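(* Let $G_0$ be a finite abelian group, let $G\leq G_0$ be a subgroup, let $\gamma,\delta\in G_0$, let $n\geq |G|$ be an integer, let $A\subseteq\mathbb Z$ be nonempty with $\gcd(A)=1$, and let $W$ be a finite sequence of integers with $\mathrm{supp}(W)=A$. Let $S$ be a sequence over $G_0$ all of whose terms lie in the coset $\gamma+G$, such that $A\cdot s\subseteq \delta+G$ for every $s\in\mathrm{supp}(S)$, and such that $|S|\geq n+\mathsf D_A(G)-1$. Then there exist a subgroup $H\leq G$, elements $\alpha\in\gamma+G$ and $\beta\in\delta+G$, and subsequences $S'\mid S$, $S''\mid S'$ and $S_0\mid S$ such that: (1) all terms of $S'$ and of $S''$ lie in $\alpha+H$, and $A\cdot s\subseteq \beta+H$ for all $s\in\mathrm{supp}(S')$; (2) $|S'|\geq \min\{|S|,\ |S|-(|G/H|-2)\}$; (3) $|S''|=|H|+\mathsf D_A(H)-1$; (4) $|H|\beta+H=\Sigma_{|H|}(W^{|H|},S'')$; (5) $\Sigma_n(W^n,S)=(n-|H|-r)\beta+\Sigma_{|H|+r}(W^{|H|+r},S_0)$, and this set is $H$-periodic (a union of $H$-cosets) and contains $n\beta$; (6) $S S'^{-1}S''\mid S_0$ and $|S_0|=|H|+r+\mathsf D_A(H)+\mathsf D_A(G/H)-2\leq |H|+r+\mathsf D_A(G)-1$, where $r=|SS'^{-1}|$ (the number of terms of $S$ not in $S'$) satisfies $r\leq\max\{0,\ |G/H|-2\}$.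
   Context: Sequences are finite multisets (elements of the free abelian monoid over a set), written multiplicatively; $|S|$ is the length, $\mathrm{supp}(S)$ the set of distinct terms, $T\mid S$ means $T$ is a subsequence (sub-multiset) of $S$, $ST^{-1}$ denotes $S$ with the terms of $T$ removed, and $T_1T_2$ denotes concatenation. For $A\subseteq\mathbb Z$ and a group element $g$, $A\cdot g=\{ag: a\in A\}$. For a sequence $W$ of integers with support $A$ and a sequence $S$ over an abelian group, $\Sigma_k(W^k,S)$ is the set of all sums $\sum_{i=1}^k a_is_i$ where $s_1\cdots s_k$ is a subsequence of $S$ of length $k$ and $a_1,\dots,a_k\in A$ (each $a_i$ chosen freely from $A$); similarly $\Sigma(W^{|S|},S)$ is the set of all such sums $\sum_{i=1}^r a_is_i$ over nontrivial (nonempty) subsequences $s_1\cdots s_r$ of $S$ with $a_i\in A$. For a finite abelian group $G$, $\mathsf D_A(G)$ is the least integer $\ell$ such that every sequence over $G$ of length $\ell$ has a nontrivial subsequence $s_1\cdots s_r$ with $\sum_{i=1}^r a_is_i=0$ for some $a_i\in A$ (i.e. $0\in\Sigma(W^{\ell},S)$); $\mathsf D_A(G/H)$ is defined likewise for the quotient group. For $k\in\mathbb Z$ and $g$ a group element, $kg+H$ is the coset; a set $X$ is $H$-periodic if $X+H=X$. *)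

theory Defs
  imports "HOL-Algebra.Coset" "HOL-Algebra.FiniteProduct" "HOL-Library.Multiset"
begin

text \<open>
  Abelian groups are written multiplicatively, so a weighted sum
  \<open>a\<^sub>1 s\<^sub>1 + \<dots> + a\<^sub>k s\<^sub>k\<close> becomes the product of the integer powers
  \<open>s\<^sub>i [^] a\<^sub>i\<close>, and a coset \<open>g + H\<close> becomes \<open>g <# H\<close>. Sequences are multisets.
\<close>

text \<open>
  \<open>wsums_of_length G A k S\<close> is \<open>\<Sigma>\<^sub>k(W\<^sup>k, S)\<close> for any integer sequence \<open>W\<close> with support \<open>A\<close>:
  in \<open>W\<^sup>k\<close> every element of \<open>A\<close> has multiplicity at least \<open>k\<close>, so each weight is chosen freely.
\<close>

definition wsums_of_length ::
    "('a, 'b) monoid_scheme \<Rightarrow> int set \<Rightarrow> nat \<Rightarrow> 'a multiset \<Rightarrow> 'a set" where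
  "wsums_of_length G A k S =
     {finprod G (\<lambda>i. s i [^]\<^bsub>G\<^esub> a i) {1..k} | (s :: nat \<Rightarrow> 'a) (a :: nat \<Rightarrow> int).
        image_mset s (mset_set {1..k}) \<subseteq># S \<and> (\<forall>i\<in>{1..k}. a i \<in> A)}"

definition wsums :: "('a, 'b) monoid_scheme \<Rightarrow> int set \<Rightarrow> 'a multiset \<Rightarrow> 'a set" where
  "wsums G A S = (\<Union>r\<in>{1..size S}. wsums_of_length G A r S)"

definition davenport :: "('a, 'b) monoid_scheme \<Rightarrow> int set \<Rightarrow> nat" where
  "davenport G A =
     (LEAST l. \<forall>S. set_mset S \<subseteq> carrier G \<and> size S = l \<longrightarrow> \<one>\<^bsub>G\<^esub> \<in> wsums G A S)"

end

theory Submission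
  imports Defs "HOL-Library.Set_Algebras" "HOL-Library.Function_Algebras"
begin

text \<open>
  All groups that occur are quotients \<open>G / K\<close> of additive subgroups \<open>K \<subseteq> G\<close> of one commutative ring, and
  a group \<open>G\<^sub>0\<close> enters as a quotient of \<open>\<int>\<close>-valued functions. Passing to a quotient then only enlarges
  \<open>K\<close>, so that an induction on the index \<open>|G / K|\<close> can use subgroups and quotients alike.

  A term \<open>s\<close> is called single modulo \<open>K\<close> if \<open>A \<cdot> s\<close> lies in one coset of \<open>K\<close>. The induction finds \<open>H\<close>, \<open>\<alpha>\<close>
  and \<open>S''\<close>; it uses two elementary facts about sumsets. First, if for every proper subgroup \<open>L\<close> at
  least \<open>|G / L| - 1\<close> of the sets of a family are not contained in a coset of \<open>L\<close>, then their sum is a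
  coset of \<open>G\<close>. Second, the Scherk--Kemperman inequality. There are three cases.

  If some single class \<open>\<alpha> + K\<close> contains at least \<open>D\<^sub>A(G / K)\<close> terms, take the smallest subgroup \<open>H\<close> with at
  most \<open>|G / H| - 2\<close> terms outside \<open>\<alpha> + H\<close>. The sets \<open>{0} \<union> A \<cdot> (s - \<alpha>)\<close> then have sum \<open>H\<close>, and weighted zero
  sums, provided by the Davenport constant, pad every representation to the right length.

  If many terms are single modulo some \<open>L \<supset> K\<close> but not modulo \<open>K\<close>, then a few of them already sum to a full
  coset of \<open>L\<close>, and the remaining terms are treated modulo \<open>L\<close>.

  Otherwise every element is again a sum of terms \<open>a (s - \<alpha>)\<close>, with \<open>\<alpha> + K\<close> the most frequent single class.
  A representation that is too long loses at least one and at most as many terms as \<open>\<alpha> + K\<close> contains, since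
  the sumset inequality leaves no room for zero to be represented uniquely.

  The formula for \<open>\<Sigma>\<^sub>n(W\<^sup>n, S)\<close> follows by padding with weighted zero sums modulo \<open>H\<close>.
\<close>

subsection \<open>Subgroups and coset counts\<close>

text \<open>The obstacle is the prescribed number of terms: sumset arguments produce sums of
  uncontrolled length. A weighted sum \<open>w\<close> of \<open>T\<close> is therefore compared
  through its normalized value \<open>w - |T| a0 \<alpha>\<close>. Modulo \<open>H\<close>, for
  \<alpha> single modulo \<open>H\<close>, this value does not change when a term of \<alpha> +
  \<open>H\<close> is added, nor when a sequence is added whose translate by -\<alpha> has a
  weighted zero sum. Lengthening thus costs nothing; shortening is the hard direction, and only the
  third case needs it. The constants come from (a - 1)(b - 1) >= 0: along K <= H <= G indices
  multiply while exceptional terms add, so bounds such as index minus 1 or index minus 2 survive a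
  tower of subgroups. The difference |G / H| - 2 is truncated, hence H = G allows no term outside
  \<alpha> + \<open>H\<close>. The condition gcd(A) = 1 enters only through
  \<open>add_subgroup_Gcd\<close>: it makes {0} together with A (s - \<alpha>) meet two cosets of L
  as soon as s lies outside \<alpha> + L. The ring structure supplies the integer multiples
  \<open>of_int a * s\<close>.\<close>

definition add_subgroup :: "'v::ab_group_add set \<Rightarrow> bool" where
  "add_subgroup K \<longleftrightarrow> 0 \<in> K \<and> (\<forall>x\<in>K. \<forall>y\<in>K. x - y \<in> K)"

text \<open>As a cardinality, \<open>ncosets K X\<close> is \<open>0\<close> if \<open>X\<close> meets infinitely many cosets.\<close>

definition ncosets :: "'v::ab_group_add set \<Rightarrow> 'v set \<Rightarrow> nat" where
  "ncosets K X = card ((\<lambda>x. x +o K) ` X)"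

definition finite_index :: "'v::ab_group_add set \<Rightarrow> 'v set \<Rightarrow> bool" where
  "finite_index K G \<longleftrightarrow>
     add_subgroup K \<and> add_subgroup G \<and> K \<subseteq> G \<and> finite ((\<lambda>x. x +o K) ` G)"

definition crosses :: "'v::ab_group_add set \<Rightarrow> 'v set \<Rightarrow> bool" where
  "crosses L B \<longleftrightarrow> (\<exists>x\<in>B. \<exists>y\<in>B. x - y \<notin> L)"

lemma mem_elt_plus: "z \<in> x +o X \<longleftrightarrow> z - x \<in> X" for x z :: "'v::ab_group_add"
  by (simp add: set_minus_plus)

lemma elt_plus_inject: "x +o X = x +o Y \<longleftrightarrow> X = Y" for x :: "'v::ab_group_add"
  by (metis set_plus_rearrange2 add.left_inverse set_zero_plus)

lemma add_subgroup_zero: "add_subgroup K \<Longrightarrow> 0 \<in> K"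
  and add_subgroup_diff: "add_subgroup K \<Longrightarrow> x \<in> K \<Longrightarrow> y \<in> K \<Longrightarrow> x - y \<in> K"
  by (auto simp: add_subgroup_def)

lemma add_subgroup_minus: "add_subgroup K \<Longrightarrow> x \<in> K \<Longrightarrow> - x \<in> K"
  using add_subgroup_diff[of K 0 x] add_subgroup_zero by force

lemma add_subgroup_add: "add_subgroup K \<Longrightarrow> x \<in> K \<Longrightarrow> y \<in> K \<Longrightarrow> x + y \<in> K"
  using add_subgroup_diff[of K x "- y"] add_subgroup_minus by force

lemma add_subgroup_diff_commute: "add_subgroup K \<Longrightarrow> x - y \<in> K \<longleftrightarrow> y - x \<in> K"
  by (metis add_subgroup_minus minus_diff_eq)

lemma add_subgroup_diff_trans:
  "add_subgroup K \<Longrightarrow> x - y \<in> K \<Longrightarrow> y - z \<in> K \<Longrightarrow> x - z \<in> K"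
  using add_subgroup_add[of K "x - y" "y - z"] by simp

lemma coset_eq_iff: "add_subgroup K \<Longrightarrow> x +o K = y +o K \<longleftrightarrow> x - y \<in> K"
  by (smt (verit, ccfv_SIG) add_subgroup_diff_commute add_subgroup_diff_trans
      add_subgroup_zero cancel_comm_monoid_add_class.diff_cancel mem_elt_plus subsetI subset_antisym)

lemma add_subgroup_absorb: "add_subgroup K \<Longrightarrow> L \<subseteq> K \<Longrightarrow> 0 \<in> L \<Longrightarrow> K + L = K"
  using add_subgroup_add by (auto simp: set_plus_def) (metis add.right_neutral)

lemma elt_plus_absorb: "add_subgroup K \<Longrightarrow> x \<in> K \<Longrightarrow> x +o K = K"
  using coset_eq_iff[of K x 0] by simp

lemma periodic_coset: "add_subgroup K \<Longrightarrow> (X + K) + K = X + K"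
  by (simp add: add.assoc add_subgroup_absorb add_subgroup_zero)

lemma subset_plus_subgroup: "add_subgroup K \<Longrightarrow> X \<subseteq> X + K"
  using add_subgroup_zero set_zero_plus2 by (metis add.commute)

lemma periodicD: "X + K = X \<Longrightarrow> x \<in> X \<Longrightarrow> k \<in> K \<Longrightarrow> x + k \<in> X"
  by (metis set_plus_intro)

lemma mem_plus_iff: "z \<in> X + K \<longleftrightarrow> (\<exists>x\<in>X. z - x \<in> K)" for z :: "'v::ab_group_add"
proof
  assume "\<exists>x\<in>X. z - x \<in> K"
  then obtain x where "x \<in> X" "z - x \<in> K" by blast
  then have "x + (z - x) \<in> X + K" by (rule set_plus_intro)
  then show "z \<in> X + K" by simp
qed (force elim!: set_plus_elim)

lemma periodic_mem_cong:
  fixes x y :: "'v::ab_group_add"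
  assumes "X + K = X" "x - y \<in> K" "y \<in> X"
  shows "x \<in> X"
  using periodicD[OF assms(1,3,2)] by (simp add: add.commute)

lemma cosets_plus: "add_subgroup K \<Longrightarrow> (\<lambda>x. x +o K) ` (X + K) = (\<lambda>x. x +o K) ` X"
  by (auto simp: set_plus_def image_iff coset_eq_iff)
     (metis add_diff_cancel_left', metis add.right_neutral add_subgroup_zero diff_self)

lemma ncosets_plus: "add_subgroup K \<Longrightarrow> ncosets K (X + K) = ncosets K X"
  by (simp add: ncosets_def cosets_plus)

lemma cosets_elt_plus: "(\<lambda>x. x +o K) ` (y +o X) = (\<lambda>C. y +o C) ` (\<lambda>x. x +o K) ` X"
  for y :: "'v::ab_group_add"
  by (auto simp: elt_set_plus_def[of y X] image_iff set_plus_rearrange2)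

lemma ncosets_elt_plus: "ncosets K (y +o X) = ncosets K X" for y :: "'v::ab_group_add"
  unfolding ncosets_def cosets_elt_plus
  by (rule card_image) (auto simp: inj_on_def elt_plus_inject)

lemma periodic_eq_iff_cosets:
  assumes K: "add_subgroup K" and X: "X + K = X" and Y: "Y + K = Y"
  shows "X \<subseteq> Y \<longleftrightarrow> (\<lambda>x. x +o K) ` X \<subseteq> (\<lambda>x. x +o K) ` Y"
proof
  assume *: "(\<lambda>x. x +o K) ` X \<subseteq> (\<lambda>x. x +o K) ` Y"
  show "X \<subseteq> Y"
  proof
    fix x assume "x \<in> X"
    then obtain y where "y \<in> Y" "x +o K = y +o K" using * by blast
    then show "x \<in> Y" using coset_eq_iff[OF K] Y periodic_mem_cong by metis
  qed
qed auto

lemma finite_indexD: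
  assumes "finite_index K G"
  shows "add_subgroup K" "add_subgroup G" "K \<subseteq> G" "finite ((\<lambda>x. x +o K) ` G)"
  using assms by (auto simp: finite_index_def)

lemma finite_cosets_coset:
  assumes "finite_index K G" "X \<subseteq> g +o G"
  shows "finite ((\<lambda>x. x +o K) ` X)"
proof (rule finite_subset[OF image_mono[OF assms(2)]])
  show "finite ((\<lambda>x. x +o K) ` (g +o G))"
    unfolding cosets_elt_plus by (intro finite_imageI finite_indexD(4)[OF assms(1)])
qed

lemma ncosets_mono:
  assumes "finite_index K G" "Y \<subseteq> g +o G" "X \<subseteq> Y"
  shows "ncosets K X \<le> ncosets K Y"
  unfolding ncosets_def by (intro card_mono finite_cosets_coset[OF assms(1,2)] image_mono assms(3))

lemma finite_index_lower:
  assumes "finite_index K G" "add_subgroup H" "K \<subseteq> H" "H \<subseteq> G"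
  shows "finite_index K H"
  using assms finite_subset[OF image_mono[OF assms(4)]] by (auto simp: finite_index_def)

lemma coset_plus_subgroup: "K \<subseteq> H \<Longrightarrow> add_subgroup K \<Longrightarrow> add_subgroup H \<Longrightarrow> (x +o K) + H = x +o H"
  by (simp add: set_plus_rearrange3 add.commute[of K] add_subgroup_absorb add_subgroup_zero)

lemma finite_index_upper:
  assumes "finite_index K G" "add_subgroup H" "K \<subseteq> H" "H \<subseteq> G"
  shows "finite_index H G"
proof -
  have "(\<lambda>x. x +o H) ` G = (\<lambda>C. C + H) ` (\<lambda>x. x +o K) ` G"
    using assms finite_indexD[OF assms(1)] by (simp add: image_image coset_plus_subgroup)
  then show ?thesis using assms by (auto simp: finite_index_def)
qed

lemma ncosets_reps:
  obtains U where "U \<subseteq> X" "inj_on (\<lambda>x. x +o K) U" "(\<lambda>x. x +o K) ` U = (\<lambda>x. x +o K) ` X" "card U = ncosets K X"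
  using subset_image_inj[of "(\<lambda>x. x +o K) ` X" "\<lambda>x. x +o K" X] that
  unfolding ncosets_def by (metis card_image order_refl)

text \<open>Representatives of the K-cosets of L, shifted by representatives of the L-cosets of X,
  hit each K-coset of X exactly once. Taking X = G gives the multiplicativity of indices.\<close>

lemma ncosets_tower:
  assumes K: "add_subgroup K" and L: "add_subgroup L" and KL: "K \<subseteq> L" and X: "X + L = X"
  shows "ncosets K X = ncosets K L * ncosets L X"
proof -
  obtain U where U: "U \<subseteq> L" "inj_on (\<lambda>x. x +o K) U" "(\<lambda>x. x +o K) ` U = (\<lambda>x. x +o K) ` L" "card U = ncosets K L"
    by (rule ncosets_reps)
  obtain V where V: "V \<subseteq> X" "inj_on (\<lambda>x. x +o L) V" "(\<lambda>x. x +o L) ` V = (\<lambda>x. x +o L) ` X" "card V = ncosets L X"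
    by (rule ncosets_reps)
  let ?f = "\<lambda>(u, v). (u + v) +o K"
  have "inj_on ?f (U \<times> V)"
  proof (rule inj_onI, clarify)
    fix u v u' v' assume h: "u \<in> U" "v \<in> V" "u' \<in> U" "v' \<in> V" "(u + v) +o K = (u' + v') +o K"
    then have k: "(u + v) - (u' + v') \<in> K" by (simp add: coset_eq_iff[OF K])
    moreover have "u - u' \<in> L" using h U(1) L add_subgroup_diff by blast
    ultimately have "(u + v) - (u' + v') - (u - u') \<in> L" using KL L add_subgroup_diff by blast
    then have "v - v' \<in> L" by (simp add: algebra_simps)
    then have "v = v'" using V(2) h by (auto simp: inj_on_def coset_eq_iff[OF L])
    then have "u - u' \<in> K" using k by simp
    then have "u = u'" using U(2) h by (auto simp: inj_on_def coset_eq_iff[OF K])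
    then show "u = u' \<and> v = v'" using \<open>v = v'\<close> by simp
  qed
  moreover have "?f ` (U \<times> V) = (\<lambda>x. x +o K) ` X"
  proof (intro equalityI subsetI)
    fix C assume "C \<in> ?f ` (U \<times> V)"
    then obtain u v where "u \<in> L" "v \<in> X" "C = (u + v) +o K" using U(1) V(1) by blast
    then show "C \<in> (\<lambda>x. x +o K) ` X" using periodicD[OF X] by (metis add.commute imageI)
  next
    fix C assume "C \<in> (\<lambda>x. x +o K) ` X"
    then obtain x where x: "x \<in> X" "C = x +o K" by blast
    then obtain v where v: "v \<in> V" "x +o L = v +o L" using V(3) by (metis (no_types, lifting) imageE imageI)
    then have "x - v \<in> L" by (simp add: coset_eq_iff[OF L])
    then obtain u where u: "u \<in> U" "(x - v) +o K = u +o K" using U(3) by (metis (no_types, lifting) imageE imageI)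
    then have "x +o K = (u + v) +o K" using coset_eq_iff[OF K] by (metis diff_diff_eq2 diff_add_eq_diff_diff_swap add.commute)
    then show "C \<in> ?f ` (U \<times> V)" using u v x by force
  qed
  ultimately have "card (U \<times> V) = ncosets K X" unfolding ncosets_def by (metis card_image)
  then show ?thesis using U V by (simp add: card_cartesian_product)
qed

lemma index_tower:
  assumes "finite_index K G" "add_subgroup H" "K \<subseteq> H" "H \<subseteq> G"
  shows "ncosets K G = ncosets K H * ncosets H G"
  using assms finite_indexD[OF assms(1)] add_subgroup_absorb[of G H] add_subgroup_zero
  by (intro ncosets_tower) auto

lemma index_self: "add_subgroup K \<Longrightarrow> ncosets K K = 1"
proof -
  assume "add_subgroup K"
  then have "(\<lambda>x. x +o K) ` K = {K}" using elt_plus_absorb[of K] add_subgroup_zero[of K] by force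
  then show ?thesis by (simp add: ncosets_def)
qed

lemma index_pos: "finite_index K G \<Longrightarrow> 1 \<le> ncosets K G"
  using finite_indexD[of K G] add_subgroup_zero[of G]
  by (metis One_nat_def Suc_leI card_gt_0_iff emptyE image_is_empty ncosets_def)

lemma index_ge_2:
  assumes fi: "finite_index K G" and ne: "K \<noteq> G"
  shows "2 \<le> ncosets K G"
proof -
  note f = finite_indexD[OF fi]
  obtain g where g: "g \<in> G" "g \<notin> K" using f ne by blast
  have "card {0 +o K, g +o K} = 2" using g coset_eq_iff[OF f(1), of g 0] by simp
  moreover have "{0 +o K, g +o K} \<subseteq> (\<lambda>x. x +o K) ` G" using g f(2) add_subgroup_zero by blast
  ultimately show ?thesis unfolding ncosets_def using card_mono[OF f(4)] by metis
qed

lemma full_coset_if_index_le: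
  assumes fi: "finite_index L G" and X: "X + L = X" "X \<subseteq> g +o G" "ncosets L G \<le> ncosets L X"
  shows "X = g +o G"
proof (rule equalityI)
  note f = finite_indexD[OF fi]
  let ?c = "\<lambda>x. x +o L"
  have p: "(g +o G) + L = g +o G" using f by (simp add: set_plus_rearrange3 add_subgroup_absorb add_subgroup_zero)
  have "?c ` X = ?c ` (g +o G)"
    using X ncosets_elt_plus[of L g G] unfolding ncosets_def
    by (intro card_seteq finite_cosets_coset[OF fi order_refl] image_mono) auto
  then show "g +o G \<subseteq> X" using periodic_eq_iff_cosets[OF f(1) p X(1)] by simp
qed (fact X(2))

subsection \<open>Sums of families of sets\<close>

lemma sumset_nonempty: "\<forall>s\<in>#R. f s \<noteq> {} \<Longrightarrow> (\<Sum>s\<in>#R. f s) \<noteq> ({} :: 'v::ab_group_add set)"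
proof (induction R)
  case (add x R)
  then obtain a b where "a \<in> f x" "b \<in> (\<Sum>s\<in>#R. f s)" by auto
  then show ?case by (metis empty_iff image_mset_add_mset set_plus_intro sum_mset.insert)
qed simp

lemma sumset_in_coset:
  fixes f :: "'i \<Rightarrow> 'v::ab_group_add set"
  assumes "add_subgroup G" "\<forall>s\<in>#R. \<not> crosses G (f s)"
  shows "\<exists>g. (\<Sum>s\<in>#R. f s) \<subseteq> g +o G"
  using assms(2)
proof (induction R)
  case empty
  then show ?case using add_subgroup_zero[OF assms(1)] by (auto intro!: exI[of _ 0])
next
  case (add x R)
  then obtain g where g: "(\<Sum>s\<in>#R. f s) \<subseteq> g +o G" by auto
  show ?case
  proof (cases "f x = {}")
    case False
    then obtain y where "y \<in> f x" by blast
    then have "f x \<subseteq> y +o G" using add.prems by (auto simp: crosses_def mem_elt_plus)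
    then have "(\<Sum>s\<in>#add_mset x R. f s) \<subseteq> (y +o G) + (g +o G)" using g by (simp add: set_plus_mono2)
    then show ?thesis by (metis assms(1) set_plus_rearrange add_subgroup_absorb add_subgroup_zero order_refl)
  qed simp
qed

lemma stabilizes_superset:
  fixes x :: "'v::ab_group_add"
  assumes "x +o (X + L) = X + L"
  shows "x +o ((X + Y) + L) = (X + Y) + L"
proof -
  have "(X + Y) + L = (X + L) + Y" by (simp add: ac_simps)
  then show ?thesis using assms by (metis set_plus_rearrange3)
qed

text \<open>\<open>R'\<close> is a largest subfamily in which every set pays for at least one new
  coset. A set that cannot be added without breaking this count enlarges nothing, so its differences
  must stabilize the partial sum.\<close>

lemma sumset_greedy:
  fixes f :: "'i \<Rightarrow> 'v::ab_group_add set"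
  assumes fi: "finite_index L G" and ne: "\<forall>s\<in>#R. f s \<noteq> {} \<and> \<not> crosses G (f s)"
  obtains R' where "R' \<subseteq># R" "size R' + 1 \<le> ncosets L (\<Sum>s\<in>#R'. f s)"
    "\<And>s x y. s \<in># R - R' \<Longrightarrow> x \<in> f s \<Longrightarrow> y \<in> f s \<Longrightarrow>
       (x - y) +o ((\<Sum>s\<in>#R'. f s) + L) = (\<Sum>s\<in>#R'. f s) + L"
proof -
  note fD = finite_indexD[OF fi]
  let ?S = "\<lambda>R. \<Sum>s\<in>#R. f s"
  let ?P = "\<lambda>R'. R' \<subseteq># R \<and> size R' + 1 \<le> ncosets L (?S R')"
  have P0: "?P {#}" by (simp add: ncosets_def)
  have "\<exists>R'. ?P R' \<and> (\<forall>M. ?P M \<longrightarrow> size M \<le> size R')"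
    using P0 ex_has_greatest_nat[of ?P "{#}" size "Suc (size R)"] by (auto dest!: size_mset_mono simp: less_Suc_eq_le)
  then obtain R' where R': "?P R'" and mx: "\<And>M. ?P M \<Longrightarrow> size M \<le> size R'" by auto
  show ?thesis
  proof (rule that[of R'])
    fix s x y assume s: "s \<in># R - R'" and x: "x \<in> f s" and y: "y \<in> f s"
    let ?X = "?S R' + L"
    have "R' + {#s#} \<subseteq># R' + (R - R')" using s by (simp only: mset_subset_eq_mono_add_left_cancel mset_subset_eq_single)
    then have sub: "add_mset s R' \<subseteq># R" using R' by simp
    \<comment> \<open>Maximality of \<open>R'\<close>: after adding s the number of cosets is the
      same as before.\<close>
    then have "\<not> size R' + 2 \<le> ncosets L (?S (add_mset s R'))" using mx[of "add_mset s R'"] by auto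
    then have "ncosets L (f s + ?X) \<le> ncosets L ?X"
      using R' by (simp add: ncosets_plus[OF fD(1)] add.assoc[symmetric])
    moreover have "\<exists>g. ?S (add_mset s R') \<subseteq> g +o G"
      by (rule sumset_in_coset[OF fD(2)]) (meson mset_subset_eqD ne sub)
    then obtain g where "?S (add_mset s R') \<subseteq> g +o G" by blast
    then have "?S (add_mset s R') + L \<subseteq> (g +o G) + L" by (intro set_plus_mono2) auto
    then have g: "f s + ?X \<subseteq> g +o G"
      using fD by (simp add: set_plus_rearrange3 add_subgroup_absorb add_subgroup_zero add.assoc)
    \<comment> \<open>Each translate lies in \<open>f s + ?X\<close> and has as many cosets, so all
      translates by elements of \<open>f s\<close> coincide.\<close>
    have eq: "z +o ?X = f s + ?X" if z: "z \<in> f s" for z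
    proof -
      have i: "z +o ?X \<subseteq> f s + ?X" using z by (rule set_plus_mono3)
      have p: "(z +o ?X) + L = z +o ?X" "(f s + ?X) + L = f s + ?X"
        by (simp_all add: set_plus_rearrange3 add.assoc add_subgroup_absorb[OF fD(1)] add_subgroup_zero[OF fD(1)])
      have "(\<lambda>x. x +o L) ` (z +o ?X) = (\<lambda>x. x +o L) ` (f s + ?X)"
        using calculation ncosets_elt_plus[of L z ?X] unfolding ncosets_def
        by (intro card_seteq finite_cosets_coset[OF fi g] image_mono i) auto
      then show ?thesis using i periodic_eq_iff_cosets[OF fD(1) p(2,1)] by auto
    qed
    have "(x - y) +o (y +o ?X) = y +o ?X" unfolding set_plus_rearrange2 diff_add_cancel using eq[OF x] eq[OF y] by simp
    then have "y +o ((x - y) +o ?X) = y +o ?X" by (simp add: set_plus_rearrange2 add.commute)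
    then show "(x - y) +o ?X = ?X" by (simp add: elt_plus_inject)
  qed (use R' in auto)
qed

text \<open>A weak form of Kneser's theorem. A set that crosses L cannot be left out by
  \<open>sumset_greedy\<close>, because one of its differences would stabilize the whole sum without
  lying in L. So all crossing sets are among those that pay for a new coset.\<close>

lemma sumset_size_if_aperiodic:
  fixes f :: "'i \<Rightarrow> 'v::ab_group_add set"
  assumes fi: "finite_index L G" and ne: "\<forall>s\<in>#R. f s \<noteq> {} \<and> \<not> crosses G (f s)"
    and stab: "\<And>x. x \<in> G \<Longrightarrow> x +o ((\<Sum>s\<in>#R. f s) + L) = (\<Sum>s\<in>#R. f s) + L \<Longrightarrow> x \<in> L"
  shows "size {#s \<in># R. crosses L (f s)#} + 1 \<le> ncosets L (\<Sum>s\<in>#R. f s)"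
proof -
  let ?S = "\<lambda>R. \<Sum>s\<in>#R. f s"
  obtain R' where R': "R' \<subseteq># R" "size R' + 1 \<le> ncosets L (?S R')"
    and st: "\<And>s x y. s \<in># R - R' \<Longrightarrow> x \<in> f s \<Longrightarrow> y \<in> f s \<Longrightarrow> (x - y) +o (?S R' + L) = ?S R' + L"
    using sumset_greedy[OF fi ne] by metis
  have R: "R = R' + (R - R')" using R' by simp
  have SR: "?S R = ?S R' + ?S (R - R')" by (subst R) (simp only: image_mset_union sum_mset.union)
  have "\<not> crosses L (f s)" if s: "s \<in># R - R'" for s
  proof
    assume "crosses L (f s)"
    then obtain x y where xy: "x \<in> f s" "y \<in> f s" "x - y \<notin> L" by (auto simp: crosses_def)
    have "(x - y) +o (?S R + L) = ?S R + L" unfolding SR using stabilizes_superset[OF st[OF s xy(1,2)]] .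
    moreover have "x - y \<in> G" using ne s xy in_diffD crosses_def by metis
    ultimately show False using stab xy by blast
  qed
  then have "set_mset {#s \<in># R - R'. crosses L (f s)#} = {}" unfolding set_mset_filter by blast
  then have "{#s \<in># R - R'. crosses L (f s)#} = {#}" by (simp only: set_mset_eq_empty_iff)
  then have "{#s \<in># R. crosses L (f s)#} = {#s \<in># R'. crosses L (f s)#}"
    by (subst R) (simp only: filter_union_mset, simp)
  then have "size {#s \<in># R. crosses L (f s)#} + 1 \<le> ncosets L (?S R')"
    using R'(2) size_filter_mset_lesseq[of "\<lambda>s. crosses L (f s)" R'] by (metis add_le_mono1 order_trans)
  also have "\<dots> \<le> ncosets L (?S R)"
  proof -
    have "?S (R - R') \<noteq> {}" by (rule sumset_nonempty) (meson in_diffD ne)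
    then obtain z where "z \<in> ?S (R - R')" by blast
    then have "z +o ?S R' \<subseteq> ?S R" unfolding SR by (simp add: set_plus_mono4)
    moreover obtain g where "?S R \<subseteq> g +o G" using sumset_in_coset[OF finite_indexD(2)[OF fi]] ne by metis
    ultimately show ?thesis using ncosets_mono[OF fi, of "?S R" g "z +o ?S R'"] ncosets_elt_plus by metis
  qed
  finally show ?thesis .
qed

definition stabilizer_in :: "'v::ab_group_add set \<Rightarrow> 'v set \<Rightarrow> 'v set" where
  "stabilizer_in G Z = {x \<in> G. x +o Z = Z}"

lemma add_subgroup_stabilizer_in: "add_subgroup G \<Longrightarrow> add_subgroup (stabilizer_in G Z)"
proof -
  assume G: "add_subgroup G"
  have "(x - y) +o Z = Z" if "x +o Z = Z" "y +o Z = Z" for x y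
  proof -
    have "(x - y) +o (y +o Z) = x +o Z" by (simp only: set_plus_rearrange2 diff_add_cancel)
    then show ?thesis using that by simp
  qed
  then show ?thesis using G add_subgroup_zero[OF G] add_subgroup_diff[OF G]
    unfolding add_subgroup_def stabilizer_in_def by simp
qed

lemma stabilizer_in_props:
  assumes fi: "finite_index K G" and Z: "Z + K = Z" "Z \<noteq> {}"
  defines "L \<equiv> stabilizer_in G Z"
  shows "add_subgroup L" "K \<subseteq> L" "L \<subseteq> G" "Z + L = Z" "\<And>x. x \<in> G \<Longrightarrow> x +o Z = Z \<Longrightarrow> x \<in> L"
proof -
  note f = finite_indexD[OF fi]
  show "add_subgroup L" unfolding L_def by (rule add_subgroup_stabilizer_in[OF f(2)])
  have "x +o Z = Z" if "x \<in> K" for x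
    by (metis Z(1) add.commute elt_plus_absorb[OF f(1) that] set_plus_rearrange3)
  then show "K \<subseteq> L" using f(3) by (auto simp: L_def stabilizer_in_def)
  show "L \<subseteq> G" by (auto simp: L_def stabilizer_in_def)
  show "x \<in> L" if "x \<in> G" "x +o Z = Z" for x using that by (simp add: L_def stabilizer_in_def)
  show "Z + L = Z"
  proof
    show "Z + L \<subseteq> Z" 
    proof
      fix z assume "z \<in> Z + L"
      then obtain w x where "w \<in> Z" "x +o Z = Z" "z = x + w"
        by (auto simp: L_def stabilizer_in_def add.commute elim!: set_plus_elim)
      then show "z \<in> Z" using set_plus_intro2[of w Z x] by simp
    qed
    show "Z \<subseteq> Z + L" using \<open>add_subgroup L\<close> by (rule subset_plus_subgroup)
  qed
qed

text \<open>Modulo the stabilizer of the sum, every set that is not in one coset enlarges some partial sum.\<close>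

theorem sumset_full:
  fixes f :: "'i \<Rightarrow> 'v::ab_group_add set"
  assumes fi: "finite_index K G" and ne: "\<forall>s\<in>#R. f s \<noteq> {} \<and> \<not> crosses G (f s)"
    and cr: "\<And>L. add_subgroup L \<Longrightarrow> K \<subseteq> L \<Longrightarrow> L \<subset> G \<Longrightarrow>
       ncosets L G \<le> size {#s \<in># R. crosses L (f s)#} + 1"
  shows "\<exists>g. (\<Sum>s\<in>#R. f s) + K = g +o G"
proof -
  note fD = finite_indexD[OF fi]
  define Z where "Z = (\<Sum>s\<in>#R. f s) + K"
  obtain g where "(\<Sum>s\<in>#R. f s) \<subseteq> g +o G" using sumset_in_coset[OF fD(2)] ne by metis
  then have "Z \<subseteq> (g +o G) + K" unfolding Z_def by (intro set_plus_mono2) auto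
  then have g: "Z \<subseteq> g +o G" using fD by (simp add: set_plus_rearrange3 add_subgroup_absorb add_subgroup_zero)
  have "(\<Sum>s\<in>#R. f s) \<noteq> {}" using sumset_nonempty[of R f] ne by blast
  then have Z0: "Z \<noteq> {}" unfolding Z_def using subset_plus_subgroup[OF fD(1)] by blast
  have ZK: "Z + K = Z" unfolding Z_def by (rule periodic_coset[OF fD(1)])
  define L where "L = stabilizer_in G Z"
  note st = stabilizer_in_props[OF fi ZK Z0, folded L_def]
  have fL: "finite_index L G" using finite_index_upper[OF fi st(1-3)] .
  \<comment> \<open>K may be replaced by L here, since K <= L and Z is already L-periodic.\<close>
  have ZL: "Z = (\<Sum>s\<in>#R. f s) + L" 
    by (metis Z_def add.assoc add.commute add_subgroup_absorb fD(1) add_subgroup_zero st(1) st(2) st(4))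
  have "ncosets L G \<le> ncosets L Z"
  proof (cases "L = G")
    case True
    have "ncosets L Z \<noteq> 0" using Z0 finite_cosets_coset[OF fL g] by (simp add: ncosets_def)
    then show ?thesis using True index_self[OF fD(2)] by simp
  next
    case False
    have "ncosets L G \<le> size {#s \<in># R. crosses L (f s)#} + 1" using cr st False by blast
    also have "\<dots> \<le> ncosets L (\<Sum>s\<in>#R. f s)" 
      by (rule sumset_size_if_aperiodic[OF fL ne]) (use st(5) ZL in auto)
    finally show ?thesis by (metis ZL ncosets_plus st(1))
  qed
  then show ?thesis using full_coset_if_index_le[OF fL st(4) g] Z_def by blast
qed

lemma sumset_prune:
  fixes f :: "'i \<Rightarrow> 'v::ab_group_add set"
  assumes fi: "finite_index K G" and ne: "\<forall>s\<in>#R. 0 \<in> f s \<and> f s \<subseteq> G"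
    and full: "(\<Sum>s\<in>#R. f s) + K = G"
  obtains R' where "R' \<subseteq># R" "size R' + 1 \<le> ncosets K G" "(\<Sum>s\<in>#R'. f s) + K = G"
proof -
  note fD = finite_indexD[OF fi]
  let ?S = "\<lambda>R. \<Sum>s\<in>#R. f s"
  have ne': "\<forall>s\<in>#R. f s \<noteq> {} \<and> \<not> crosses G (f s)"
    using ne add_subgroup_diff[OF fD(2)] by (fastforce simp: crosses_def)
  obtain R' where R': "R' \<subseteq># R" "size R' + 1 \<le> ncosets K (?S R')"
    and st: "\<And>s x y. s \<in># R - R' \<Longrightarrow> x \<in> f s \<Longrightarrow> y \<in> f s \<Longrightarrow> (x - y) +o (?S R' + K) = ?S R' + K"
    using sumset_greedy[OF fi ne'] by metis
  \<comment> \<open>Since 0 lies in a left-out set, its elements are themselves stabilizing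
    differences.\<close>
  have *: "?S M + (?S R' + K) \<subseteq> ?S R' + K" if "M \<subseteq># R - R'" for M
    using that
  proof (induction M)
    case (add s M)
    then have "M \<subseteq># R - R'" "s \<in># R - R'" 
      by (metis mset_subset_eq_insertD subset_mset.less_imp_le, metis mset_subset_eq_insertD)
    then have "0 \<in> f s" using ne in_diffD by metis
    have "f s + (?S R' + K) \<subseteq> ?S R' + K"
    proof
      fix z assume "z \<in> f s + (?S R' + K)"
      then obtain x w where "x \<in> f s" "w \<in> ?S R' + K" "z = x + w" by (rule set_plus_elim)
      then show "z \<in> ?S R' + K" using st[OF \<open>s \<in># R - R'\<close> \<open>x \<in> f s\<close> \<open>0 \<in> f s\<close>] by (metis diff_zero set_plus_intro2)
    qed
    moreover have "?S M + (?S R' + K) \<subseteq> ?S R' + K" using add \<open>M \<subseteq># R - R'\<close> by blast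
    ultimately have "f s + (?S M + (?S R' + K)) \<subseteq> ?S R' + K" by (meson dual_order.trans order_refl set_plus_mono2)
    then show ?case by (simp add: add.assoc)
  qed simp
  have "R = R' + (R - R')" using R' by simp
  then have "?S R = ?S (R - R') + ?S R'" by (metis image_mset_union sum_mset.union add.commute)
  then have "G \<subseteq> ?S R' + K" using *[OF subset_mset.order_refl] full by (simp add: add.assoc)
  moreover have "?S M \<subseteq> G" if "M \<subseteq># R" for M
    using that
  proof (induction M)
    case (add s M)
    then have "M \<subseteq># R" "s \<in># R" 
      by (metis mset_subset_eq_insertD subset_mset.less_imp_le, metis mset_subset_eq_insertD)
    then have "f s + ?S M \<subseteq> G + G" using add ne by (intro set_plus_mono2) auto
    then show ?case by (simp add: add_subgroup_absorb[OF fD(2)] add_subgroup_zero[OF fD(2)])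
  qed (simp add: add_subgroup_zero[OF fD(2)])
  then have "?S R' \<subseteq> G" using R' by blast
  then have "?S R' + K \<subseteq> G + G" using fD(3) by (intro set_plus_mono2) auto
  then have "?S R' + K \<subseteq> G" by (simp add: add_subgroup_absorb[OF fD(2)] add_subgroup_zero[OF fD(2)])
  ultimately have eq: "?S R' + K = G" by blast
  then have "ncosets K (?S R') = ncosets K G" using ncosets_plus[OF fD(1)] by metis
  then show ?thesis using that R' eq by metis
qed

subsection \<open>The Scherk--Kemperman inequality\<close>

lemma ncosets_Un_Int:
  assumes fi: "finite_index K G" and X: "X + K = X" "X \<subseteq> G" and Y: "Y + K = Y" "Y \<subseteq> G"
  shows "ncosets K (X \<union> Y) + ncosets K (X \<inter> Y) = ncosets K X + ncosets K Y"
proof -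
  note f = finite_indexD[OF fi]
  have "(\<lambda>x. x +o K) ` (X \<inter> Y) = (\<lambda>x. x +o K) ` X \<inter> (\<lambda>x. x +o K) ` Y"
  proof (intro equalityI subsetI)
    fix C assume "C \<in> (\<lambda>x. x +o K) ` X \<inter> (\<lambda>x. x +o K) ` Y"
    then obtain x y where "x \<in> X" "y \<in> Y" "C = x +o K" "x +o K = y +o K" by blast
    then show "C \<in> (\<lambda>x. x +o K) ` (X \<inter> Y)" using periodic_mem_cong[OF Y(1)] coset_eq_iff[OF f(1)] by blast
  qed auto
  moreover have "finite ((\<lambda>x. x +o K) ` X)" "finite ((\<lambda>x. x +o K) ` Y)"
    using X Y finite_subset[OF image_mono f(4)] by blast+
  ultimately show ?thesis unfolding ncosets_def image_Un using card_Un_Int by metis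
qed

text \<open>The Dyson transform of \<open>(X, Y)\<close> by \<open>e \<in> X\<close> keeps the uniqueness of the representation of zero.\<close>

theorem scherk_kemperman:
  assumes fi: "finite_index K G"
    and X: "X + K = X" "X \<subseteq> G" "0 \<in> X" and Y: "Y + K = Y" "Y \<subseteq> G" "0 \<in> Y"
    and triv: "\<And>x y. x \<in> X \<Longrightarrow> y \<in> Y \<Longrightarrow> x + y \<in> K \<Longrightarrow> y \<in> K"
  shows "ncosets K X + ncosets K Y \<le> ncosets K (X + Y) + 1"
  using X Y triv
proof (induction "ncosets K Y" arbitrary: X Y rule: less_induct)
  case less
  note f = finite_indexD[OF fi]
  have XY: "X + Y \<subseteq> G"
    using set_plus_mono2[OF less.prems(2,5)] add_subgroup_absorb[OF f(2)] add_subgroup_zero[OF f(2)] by blast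
  show ?case
  proof (cases "\<exists>e\<in>X. \<not> e +o Y \<subseteq> X")
    case True
    then obtain e where e: "e \<in> X" "\<not> e +o Y \<subseteq> X" by blast
    \<comment> \<open>Coset counts of the pair are preserved in total and the sum does not grow,
      while Y loses a coset because \<open>e +o Y\<close> is not contained in X; the induction is on
      Y.\<close>
    define X' where "X' = X \<union> (e +o Y)"
    define Y' where "Y' = Y \<inter> ((- e) +o X)"
    have eY: "(e +o Y) + K = e +o Y" "((- e) +o X) + K = (- e) +o X"
      using less.prems by (simp_all add: set_plus_rearrange3)
    have eG: "e \<in> G" "- e \<in> G" using e less.prems f add_subgroup_minus by blast+
    have sub: "e +o Y \<subseteq> G" "(- e) +o X \<subseteq> G"
      using less.prems elt_plus_absorb[OF f(2) eG(1)] elt_plus_absorb[OF f(2) eG(2)] by (metis set_plus_mono)+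
    have pX': "X' + K = X'" using less.prems eY by (simp add: X'_def Un_set_plus)
    have pY': "Y' + K = Y'"
    proof
      show "Y' + K \<subseteq> Y'"
        using periodicD[OF less.prems(4)] periodicD[OF eY(2)] by (auto simp: Y'_def elim!: set_plus_elim)
    qed (rule subset_plus_subgroup[OF f(1)])
    have iX': "X' \<subseteq> G" "0 \<in> X'" using less.prems sub by (auto simp: X'_def)
    have iY': "Y' \<subseteq> G" "0 \<in> Y'" using less.prems e by (auto simp: Y'_def mem_elt_plus)
    have Y'e: "e +o Y' = (e +o Y) \<inter> X" by (auto simp: Y'_def mem_elt_plus)
    have lt: "ncosets K Y' < ncosets K Y"
    proof -
      have "(\<lambda>x. x +o K) ` Y' \<subset> (\<lambda>x. x +o K) ` Y"
      proof
        show "(\<lambda>x. x +o K) ` Y' \<subseteq> (\<lambda>x. x +o K) ` Y" by (auto simp: Y'_def)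
        have "\<not> Y \<subseteq> Y'" using e(2) Y'e by (metis inf.absorb_iff1 inf_le2 le_inf_iff set_plus_mono subset_trans)
        then show "(\<lambda>x. x +o K) ` Y' \<noteq> (\<lambda>x. x +o K) ` Y"
          using periodic_eq_iff_cosets[OF f(1) less.prems(4) pY'] by auto
      qed
      then show ?thesis unfolding ncosets_def
        using less.prems(5) finite_subset[OF image_mono f(4)] by (intro psubset_card_mono) auto
    qed
    \<comment> \<open>For x in the new part, x - e lies in Y and y + e in X, so the roles are
      exchanged: uniqueness first gives x - e in K, hence e + y in K, and a second use with e gives
      y in K.\<close>
    have tr: "y \<in> K" if xy: "x \<in> X'" "y \<in> Y'" "x + y \<in> K" for x y
    proof (cases "x \<in> X")
      case True
      then show ?thesis using xy less.prems(7) by (auto simp: Y'_def)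
    next
      case False
      then have x: "x - e \<in> Y" using xy by (auto simp: X'_def mem_elt_plus)
      have y: "y \<in> Y" "y + e \<in> X" using xy by (auto simp: Y'_def mem_elt_plus)
      have "(y + e) + (x - e) \<in> K" using xy by (simp add: add.commute)
      then have xe: "x - e \<in> K" using less.prems(7) x y by blast
      then have "e - x \<in> K" using add_subgroup_diff_commute[OF f(1)] by blast
      then have "(x + y) + (e - x) \<in> K" using xy(3) add_subgroup_add[OF f(1)] by blast
      then have "e + y \<in> K" by (simp add: algebra_simps)
      then show ?thesis using less.prems(7)[OF e(1) y(1)] by blast
    qed
    have IH: "ncosets K X' + ncosets K Y' \<le> ncosets K (X' + Y') + 1"
      by (rule less.hyps[OF lt pX' iX' pY' iY']) (fact tr)
    have "X' + Y' \<subseteq> X + Y"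
    proof
      fix z assume "z \<in> X' + Y'"
      then obtain x y where z: "z = x + y" "x \<in> X'" "y \<in> Y'" by (rule set_plus_elim)
      show "z \<in> X + Y"
      proof (cases "x \<in> X")
        case False
        then have "(y + e) + (x - e) \<in> X + Y" using z by (intro set_plus_intro) (auto simp: X'_def Y'_def mem_elt_plus)
        then show ?thesis using z by (simp add: add.commute)
      qed (use z in \<open>auto simp: Y'_def\<close>)
    qed
    then have "ncosets K (X' + Y') \<le> ncosets K (X + Y)" using ncosets_mono[OF fi, of "X + Y" 0] XY by simp
    moreover have "ncosets K X' + ncosets K Y' = ncosets K X + ncosets K Y"
      using ncosets_Un_Int[OF fi less.prems(1,2) eY(1) sub(1)] ncosets_elt_plus[of K e] Y'e
      by (metis X'_def inf_commute)
    ultimately show ?thesis using IH by simp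
  next
    \<comment> \<open>Now X + Y is contained in X, so every y in Y stabilizes X. Then -y lies in X,
      and -y + y = 0 forces y into K.\<close>
    case False
    have "Y \<subseteq> K"
    proof
      fix y assume y: "y \<in> Y"
      have "y +o X \<subseteq> X" using False y by (auto simp: mem_elt_plus) (metis add.commute diff_add_cancel diff_diff_eq2 mem_elt_plus subsetD add_diff_cancel)
      moreover have "X \<subseteq> 0 +o G" using less.prems by simp
      moreover have p: "(y +o X) + K = y +o X" using less.prems by (simp add: set_plus_rearrange3)
      moreover have "(\<lambda>x. x +o K) ` (y +o X) = (\<lambda>x. x +o K) ` X"
        using ncosets_elt_plus[of K y X] unfolding ncosets_def
        by (intro card_seteq finite_cosets_coset[OF fi calculation(2)] image_mono calculation(1)) auto
      ultimately have "X \<subseteq> y +o X" using periodic_eq_iff_cosets[OF f(1) less.prems(1) p] by auto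
      then have "- y \<in> X" using less.prems(3) by (auto simp: mem_elt_plus subset_iff)
      then show "y \<in> K" using less.prems(7)[of "- y" y] y add_subgroup_zero[OF f(1)] by simp
    qed
    then have YK: "Y = K" using less.prems(4,6) by (metis add.commute set_zero_plus2 subset_antisym)
    show ?thesis unfolding YK using less.prems(1) index_self[OF f(1)] by simp
  qed
qed

subsection \<open>Weighted sums\<close>

lemma submultiset_of_size_between:
  assumes "M \<subseteq># S" "size M \<le> n" "n \<le> size S"
  obtains T where "M \<subseteq># T" "T \<subseteq># S" "size T = n"
proof -
  have "\<exists>T. T \<subseteq># N \<and> size T = k" if "k \<le> size N" for k and N :: "'a multiset"
    using that
  proof (induction k)
    case (Suc k)
    then obtain T where T: "T \<subseteq># N" "size T = k" by auto
    then have "N - T \<noteq> {#}" using Suc.prems by (auto simp: Diff_eq_empty_iff_mset dest: size_mset_mono)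
    then obtain x where "x \<in># N - T" by blast
    then have "T + {#x#} \<subseteq># T + (N - T)" by (simp only: mset_subset_eq_mono_add_left_cancel mset_subset_eq_single)
    then show ?case using T by (intro exI[of _ "T + {#x#}"]) simp
  qed auto
  then obtain T where T: "T \<subseteq># S - M" "size T = n - size M"
    using assms by (metis diff_le_mono size_Diff_submset)
  show ?thesis
  proof (rule that[of "M + T"])
    show "M + T \<subseteq># S" using T assms(1) by (metis subset_mset.add_diff_inverse mset_subset_eq_mono_add_left_cancel)
  qed (use T assms in auto)
qed

lemma submultiset_of_size:
  assumes "n \<le> size S"
  obtains T where "T \<subseteq># S" "size T = n"
  using submultiset_of_size_between[of "{#}" S n] assms by auto

lemma submultiset_image_msetE:
  assumes "N \<subseteq># image_mset f M"
  obtains M' where "M' \<subseteq># M" "N = image_mset f M'"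
proof -
  from assms obtain P where "image_mset f M = N + P" by (metis subset_mset.add_diff_inverse)
  then obtain M1 M2 where "M = M1 + M2" "N = image_mset f M1"
    by (metis image_mset_eq_plusD)
  then show ?thesis using that[of M1] by simp
qed

lemma submultiset_plusE:
  assumes "U \<subseteq># R + S"
  obtains T V where "U = T + V" "T \<subseteq># R" "V \<subseteq># S"
proof (rule that[of "U \<inter># R" "U - R"])
  show "U = U \<inter># R + (U - R)" by (auto simp: multiset_eq_iff min_def)
  show "U - R \<subseteq># S" using assms by (simp add: subset_eq_diff_conv add.commute)
qed simp

text \<open>This is (a - 1)(b - 1) >= 0. It compares sums of exceptional terms with products of
  indices throughout the induction.\<close>

lemma add_le_mult_plus_one: "1 \<le> a \<Longrightarrow> 1 \<le> b \<Longrightarrow> a + b \<le> a * b + (1::nat)"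
  by (cases a; cases b) auto

lemma filter_mset_subset_filter_mset: "(\<And>x. P x \<Longrightarrow> Q x) \<Longrightarrow> filter_mset P M \<subseteq># filter_mset Q M"
  by (auto simp: subseteq_mset_def)

lemma filter_mset_empty_if: "(\<And>x. x \<in># M \<Longrightarrow> \<not> P x) \<Longrightarrow> filter_mset P M = {#}"
  by (simp flip: set_mset_eq_empty_iff)

lemma add_subgroup_of_int:
  fixes x :: "'v::comm_ring_1"
  assumes K: "add_subgroup K" and x: "x \<in> K"
  shows "of_int m * x \<in> K"
proof -
  have n: "of_nat n * x \<in> K" for n
    by (induction n) (simp_all add: add_subgroup_zero[OF K] add_subgroup_add[OF K] x distrib_right)
  show ?thesis
  proof (cases m)
    case (nonneg k)
    then show ?thesis using n[of k] by simp
  next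
    case (neg k)
    then have "of_int m * x = - (of_nat (Suc k) * x)" by (metis mult_minus_left of_int_minus of_int_of_nat_eq)
    then show ?thesis using add_subgroup_minus[OF K n[of "Suc k"]] by metis
  qed
qed

text \<open>The least positive d with d x in L divides every a in A, because the remainder of a
  modulo d would be a smaller candidate. So d divides gcd(A) = 1.\<close>

lemma add_subgroup_Gcd:
  fixes x :: "'v::comm_ring_1"
  assumes L: "add_subgroup L" and g: "Gcd A = (1 :: int)" and A: "\<And>a. a \<in> A \<Longrightarrow> of_int a * x \<in> L"
  shows "x \<in> L"
proof -
  let ?P = "\<lambda>d::nat. d > 0 \<and> of_int (int d) * x \<in> L"
  obtain a where a: "a \<in> A" "a \<noteq> 0" using g by (metis Gcd_0_iff zero_neq_one insertCI subsetI)
  have "of_int \<bar>a\<bar> * x \<in> L"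
    using A[OF a(1)] add_subgroup_minus[OF L A[OF a(1)]] by (cases "a \<ge> 0") auto
  then have "?P (nat \<bar>a\<bar>)" using a by simp
  define d where "d = (LEAST d. ?P d)"
  have d: "?P d" unfolding d_def using LeastI[of ?P] \<open>?P (nat \<bar>a\<bar>)\<close> by blast
  have mn: "d \<le> k" if "?P k" for k unfolding d_def using that by (rule Least_le)
  have "int d dvd b" if b: "b \<in> A" for b
  proof (rule ccontr)
    assume nd: "\<not> int d dvd b"
    have "b mod int d = b - b div int d * int d" by (simp add: minus_div_mult_eq_mod)
    then have "of_int (b mod int d) * x = of_int b * x - of_int (b div int d) * (of_int (int d) * x)"
      by (simp add: left_diff_distrib mult.assoc)
    also have "\<dots> \<in> L" using add_subgroup_diff[OF L A[OF b] add_subgroup_of_int[OF L]] d by blast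
    finally have "of_int (b mod int d) * x \<in> L" .
    moreover have d0: "int d > 0" using d by simp
    moreover have "b mod int d \<noteq> 0" using nd mod_0_imp_dvd by blast
    moreover note pos_mod_sign[OF d0, of b]
    ultimately have "b mod int d > 0" "of_int (b mod int d) * x \<in> L" by (metis order_le_less)+
    moreover have "b mod int d < int d" using d0 by (rule pos_mod_bound)
    ultimately have "?P (nat (b mod int d))" by auto
    then have "d \<le> nat (b mod int d)" by (rule mn)
    then show False using \<open>b mod int d < int d\<close> \<open>b mod int d > 0\<close> by linarith
  qed
  then have "int d dvd 1" using g Gcd_greatest by metis
  then show ?thesis using d by simp
qed

section \<open>Dilates, weighted sumsets and single terms\<close>

definition dilate :: "int set \<Rightarrow> 'v::comm_ring_1 \<Rightarrow> 'v set" where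
  "dilate A s = (\<lambda>a. of_int a * s) ` A"

definition wsumset :: "int set \<Rightarrow> 'v::comm_ring_1 multiset \<Rightarrow> 'v set" where
  "wsumset A T = (\<Sum>s\<in>#T. dilate A s)"

definition wsumset_n :: "int set \<Rightarrow> nat \<Rightarrow> 'v::comm_ring_1 multiset \<Rightarrow> 'v set" where
  "wsumset_n A n S = \<Union> (wsumset A ` {T. T \<subseteq># S \<and> size T = n})"

definition single :: "int set \<Rightarrow> 'v::comm_ring_1 set \<Rightarrow> 'v \<Rightarrow> bool" where
  "single A L s \<longleftrightarrow> \<not> crosses L (dilate A s)"

text \<open>The weighted Davenport constant of G / K, with K in the place of zero. The
  \<open>LEAST\<close> mirrors \<open>davenport\<close>, so that the two can be identified predicate
  by predicate.\<close>

definition dav :: "int set \<Rightarrow> 'v::comm_ring_1 set \<Rightarrow> 'v set \<Rightarrow> nat" where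
  "dav A K G = (LEAST l. \<forall>S. set_mset S \<subseteq> G \<and> size S = l \<longrightarrow> (\<exists>T. T \<subseteq># S \<and> T \<noteq> {#} \<and> wsumset A T \<inter> K \<noteq> {}))"

lemma wsumset_empty [simp]: "wsumset A {#} = {0}"
  and wsumset_add_mset: "wsumset A (add_mset s T) = dilate A s + wsumset A T"
  and wsumset_union: "wsumset A (M + N) = wsumset A M + wsumset A N"
  by (simp_all add: wsumset_def)

lemma wsumset_nI: "T \<subseteq># S \<Longrightarrow> size T = n \<Longrightarrow> w \<in> wsumset A T \<Longrightarrow> w \<in> wsumset_n A n S"
  by (auto simp: wsumset_n_def)

lemma wsumset_nE:
  assumes "w \<in> wsumset_n A n S"
  obtains T where "T \<subseteq># S" "size T = n" "w \<in> wsumset A T"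
  using assms by (auto simp: wsumset_n_def)

definition inside :: "'v::comm_ring_1 multiset \<Rightarrow> 'v \<Rightarrow> 'v set \<Rightarrow> 'v multiset" where
  "inside S \<alpha> H = {#s \<in># S. s - \<alpha> \<in> H#}"

definition outside :: "'v::comm_ring_1 multiset \<Rightarrow> 'v \<Rightarrow> 'v set \<Rightarrow> 'v multiset" where
  "outside S \<alpha> H = {#s \<in># S. s - \<alpha> \<notin> H#}"

lemma outside_plus_inside: "S = outside S \<alpha> H + inside S \<alpha> H"
  unfolding inside_def outside_def by (metis add.commute multiset_partition)

lemma size_inside_outside: "size S = size (outside S \<alpha> H) + size (inside S \<alpha> H)"
  by (metis outside_plus_inside size_union)

lemma inside_subset: "inside S \<alpha> H \<subseteq># S" and outside_subset: "outside S \<alpha> H \<subseteq># S"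
  unfolding inside_def outside_def by simp_all

text \<open>\<open>a0\<close> is a reference weight: on a term that is single modulo L, all weights
  agree with it modulo L.\<close>

locale weights =
  fixes A :: "int set" and a0 :: int
  assumes a0: "a0 \<in> A" and Gcd_A: "Gcd A = 1"
begin

lemma dilate_nonempty: "dilate A s \<noteq> {}"
  using a0 by (auto simp: dilate_def)

lemma wsumset_nonempty: "wsumset A T \<noteq> {}"
  unfolding wsumset_def by (intro sumset_nonempty ballI dilate_nonempty)

lemma single_iff:
  assumes L: "add_subgroup L"
  shows "single A L s \<longleftrightarrow> (\<forall>a\<in>A. of_int a * s - of_int a0 * s \<in> L)"
proof
  assume *: "\<forall>a\<in>A. of_int a * s - of_int a0 * s \<in> L"
  then have "of_int a * s - of_int b * s \<in> L" if "a \<in> A" "b \<in> A" for a b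
    using add_subgroup_diff_trans[OF L] add_subgroup_diff_commute[OF L] that by blast
  then show "single A L s" by (auto simp: single_def crosses_def dilate_def)
qed (use a0 in \<open>auto simp: single_def crosses_def dilate_def\<close>)

lemma single_mono: "add_subgroup K \<Longrightarrow> add_subgroup L \<Longrightarrow> K \<subseteq> L \<Longrightarrow> single A K s \<Longrightarrow> single A L s"
  by (auto simp: single_iff)

lemma single_cong:
  assumes L: "add_subgroup L" and s: "single A L \<alpha>" "s - \<alpha> \<in> L"
  shows "single A L s"
  unfolding single_iff[OF L]
proof
  fix a assume "a \<in> A"
  then have "(of_int a * \<alpha> - of_int a0 * \<alpha>) + of_int (a - a0) * (s - \<alpha>) \<in> L"
    using s single_iff[OF L] add_subgroup_add[OF L] add_subgroup_of_int[OF L] by blast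
  then show "of_int a * s - of_int a0 * s \<in> L" by (simp add: algebra_simps)
qed

lemma dilate_single: "add_subgroup L \<Longrightarrow> single A L s \<Longrightarrow> x \<in> dilate A s \<Longrightarrow> x - of_int a0 * s \<in> L"
  by (auto simp: single_iff dilate_def)

lemma mem_if_dilate_subset: "add_subgroup L \<Longrightarrow> dilate A x \<subseteq> L \<Longrightarrow> x \<in> L"
  by (rule add_subgroup_Gcd[OF _ Gcd_A]) (auto simp: dilate_def)

text \<open>Multiplication by \<open>a0\<close> alone need not be injective modulo L. For singles,
  however, agreement under \<open>a0\<close> is agreement under every weight, so all of A (s - t)
  lies in L and the gcd condition applies.\<close>

lemma single_class_eq:
  assumes L: "add_subgroup L" and s: "single A L s" "single A L t" and d: "of_int a0 * s - of_int a0 * t \<in> L"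
  shows "s - t \<in> L"
proof (rule add_subgroup_Gcd[OF L Gcd_A])
  fix a assume a: "a \<in> A"
  have "of_int a * s - of_int a0 * s \<in> L" "of_int a * t - of_int a0 * t \<in> L" using s a single_iff[OF L] by auto
  then have "(of_int a * s - of_int a0 * s) + (of_int a0 * s - of_int a0 * t) - (of_int a * t - of_int a0 * t) \<in> L"
    using d by (meson L add_subgroup_add add_subgroup_diff)
  then show "of_int a * (s - t) \<in> L" by (simp add: algebra_simps)
qed

lemma sum_in_wsumset: "of_int a0 * (\<Sum>\<^sub># T) \<in> wsumset A T"
proof (induction T)
  case (add s T)
  have "of_int a0 * s + of_int a0 * (\<Sum>\<^sub># T) \<in> dilate A s + wsumset A T"
    using add a0 by (auto simp: dilate_def)
  then show ?case by (simp add: wsumset_add_mset algebra_simps)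
qed simp

lemma wsumset_single_diff:
  assumes L: "add_subgroup L" and T: "\<forall>s\<in>#T. single A L s" and w: "w \<in> wsumset A T"
  shows "w - of_int a0 * (\<Sum>\<^sub># T) \<in> L"
  using T w
proof (induction T arbitrary: w)
  case empty
  then show ?case by (simp add: add_subgroup_zero[OF L])
next
  case (add s T)
  then obtain x y where w: "w = x + y" "x \<in> dilate A s" "y \<in> wsumset A T" by (auto simp: wsumset_add_mset elim!: set_plus_elim)
  then have "(x - of_int a0 * s) + (y - of_int a0 * (\<Sum>\<^sub># T)) \<in> L"
    using add dilate_single[OF L] by (intro add_subgroup_add[OF L]) auto
  then show ?case using w by (simp add: algebra_simps)
qed

lemma sum_mset_coset:
  fixes \<alpha> :: "'v::comm_ring_1"
  assumes L: "add_subgroup L" and T: "\<forall>s\<in>#T. s - \<alpha> \<in> L"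
  shows "\<Sum>\<^sub># T - of_nat (size T) * \<alpha> \<in> L"
  using T
proof (induction T)
  case empty
  then show ?case by (simp add: add_subgroup_zero[OF L])
next
  case (add s T)
  then have "(s - \<alpha>) + (\<Sum>\<^sub># T - of_nat (size T) * \<alpha>) \<in> L" by (intro add_subgroup_add[OF L]) auto
  then show ?case by (simp add: algebra_simps)
qed

lemma wsumset_coset:
  assumes L: "add_subgroup L" and \<alpha>: "single A L \<alpha>" and T: "\<forall>s\<in>#T. s - \<alpha> \<in> L" and w: "w \<in> wsumset A T"
  shows "w - of_nat (size T) * (of_int a0 * \<alpha>) \<in> L"
proof -
  have "w - of_int a0 * (\<Sum>\<^sub># T) \<in> L"
    using wsumset_single_diff[OF L _ w] single_cong[OF L \<alpha>] T by blast
  then have "(w - of_int a0 * (\<Sum>\<^sub># T)) + of_int a0 * (\<Sum>\<^sub># T - of_nat (size T) * \<alpha>) \<in> L"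
    using add_subgroup_add[OF L] add_subgroup_of_int[OF L] sum_mset_coset[OF L T] by blast
  then show ?thesis by (simp add: algebra_simps)
qed

lemma wsumset_n_coset:
  assumes L: "add_subgroup L" and \<alpha>: "single A L \<alpha>" and T: "\<forall>s\<in>#S. s - \<alpha> \<in> L" and w: "w \<in> wsumset_n A n S"
  shows "w - of_nat n * (of_int a0 * \<alpha>) \<in> L"
proof -
  obtain U where U: "U \<subseteq># S" "size U = n" "w \<in> wsumset A U" using w by (rule wsumset_nE)
  then have "\<forall>s\<in>#U. s - \<alpha> \<in> L" using T mset_subset_eqD by metis
  then show ?thesis using wsumset_coset[OF L \<alpha> _ U(3)] U(2) by blast
qed

text \<open>Translating by an element \<open>\<alpha>\<close> whose dilate is a single coset of \<open>H\<close> commutes with taking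
  weighted sums modulo \<open>H\<close>.\<close>

lemma wsumset_translate:
  assumes H: "add_subgroup H" and \<alpha>: "single A H \<alpha>" and w: "w \<in> wsumset A (image_mset (\<lambda>s. s - \<alpha>) T)"
  shows "\<exists>v \<in> wsumset A T. w - (v - of_nat (size T) * (of_int a0 * \<alpha>)) \<in> H"
  using w
proof (induction T arbitrary: w)
  case empty
  then show ?case by (simp add: add_subgroup_zero[OF H])
next
  case (add s T)
  then obtain a y where w: "w = of_int a * (s - \<alpha>) + y" "a \<in> A" "y \<in> wsumset A (image_mset (\<lambda>s. s - \<alpha>) T)"
    by (auto simp: wsumset_add_mset dilate_def elim!: set_plus_elim)
  then obtain v where v: "v \<in> wsumset A T" "y - (v - of_nat (size T) * (of_int a0 * \<alpha>)) \<in> H" using add.IH by blast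
  have "(y - (v - of_nat (size T) * (of_int a0 * \<alpha>))) - (of_int a * \<alpha> - of_int a0 * \<alpha>) \<in> H"
    using add_subgroup_diff[OF H v(2)] \<alpha> single_iff[OF H] w(2) by blast
  then have "w - ((of_int a * s + v) - of_nat (size (add_mset s T)) * (of_int a0 * \<alpha>)) \<in> H"
    unfolding w(1) by (simp add: algebra_simps)
  moreover have "of_int a * s + v \<in> wsumset A (add_mset s T)" using w v by (auto simp: wsumset_add_mset dilate_def)
  ultimately show ?case by blast
qed

text \<open>Choosing the adjoined 0 means leaving the term out; the sum of these sets thus ranges
  over weighted sums of all subsequences.\<close>

lemma sumset_insert_zero:
  "y \<in> (\<Sum>s\<in>#R. insert 0 (dilate A (s - \<alpha>))) \<Longrightarrow> \<exists>T. T \<subseteq># R \<and> y \<in> wsumset A (image_mset (\<lambda>s. s - \<alpha>) T)"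
proof (induction R arbitrary: y)
  case (add s R)
  then obtain x z where y: "y = x + z" "x \<in> insert 0 (dilate A (s - \<alpha>))" "z \<in> (\<Sum>s\<in>#R. insert 0 (dilate A (s - \<alpha>)))"
    by (auto elim!: set_plus_elim)
  then obtain T where T: "T \<subseteq># R" "z \<in> wsumset A (image_mset (\<lambda>s. s - \<alpha>) T)" using add.IH by blast
  show ?case
  proof (cases "x = 0")
    case True
    then show ?thesis using T y by (intro exI[of _ T]) (auto intro: subset_mset.order_trans)
  next
    case False
    then show ?thesis using T y by (intro exI[of _ "add_mset s T"]) (auto simp: wsumset_add_mset)
  qed
qed auto

text \<open>With 0 adjoined, not crossing L means lying inside L itself. In contrapositive form,
  every term outside \<alpha> + L contributes a crossing set.\<close>

lemma crosses_insert_zero: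
  assumes "add_subgroup L" "\<not> crosses L (insert 0 (dilate A x))"
  shows "x \<in> L"
proof (rule mem_if_dilate_subset[OF assms(1)])
  show "dilate A x \<subseteq> L" using assms(2) by (auto simp: crosses_def)
qed

lemma dilate_subset: "add_subgroup L \<Longrightarrow> x \<in> L \<Longrightarrow> dilate A x \<subseteq> L"
  by (auto simp: dilate_def add_subgroup_of_int)

subsection \<open>The weighted Davenport constant of a quotient\<close>

text \<open>Pigeonhole on the prefix sums, with the constant weight \<open>a0\<close>. This makes |G
  / K| a candidate for the \<open>LEAST\<close> in \<open>dav\<close>, which is therefore
  attained.\<close>

lemma weighted_zero_sum_exists:
  fixes G :: "'v::comm_ring_1 set"
  assumes fi: "finite_index K G" and S: "set_mset S \<subseteq> G" "ncosets K G \<le> size S"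
  shows "\<exists>T. T \<subseteq># S \<and> T \<noteq> {#} \<and> wsumset A T \<inter> K \<noteq> {}"
proof -
  note f = finite_indexD[OF fi]
  obtain xs where xs: "mset xs = S" using ex_mset by blast
  let ?p = "\<lambda>j. sum_list (take j xs) +o K"
  have sum_in: "sum_list ys \<in> G" if "set ys \<subseteq> G" for ys
    using that by (induction ys) (auto simp: add_subgroup_zero[OF f(2)] add_subgroup_add[OF f(2)])
  have "set (take j xs) \<subseteq> G" for j using S(1) xs set_take_subset[of j xs] by (metis order_trans set_mset_mset)
  then have "?p ` {0..length xs} \<subseteq> (\<lambda>x. x +o K) ` G" using sum_in by blast
  then have "card (?p ` {0..length xs}) \<le> ncosets K G" unfolding ncosets_def using card_mono[OF f(4)] by blast
  also have "\<dots> < card {0..length xs}" using S xs by auto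
  finally have "\<not> inj_on ?p {0..length xs}" by (metis card_image less_irrefl)
  then have "\<exists>i j. i < j \<and> j \<le> length xs \<and> ?p i = ?p j"
    by (auto simp: inj_on_def) (metis linorder_neqE_nat)
  then obtain i j where ij: "i < j" "j \<le> length xs" "?p j = ?p i" by auto
  let ?ys = "take (j - i) (drop i xs)"
  have tj: "take j xs = take i xs @ ?ys" using ij by (metis le_add_diff_inverse less_imp_le take_add)
  then have "sum_list ?ys \<in> K" using ij(3) coset_eq_iff[OF f(1)] by simp
  then have "of_int a0 * (\<Sum>\<^sub># (mset ?ys)) \<in> wsumset A (mset ?ys) \<inter> K"
    using sum_in_wsumset[of "mset ?ys"] add_subgroup_of_int[OF f(1)] by (simp add: sum_mset_sum_list)
  moreover have "mset ?ys \<subseteq># S"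
  proof -
    have "xs = take i xs @ ?ys @ drop j xs" using tj by (metis append_assoc append_take_drop_id)
    then have "mset xs = mset (take i xs) + (mset ?ys + mset (drop j xs))" by (metis mset_append)
    then show ?thesis unfolding xs[symmetric] by (metis add.left_commute mset_subset_eq_add_left)
  qed
  moreover have "mset ?ys \<noteq> {#}" using ij by auto
  ultimately show ?thesis by blast
qed

lemma dav_property:
  fixes G :: "'v::comm_ring_1 set"
  assumes fi: "finite_index K G" and S: "set_mset S \<subseteq> G" "dav A K G \<le> size S"
  shows "\<exists>T. T \<subseteq># S \<and> T \<noteq> {#} \<and> wsumset A T \<inter> K \<noteq> {}"
proof -
  let ?P = "\<lambda>l. \<forall>S::'v multiset. set_mset S \<subseteq> G \<and> size S = l \<longrightarrow> (\<exists>T. T \<subseteq># S \<and> T \<noteq> {#} \<and> wsumset A T \<inter> K \<noteq> {})"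
  have "?P (ncosets K G)" using weighted_zero_sum_exists[OF fi] by simp
  then have P: "?P (dav A K G)" unfolding dav_def by (rule LeastI)
  obtain S1 where S1: "S1 \<subseteq># S" "size S1 = dav A K G" using submultiset_of_size[OF S(2)] .
  then have "set_mset S1 \<subseteq> G" using S(1) set_mset_mono by blast
  then show ?thesis using P S1 subset_mset.order_trans by metis
qed

lemma dav_witness:
  assumes "l < dav A K G"
  obtains S where "set_mset S \<subseteq> G" "size S = l" "\<And>T. T \<subseteq># S \<Longrightarrow> T \<noteq> {#} \<Longrightarrow> wsumset A T \<inter> K = {}"
  using not_less_Least[OF assms[unfolded dav_def]] by blast

lemma dav_pos: "finite_index K G \<Longrightarrow> 1 \<le> dav A K G"
  using dav_property[of K G "{#}"] by force

lemma dav_self: "add_subgroup K \<Longrightarrow> dav A K K = 1"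
proof -
  assume K: "add_subgroup K"
  then have fi: "finite_index K K" using index_self[OF K] by (auto simp: finite_index_def ncosets_def intro: card_ge_0_finite)
  have "dav A K K \<le> 1"
  proof (rule ccontr)
    assume "\<not> dav A K K \<le> 1"
    then obtain S where "set_mset S \<subseteq> K" "size S = 1" "\<And>T. T \<subseteq># S \<Longrightarrow> T \<noteq> {#} \<Longrightarrow> wsumset A T \<inter> K = {}"
      using dav_witness[of 1 K K] by (metis not_le)
    then show False using weighted_zero_sum_exists[OF fi, of S] index_self[OF K] by auto
  qed
  then show ?thesis using dav_pos[OF fi] by simp
qed

text \<open>Extremal sequences concatenate: one over H without weighted zero sum modulo K, followed
  by one over G without weighted zero sum modulo H, has no weighted zero sum modulo K.\<close>

lemma dav_tower:
  assumes fi: "finite_index K G" and H: "add_subgroup H" "K \<subseteq> H" "H \<subseteq> G"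
  shows "dav A K H + dav A H G \<le> dav A K G + 1"
proof (rule ccontr)
  assume "\<not> ?thesis"
  then have lt: "dav A K G \<le> (dav A K H - 1) + (dav A H G - 1)"
    using dav_pos[OF finite_index_lower[OF fi H]] dav_pos[OF finite_index_upper[OF fi H]] by linarith
  obtain S where S: "set_mset S \<subseteq> H" "size S = dav A K H - 1" "\<And>T. T \<subseteq># S \<Longrightarrow> T \<noteq> {#} \<Longrightarrow> wsumset A T \<inter> K = {}"
    using dav_witness[of "dav A K H - 1" K H] dav_pos[OF finite_index_lower[OF fi H]] by auto
  obtain R where R: "set_mset R \<subseteq> G" "size R = dav A H G - 1" "\<And>T. T \<subseteq># R \<Longrightarrow> T \<noteq> {#} \<Longrightarrow> wsumset A T \<inter> H = {}"
    using dav_witness[of "dav A H G - 1" H G] dav_pos[OF finite_index_upper[OF fi H]] by auto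
  have "set_mset (R + S) \<subseteq> G" "dav A K G \<le> size (R + S)" using R S H lt by auto
  then obtain U where U: "U \<subseteq># R + S" "U \<noteq> {#}" "wsumset A U \<inter> K \<noteq> {}" using dav_property[OF fi] by blast
  obtain T V where TV: "U = T + V" "T \<subseteq># R" "V \<subseteq># S" using U(1) by (rule submultiset_plusE)
  obtain t v where tv: "t \<in> wsumset A T" "v \<in> wsumset A V" "t + v \<in> K" using U(3) TV(1) by (auto simp: wsumset_union elim!: set_plus_elim)
  have "\<forall>s\<in>#V. s \<in> H" using mset_subset_eqD[OF TV(3)] S(1) by blast
  \<comment> \<open>The terms from H contribute an element of H, so the terms from R alone sum to
    zero modulo H, and there are none of them.\<close>
  then have "v \<in> H"
    using wsumset_coset[OF H(1) _ _ tv(2), of 0] add_subgroup_zero[OF H(1)] by (simp add: single_iff[OF H(1)])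
  then have "(t + v) - v \<in> H" using tv(3) H add_subgroup_diff by blast
  then have "T = {#}" using R(3)[OF TV(2)] tv(1) by auto
  then show False using S(3)[OF TV(3)] U TV by auto
qed

text \<open>The Davenport property for the terms s - \<alpha>, read back for s: the sequence found
  has normalized value zero modulo H, so joining it to a representation changes only the
  length.\<close>

lemma dav_property_translate:
  assumes fi: "finite_index H G" and \<alpha>: "single A H \<alpha>" and R: "\<forall>s\<in>#R. s - \<alpha> \<in> G" and d: "dav A H G \<le> size R"
  obtains T w where "T \<subseteq># R" "T \<noteq> {#}" "w \<in> wsumset A T" "w - of_nat (size T) * (of_int a0 * \<alpha>) \<in> H"
proof -
  note f = finite_indexD[OF fi]
  have "set_mset (image_mset (\<lambda>s. s - \<alpha>) R) \<subseteq> G" "dav A H G \<le> size (image_mset (\<lambda>s. s - \<alpha>) R)" using R d by auto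
  then obtain T' where T': "T' \<subseteq># image_mset (\<lambda>s. s - \<alpha>) R" "T' \<noteq> {#}" "wsumset A T' \<inter> H \<noteq> {}"
    using dav_property[OF fi] by blast
  then obtain T where T: "T \<subseteq># R" "T' = image_mset (\<lambda>s. s - \<alpha>) T" using submultiset_image_msetE by metis
  obtain u where u: "u \<in> wsumset A T'" "u \<in> H" using T' by blast
  then obtain v where v: "v \<in> wsumset A T" "u - (v - of_nat (size T) * (of_int a0 * \<alpha>)) \<in> H"
    using wsumset_translate[OF f(1) \<alpha>] T by blast
  then have "u - (u - (v - of_nat (size T) * (of_int a0 * \<alpha>))) \<in> H" using u add_subgroup_diff[OF f(1)] by blast
  then show ?thesis using that[OF T(1)] T' T v by auto
qed

subsection \<open>Padding with weighted zero sums\<close>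

text \<open>If fewer than \<open>dav A H G\<close> terms of \<open>R\<close> are left out, there are enough terms of \<open>S'\<close> to
  complete \<open>T\<close> to length \<open>n\<close>; otherwise a weighted subsum of the left-out terms vanishes modulo \<open>H\<close>
  and can be added to \<open>T\<close>.\<close>

lemma extend_by_zero_sums:
  assumes fi: "finite_index H G" and \<alpha>: "single A H \<alpha>" and R: "\<forall>s\<in>#R. s - \<alpha> \<in> G"
    and T: "T \<subseteq># R" "w \<in> wsumset A T"
  shows "\<exists>T' w'. T' \<subseteq># R \<and> w' \<in> wsumset A T' \<and> size R + 1 \<le> size T' + dav A H G \<and> size T \<le> size T' \<and>
    (w' - of_nat (size T') * (of_int a0 * \<alpha>)) - (w - of_nat (size T) * (of_int a0 * \<alpha>)) \<in> H"
  using T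
proof (induction "size R - size T" arbitrary: T w rule: less_induct)
  case less
  note H = finite_indexD(1)[OF fi]
  show ?case
  proof (cases "size R + 1 \<le> size T + dav A H G")
    case True
    then show ?thesis using less.prems add_subgroup_zero[OF H] by (intro exI[of _ T] exI[of _ w]) simp
  next
    case False
    then have "dav A H G \<le> size (R - T)" using less.prems by (simp add: size_Diff_submset)
    moreover have "\<forall>s\<in>#R - T. s - \<alpha> \<in> G" using R in_diffD by metis
    ultimately obtain Z z where Z: "Z \<subseteq># R - T" "Z \<noteq> {#}" "z \<in> wsumset A Z" "z - of_nat (size Z) * (of_int a0 * \<alpha>) \<in> H"
      using dav_property_translate[OF fi \<alpha>] by metis
    have TZ: "T + Z \<subseteq># R" using Z(1) less.prems(1)
      by (metis subset_mset.add_diff_inverse mset_subset_eq_mono_add_left_cancel)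
    moreover have "w + z \<in> wsumset A (T + Z)" using less.prems Z by (auto simp: wsumset_union)
    moreover have "size R - size (T + Z) < size R - size T"
      using size_mset_mono[OF TZ] Z(2) by (simp add: nonempty_has_size)
    ultimately obtain T' w' where T': "T' \<subseteq># R" "w' \<in> wsumset A T'" "size R + 1 \<le> size T' + dav A H G"
        "size (T + Z) \<le> size T'"
        "(w' - of_nat (size T') * (of_int a0 * \<alpha>)) - ((w + z) - of_nat (size (T + Z)) * (of_int a0 * \<alpha>)) \<in> H"
      using less.hyps by metis
    have "(w' - of_nat (size T') * (of_int a0 * \<alpha>)) - ((w + z) - of_nat (size (T + Z)) * (of_int a0 * \<alpha>))
        + (z - of_nat (size Z) * (of_int a0 * \<alpha>)) \<in> H"
      using T'(5) Z(4) by (rule add_subgroup_add[OF H])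
    then show ?thesis using T' by (intro exI[of _ T'] exI[of _ w']) (simp add: algebra_simps)
  qed
qed

text \<open>Modulo H, terms of \<open>S'\<close> contribute only their number, so an n-term sum is
  determined by its part T in R. Conversely, T is lengthened by zero sums modulo H, filled up from
  \<open>S' - S''\<close>, and finished with m terms of \<open>S''\<close>, whose m-term sums
  realize a whole coset of H. The bounds say that m slots remain for \<open>S''\<close> and that the
  filler suffices. As the description depends on the length only through a translation, sums of
  different lengths can be compared by it.\<close>

lemma wsumset_n_periodic:
  assumes fi: "finite_index K G" and H: "add_subgroup H" "K \<subseteq> H" "H \<subseteq> G"
    and \<alpha>: "single A H \<alpha>" and R: "\<forall>s\<in>#R. s - \<alpha> \<in> G"
    and S': "\<forall>s\<in>#S'. s - \<alpha> \<in> H" and S'': "S'' \<subseteq># S'"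
    and full: "wsumset_n A m S'' + K = (of_nat m * (of_int a0 * \<alpha>)) +o H"
    and n: "m + size R \<le> n"
    and sz: "n + size S'' + dav A H G \<le> size R + size S' + m + 1"
  shows "x \<in> wsumset_n A n (R + S') + K \<longleftrightarrow>
    (\<exists>T w. T \<subseteq># R \<and> w \<in> wsumset A T \<and> x - (w + of_nat (n - size T) * (of_int a0 * \<alpha>)) \<in> H)"
proof
  note f = finite_indexD[OF fi]
  note fH = finite_index_upper[OF fi H]
  let ?b = "of_int a0 * \<alpha>"
  show "\<exists>T w. T \<subseteq># R \<and> w \<in> wsumset A T \<and> x - (w + of_nat (n - size T) * ?b) \<in> H" if x: "x \<in> wsumset_n A n (R + S') + K"
  proof -
    obtain u where u: "u \<in> wsumset_n A n (R + S')" "x - u \<in> K" using x by (auto simp: mem_plus_iff)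
    then obtain U where U: "U \<subseteq># R + S'" "size U = n" "u \<in> wsumset A U" by (auto elim: wsumset_nE)
    obtain T V where TV: "U = T + V" "T \<subseteq># R" "V \<subseteq># S'" using U(1) by (rule submultiset_plusE)
    obtain w v where wv: "u = w + v" "w \<in> wsumset A T" "v \<in> wsumset A V" using U(3) TV(1) by (auto simp: wsumset_union elim!: set_plus_elim)
    have "\<forall>s\<in>#V. s - \<alpha> \<in> H" using S' mset_subset_eqD[OF TV(3)] by blast
    then have "v - of_nat (size V) * ?b \<in> H" using wsumset_coset[OF H(1) \<alpha> _ wv(3)] by blast
    then have "(x - u) + (v - of_nat (size V) * ?b) \<in> H" using u(2) H add_subgroup_add[OF H(1)] by blast
    moreover have "size V = n - size T" using U(2) TV(1) by auto
    ultimately show ?thesis using TV wv by (intro exI[of _ T] exI[of _ w]) (simp add: algebra_simps)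
  qed
  assume "\<exists>T w. T \<subseteq># R \<and> w \<in> wsumset A T \<and> x - (w + of_nat (n - size T) * ?b) \<in> H"
  then obtain T w where T: "T \<subseteq># R" "w \<in> wsumset A T" "x - (w + of_nat (n - size T) * ?b) \<in> H" by blast
  obtain T' w' where T': "T' \<subseteq># R" "w' \<in> wsumset A T'" "size R + 1 \<le> size T' + dav A H G" "size T \<le> size T'"
     "(w' - of_nat (size T') * ?b) - (w - of_nat (size T) * ?b) \<in> H"
    using extend_by_zero_sums[OF fH \<alpha> R T(1,2)] by blast
  have sT: "size T \<le> n" "size T' + m \<le> n" using size_mset_mono[OF T(1)] size_mset_mono[OF T'(1)] n by auto
  have "(x - (w + of_nat (n - size T) * ?b)) - ((w' - of_nat (size T') * ?b) - (w - of_nat (size T) * ?b)) \<in> H"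
    using add_subgroup_diff[OF H(1) T(3) T'(5)] .
  then have x: "x - w' - (of_nat n - of_nat (size T')) * ?b \<in> H" using sT by (simp add: of_nat_diff algebra_simps)
  \<comment> \<open>\<open>T'\<close> misses fewer than \<open>dav A H G\<close> terms of R; the
    hypothesis \<open>sz\<close> is tailored to this.\<close>
  have "n - size T' - m \<le> size (S' - S'')" using sz T'(3) sT size_mset_mono[OF S''] by (simp add: size_Diff_submset[OF S''])
  then obtain V where V: "V \<subseteq># S' - S''" "size V = n - size T' - m" using submultiset_of_size by blast
  obtain v where v: "v \<in> wsumset A V" using wsumset_nonempty[of V] by blast
  have "V \<subseteq># S'" using V(1) by (meson diff_subset_eq_self subset_mset.order_trans)
  then have "\<forall>s\<in>#V. s - \<alpha> \<in> H" using S' mset_subset_eqD by metis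
  then have "v - of_nat (n - size T' - m) * ?b \<in> H" using wsumset_coset[OF H(1) \<alpha> _ v] V(2) by simp
  with x have "(x - w' - (of_nat n - of_nat (size T')) * ?b) - (v - of_nat (n - size T' - m) * ?b) \<in> H"
    by (rule add_subgroup_diff[OF H(1)])
  then have "(x - w' - v) - of_nat m * ?b \<in> H" using sT by (simp add: of_nat_diff algebra_simps)
  \<comment> \<open>What remains lies in the coset of H that \<open>S''\<close> fills, so it can be
    hit exactly modulo K.\<close>
  then have "x - w' - v \<in> wsumset_n A m S'' + K" using full by (simp add: mem_elt_plus)
  then obtain y where y: "y \<in> wsumset_n A m S''" "x - w' - v - y \<in> K" by (auto simp: mem_plus_iff)
  then obtain Y where Y: "Y \<subseteq># S''" "size Y = m" "y \<in> wsumset A Y" by (auto elim: wsumset_nE)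
  have "w' + (v + y) \<in> wsumset A (T' + (V + Y))" using T' v Y by (auto simp: wsumset_union)
  moreover have "V + Y \<subseteq># (S' - S'') + S''" using V Y by (intro subset_mset.add_mono) auto
  then have "V + Y \<subseteq># S'" using S'' by simp
  then have "T' + (V + Y) \<subseteq># R + S'" using T' by (intro subset_mset.add_mono) auto
  moreover have "size (T' + (V + Y)) = n" using V Y sT by simp
  ultimately have "w' + (v + y) \<in> wsumset_n A n (R + S')" by (intro wsumset_nI)
  moreover have "x - (w' + (v + y)) \<in> K" using y(2) by (simp add: algebra_simps)
  ultimately show "x \<in> wsumset_n A n (R + S') + K" by (auto simp: mem_plus_iff)
qed

text \<open>The element \<open>\<beta>\<close> of the paper is \<open>a0 \<alpha>\<close>, for a fixed \<open>a0 \<in> A\<close>: modulo \<open>H\<close> it does not depend on \<open>a0\<close>.\<close>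

definition fills :: "'v::comm_ring_1 set \<Rightarrow> 'v set \<Rightarrow> 'v \<Rightarrow> 'v multiset \<Rightarrow> bool" where
  "fills K H \<alpha> S \<longleftrightarrow> single A H \<alpha> \<and> (\<forall>s\<in>#S. s - \<alpha> \<in> H) \<and> size S + 1 = ncosets K H + dav A K H \<and>
     wsumset_n A (ncosets K H) S + K = (of_nat (ncosets K H) * (of_int a0 * \<alpha>)) +o H"

text \<open>Here the gcd condition turns counts of terms outside \<alpha> + L into counts of
  crossing sets. The coset obtained is G itself because every summand contains 0.\<close>

lemma sum_translated_dilates_full:
  assumes fi: "finite_index K G"
    and S: "\<forall>s\<in>#R. s - \<alpha> \<in> G"
    and cr: "\<And>L. add_subgroup L \<Longrightarrow> K \<subseteq> L \<Longrightarrow> L \<subset> G \<Longrightarrow> ncosets L G \<le> size (outside R \<alpha> L) + 1"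
  obtains R' where "R' \<subseteq># R" "size R' + 1 \<le> ncosets K G"
    "(\<Sum>s\<in>#R'. insert 0 (dilate A (s - \<alpha>))) + K = G"
proof -
  note f = finite_indexD[OF fi]
  let ?B = "\<lambda>s. insert 0 (dilate A (s - \<alpha>))"
  have sub: "\<forall>s\<in>#R. 0 \<in> ?B s \<and> ?B s \<subseteq> G" using S dilate_subset[OF f(2)] add_subgroup_zero[OF f(2)] by auto
  then have ne: "\<forall>s\<in>#R. ?B s \<noteq> {} \<and> \<not> crosses G (?B s)"
    using add_subgroup_diff[OF f(2)] unfolding crosses_def by (metis empty_iff subset_iff)
  have "\<exists>g. (\<Sum>s\<in>#R. ?B s) + K = g +o G"
  proof (rule sumset_full[OF fi ne])
    fix L assume L: "add_subgroup L" "K \<subseteq> L" "L \<subset> G"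
    have "crosses L (?B s)" if "s - \<alpha> \<notin> L" for s using crosses_insert_zero[OF L(1)] that by blast
    then have "outside R \<alpha> L \<subseteq># {#s \<in># R. crosses L (?B s)#}" unfolding outside_def by (rule filter_mset_subset_filter_mset)
    then show "ncosets L G \<le> size {#s \<in># R. crosses L (?B s)#} + 1" using cr[OF L] size_mset_mono
      by (meson add_le_mono1 order_trans)
  qed
  then obtain g where g: "(\<Sum>s\<in>#R. ?B s) + K = g +o G" by blast
  have "0 \<in> (\<Sum>s\<in>#R. ?B s)" 
  proof (induction R)
    case (add s R)
    then have "0 + 0 \<in> ?B s + (\<Sum>s\<in>#R. ?B s)" by (intro set_plus_intro) auto
    then show ?case by simp
  qed simp
  then have "0 \<in> g +o G" using subset_plus_subgroup[OF f(1)] g by blast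
  then have "- g \<in> G" by (simp add: mem_elt_plus)
  then have "g \<in> G" using add_subgroup_minus[OF f(2)] by force
  then have "(\<Sum>s\<in>#R. ?B s) + K = G" using g elt_plus_absorb[OF f(2)] by simp
  then show ?thesis using sumset_prune[OF fi sub] that by metis
qed

text \<open>\<open>H'\<close> is the smallest subgroup above \<open>H\<close> with at most \<open>|G / H'| - 2\<close> terms outside \<open>\<alpha> + H'\<close>.\<close>

theorem fills_enlarge:
  assumes fi: "finite_index K G" and H: "add_subgroup H" "K \<subseteq> H" "H \<subseteq> G"
    and S: "\<forall>s\<in>#S. s - \<alpha> \<in> G" and fl: "fills K H \<alpha> S2" and S2: "S2 \<subseteq># inside S \<alpha> H"
    and ins: "ncosets K H + dav A K G \<le> size (inside S \<alpha> H) + 1"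
    and sz: "ncosets K G + dav A K G \<le> size S + 1"
  shows "\<exists>H' S''. add_subgroup H' \<and> K \<subseteq> H' \<and> H' \<subseteq> G \<and> S'' \<subseteq># inside S \<alpha> H' \<and> fills K H' \<alpha> S'' \<and>
    size (outside S \<alpha> H') \<le> ncosets H' G - 2"
proof -
  note f = finite_indexD[OF fi]
  let ?b = "of_int a0 * \<alpha>"
  let ?P = "\<lambda>H'. add_subgroup H' \<and> H \<subseteq> H' \<and> H' \<subseteq> G \<and> size (outside S \<alpha> H') \<le> ncosets H' G - 2"
  have "outside S \<alpha> G = {#}" using S by (auto simp: outside_def filter_mset_eq_conv)
  \<comment> \<open>No term lies outside \<alpha> + G, so the truncated bound 1 - 2 = 0 is
    met.\<close>
  then have "?P G" using f H by simp
  then obtain H' where P: "?P H'" and mn: "\<And>L. ?P L \<Longrightarrow> ncosets K H' \<le> ncosets K L"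
    using ex_has_least_nat[of ?P G "ncosets K"] by blast
  have H': "add_subgroup H'" "K \<subseteq> H'" "H' \<subseteq> G" "H \<subseteq> H'" using P H by auto
  have fH': "finite_index K H'" by (rule finite_index_lower[OF fi H'(1-3)])
  have fHH': "finite_index H H'" by (rule finite_index_upper[OF fH' H(1,2) H'(4)])
  have fH: "finite_index K H" by (rule finite_index_lower[OF fi H])
  have fH'G: "finite_index H' G" by (rule finite_index_upper[OF fi H'(1-3)])
  define b where "b = ncosets H' G"
  define x where "x = ncosets H H'"
  define h where "h = ncosets K H"
  have b1: "1 \<le> b" and x1: "1 \<le> x" and h1: "1 \<le> h"
    unfolding b_def x_def h_def using index_pos fH'G fHH' fH by auto
  have idx': "ncosets K H' = h * x" unfolding h_def x_def by (rule index_tower[OF fH' H(1,2) H'(4)])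
  have idxG: "ncosets K G = h * x * b" unfolding b_def idx'[symmetric] by (rule index_tower[OF fi H'(1-3)])
  define SH where "SH = inside S \<alpha> H'"
  define R where "R = outside SH \<alpha> H"
  have R: "\<forall>s\<in>#R. s - \<alpha> \<in> H'" by (auto simp: R_def SH_def inside_def outside_def)
  have insH: "inside SH \<alpha> H = inside S \<alpha> H" using H'(4) by (auto simp: SH_def inside_def filter_filter_mset intro!: filter_mset_cong)
  \<comment> \<open>By minimality of \<open>H'\<close> more than |G / L| - 2 terms lie outside
    \<alpha> + L, and at most |G / H'| - 2 of them lie outside \<alpha> + \<open>H'\<close>. The
    product inequality leaves enough of them inside.\<close>
  have cr: "ncosets L H' \<le> size (outside R \<alpha> L) + 1" if L: "add_subgroup L" "H \<subseteq> L" "L \<subset> H'" for L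
  proof -
    have KL: "K \<subseteq> L" "L \<subseteq> G" "L \<subseteq> H'" using L H' H by auto
    have fLH': "finite_index L H'" by (rule finite_index_upper[OF fH' L(1) KL(1,3)])
    have a2: "2 \<le> ncosets L H'" using index_ge_2[OF fLH'] L by blast
    have "ncosets K H' = ncosets K L * ncosets L H'" by (rule index_tower[OF fH' L(1) KL(1,3)])
    moreover have "1 \<le> ncosets K L" by (rule index_pos[OF finite_index_lower[OF fi L(1) KL(1,2)]])
    ultimately have "ncosets K L < ncosets K H'" using a2 by simp
    then have "\<not> ?P L" using mn[of L] by linarith
    then have out: "ncosets L G - 2 < size (outside S \<alpha> L)" using L KL by simp
    have idxL: "ncosets L G = ncosets L H' * b"
      unfolding b_def by (rule index_tower[OF finite_index_upper[OF fi L(1) KL(1,2)] H'(1) KL(3) H'(3)])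
    have "outside S \<alpha> L = outside S \<alpha> H' + outside R \<alpha> L"
      using L(2) KL(3) by (auto simp: multiset_eq_iff R_def SH_def outside_def inside_def)
    then have "ncosets L H' * b - 2 < (b - 2) + size (outside R \<alpha> L)" using out idxL P b_def by simp
    moreover have "ncosets L H' + b \<le> ncosets L H' * b + 1" by (rule add_le_mult_plus_one) (use a2 b1 in auto)
    \<comment> \<open>b = 1 is separate because b - 2 truncates to 0 there.\<close>
    ultimately show ?thesis using a2 b1 by (cases "b = 1") auto
  qed
  obtain R' where R': "R' \<subseteq># R" "size R' + 1 \<le> x" "(\<Sum>s\<in>#R'. insert 0 (dilate A (s - \<alpha>))) + H = H'"
    using sum_translated_dilates_full[OF fHH' R cr] unfolding x_def by blast
  \<comment> \<open>N is the length that \<open>fills\<close> prescribes for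
    \<open>H'\<close>.\<close>
  define N where "N = h * x + dav A K H' - 1"
  have dp: "1 \<le> dav A K H'" "1 \<le> dav A K H" "1 \<le> dav A H' G" "1 \<le> dav A H H'"
    using dav_pos fH' fH fH'G fHH' by blast+
  have dG: "dav A K H' \<le> dav A K G" using dav_tower[OF fi H'(1-3)] dp by linarith
  have dH: "dav A K H + dav A H H' \<le> dav A K H' + 1" by (rule dav_tower[OF fH' H(1,2) H'(4)])
  have sS2: "size S2 + 1 = h + dav A K H" using fl by (simp add: fills_def h_def)
  have hx: "h + x \<le> h * x + 1" by (rule add_le_mult_plus_one[OF h1 x1])
  have hxb: "h * x + b \<le> h * x * b + 1" using add_le_mult_plus_one[of "h * x" b] h1 x1 b1 by simp
  have sSH: "N \<le> size SH"
  proof -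
    have "size S \<le> (b - 2) + size SH" using P size_inside_outside[of S \<alpha> H'] by (simp add: SH_def b_def)
    moreover have "h * x * b + dav A K H' \<le> size S + 1" using sz idxG dG by linarith
    ultimately show ?thesis unfolding N_def using hxb b1 by (cases "b = 1") auto
  qed
  have i: "h + dav A K H' \<le> size (inside S \<alpha> H) + 1" using ins dG h_def by linarith
  have SHeq: "SH = R + inside S \<alpha> H" using outside_plus_inside[of SH \<alpha> H] insH R_def by simp
  \<comment> \<open>\<open>R1\<close> must contain \<open>R'\<close> and still leave h of the h x
    slots for \<open>S2\<close>. If \<open>R'\<close> and \<alpha> + H together supply N terms,
    \<open>R'\<close> itself serves. Otherwise all terms in \<alpha> + H are used, and the
    hypothesis \<open>ins\<close> bounds the number still missing by h x - h.\<close>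
  obtain R1 I1 where RI: "R' \<subseteq># R1" "R1 \<subseteq># R" "S2 \<subseteq># I1" "I1 \<subseteq># inside S \<alpha> H" "size R1 + size I1 = N" "size R1 + h \<le> h * x"
  proof (cases "N \<le> size R' + size (inside S \<alpha> H)")
    case True
    have "size S2 \<le> N - size R'" unfolding N_def using sS2 R'(2) hx dH dp by linarith
    then obtain I1 where "S2 \<subseteq># I1" "I1 \<subseteq># inside S \<alpha> H" "size I1 = N - size R'"
      using submultiset_of_size_between[OF S2, of "N - size R'"] True by (metis le_diff_conv add.commute)
    moreover have "size R' \<le> N" unfolding N_def using R'(2) hx h1 dp by linarith
    moreover have "size R' + h \<le> h * x" using R'(2) hx by linarith
    ultimately show ?thesis using that[of R' I1] R' by simp
  next
    case False
    have "N - size (inside S \<alpha> H) \<le> size R" using sSH SHeq by simp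
    then obtain R1 where R1: "R' \<subseteq># R1" "R1 \<subseteq># R" "size R1 = N - size (inside S \<alpha> H)"
      using submultiset_of_size_between[OF R'(1), of "N - size (inside S \<alpha> H)"] False
      by (metis less_diff_conv less_imp_le not_le)
    then show ?thesis using that[of R1 "inside S \<alpha> H"] S2 i False by (simp add: N_def)
  qed
  define S'' where "S'' = R1 + I1"
  have sub: "S'' \<subseteq># SH" unfolding S''_def SHeq using RI by (intro subset_mset.add_mono)
  then have inH': "\<forall>s\<in>#S''. s - \<alpha> \<in> H'" using mset_subset_eqD[OF sub] by (auto simp: SH_def inside_def)
  have sH: "single A H \<alpha>" using fl by (simp add: fills_def)
  have sH': "single A H' \<alpha>" using single_mono[OF H(1) H'(1,4) sH] .
  have szS'': "size S'' + 1 = h * x + dav A K H'" unfolding S''_def using RI(5) dp h1 x1 by (simp add: N_def)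
  have full: "wsumset_n A (h * x) S'' + K = (of_nat (h * x) * ?b) +o H'"
  proof (rule equalityI)
    show "wsumset_n A (h * x) S'' + K \<subseteq> (of_nat (h * x) * ?b) +o H'"
    proof
      fix y assume "y \<in> wsumset_n A (h * x) S'' + K"
      then obtain w where w: "w \<in> wsumset_n A (h * x) S''" "y - w \<in> K" by (auto simp: mem_plus_iff)
      then have "(y - w) + (w - of_nat (h * x) * ?b) \<in> H'"
        using wsumset_n_coset[OF H'(1) sH' inH'] H'(2) by (intro add_subgroup_add[OF H'(1)]) blast+
      then show "y \<in> (of_nat (h * x) * ?b) +o H'" by (simp add: mem_elt_plus)
    qed
    show "(of_nat (h * x) * ?b) +o H' \<subseteq> wsumset_n A (h * x) S'' + K"
    proof
      fix y assume "y \<in> (of_nat (h * x) * ?b) +o H'"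
      then have "y - of_nat (h * x) * ?b \<in> (\<Sum>s\<in>#R'. insert 0 (dilate A (s - \<alpha>))) + H" using R'(3) by (simp add: mem_elt_plus)
      then obtain z where z: "z \<in> (\<Sum>s\<in>#R'. insert 0 (dilate A (s - \<alpha>)))" "y - of_nat (h * x) * ?b - z \<in> H" by (auto simp: mem_plus_iff)
      then obtain T where T: "T \<subseteq># R'" "z \<in> wsumset A (image_mset (\<lambda>s. s - \<alpha>) T)" using sumset_insert_zero by blast
      then obtain w where w: "w \<in> wsumset A T" "z - (w - of_nat (size T) * ?b) \<in> H" using wsumset_translate[OF H(1) sH] by blast
      have TR: "T \<subseteq># R1" using T RI(1) by (meson subset_mset.order_trans)
      have "size T \<le> h * x" using size_mset_mono[OF TR] RI(6) by linarith
      moreover have "(y - of_nat (h * x) * ?b - z) + (z - (w - of_nat (size T) * ?b)) \<in> H"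
        using add_subgroup_add[OF H(1) z(2) w(2)] .
      ultimately have "y - (w + of_nat (h * x - size T) * ?b) \<in> H" by (simp add: of_nat_diff algebra_simps)
      then have ex: "\<exists>T w. T \<subseteq># R1 \<and> w \<in> wsumset A T \<and> y - (w + of_nat (h * x - size T) * ?b) \<in> H" using TR w by blast
      have R1H': "\<forall>s\<in>#R1. s - \<alpha> \<in> H'" using R mset_subset_eqD[OF RI(2)] by blast
      have I1H: "\<forall>s\<in>#I1. s - \<alpha> \<in> H" using mset_subset_eqD[OF RI(4)] by (auto simp: inside_def)
      have flH: "wsumset_n A h S2 + K = (of_nat h * ?b) +o H" using fl by (simp add: fills_def h_def)
      have "y \<in> wsumset_n A (h * x) (R1 + I1) + K"
        by (rule iffD2[OF wsumset_n_periodic[OF fH' H(1,2) H'(4) sH R1H' I1H RI(3) flH] ex])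
           (use RI(5,6) sS2 dH szS'' S''_def in auto)
      then show "y \<in> wsumset_n A (h * x) S'' + K" by (simp add: S''_def)
    qed
  qed
  have "fills K H' \<alpha> S''" unfolding fills_def idx' using sH' inH' szS'' full by simp
  then show ?thesis using H' sub P unfolding SH_def by blast
qed

end

subsection \<open>The inductive structure theorem\<close>

lemma filter_mset_sum:
  fixes F :: "nat \<Rightarrow> 'b multiset"
  shows "filter_mset Q (\<Sum>i<h. F i) = (\<Sum>i<h. filter_mset Q (F i))"
  by (induction h) auto

text \<open>A new element goes into a block that does not yet meet its class. If all h blocks met
  it, the class would have h elements besides the new one.\<close>

lemma partition_into_transversals:
  fixes M :: "'b multiset" and f :: "'b \<Rightarrow> 'c"
  assumes "\<And>c. size {#x \<in># M. f x = c#} \<le> h"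
  shows "\<exists>P :: nat \<Rightarrow> 'b set. (\<forall>i<h. finite (P i) \<and> inj_on f (P i)) \<and> M = (\<Sum>i<h. mset_set (P i))"
  using assms
proof (induction M)
  case empty
  show ?case by (intro exI[of _ "\<lambda>_. {}"]) simp
next
  case (add x M)
  have le: "size {#y \<in># M. f y = c#} \<le> h" for c
    using add.prems[of c] by (cases "f x = c") auto
  obtain P where P: "\<forall>i<h. finite (P i) \<and> inj_on f (P i)" "M = (\<Sum>i<h. mset_set (P i))"
    using add.IH[OF le] by blast
  have "\<exists>i<h. f x \<notin> f ` P i"
  proof (rule ccontr)
    assume "\<not> ?thesis"
    then have *: "\<And>i. i < h \<Longrightarrow> f x \<in> f ` P i" by blast
    \<comment> \<open>Each block contributes at least one element of the class of x.\<close>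
    have ge: "k \<le> size (\<Sum>i<k. {#y \<in># mset_set (P i). f y = f x#})" if "k \<le> h" for k
      using that
    proof (induction k)
      case (Suc k)
      then obtain y where "y \<in> P k" "f y = f x" using *[of k] by auto
      then have "y \<in># {#y \<in># mset_set (P k). f y = f x#}" using P Suc.prems by simp
      then have "{#y \<in># mset_set (P k). f y = f x#} \<noteq> {#}" by auto
      then have "1 \<le> size {#y \<in># mset_set (P k). f y = f x#}" by (metis One_nat_def Suc_leI nonempty_has_size)
      then show ?case using Suc by simp
    qed simp
    have "h \<le> size {#y \<in># M. f y = f x#}" unfolding P(2) filter_mset_sum using ge[of h] by simp
    then show False using add.prems[of "f x"] by simp
  qed
  then obtain i where i: "i < h" "f x \<notin> f ` P i" by blast
  let ?P = "P(i := insert x (P i))"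
  have "x \<notin> P i" using i by auto
  then have m: "mset_set (insert x (P i)) = add_mset x (mset_set (P i))" using P i by simp
  have "(\<Sum>j<h. mset_set (?P j)) = mset_set (?P i) + (\<Sum>j\<in>{..<h} - {i}. mset_set (?P j))"
    using i by (intro sum.remove) auto
  also have "\<dots> = add_mset x (mset_set (P i) + (\<Sum>j\<in>{..<h} - {i}. mset_set (P j)))" using m by simp
  also have "\<dots> = add_mset x M" unfolding P(2) using i sum.remove[of "{..<h}" i "\<lambda>j. mset_set (P j)"] by simp
  finally have "add_mset x M = (\<Sum>j<h. mset_set (?P j))" by simp
  moreover have "\<forall>j<h. finite (?P j) \<and> inj_on f (?P j)" using P i by auto
  ultimately show ?case by blast
qed

context weights
begin

definition structured :: "'v::comm_ring_1 set \<Rightarrow> 'v set \<Rightarrow> 'v multiset \<Rightarrow> bool" where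
  "structured K G S \<longleftrightarrow> (\<exists>H \<alpha> S''. add_subgroup H \<and> K \<subseteq> H \<and> H \<subseteq> G \<and>
     S'' \<subseteq># inside S \<alpha> H \<and> fills K H \<alpha> S'' \<and> size (outside S \<alpha> H) \<le> ncosets H G - 2)"

lemma fills_trivial:
  assumes K: "add_subgroup K" and \<alpha>: "single A K \<alpha>"
  shows "fills K K \<alpha> {#\<alpha>#}"
proof -
  have "wsumset_n A 1 {#\<alpha>#} = dilate A \<alpha>"
  proof
    show "wsumset_n A 1 {#\<alpha>#} \<subseteq> dilate A \<alpha>"
    proof
      fix w assume "w \<in> wsumset_n A 1 {#\<alpha>#}"
      then obtain T where T: "T \<subseteq># {#\<alpha>#}" "size T = 1" "w \<in> wsumset A T" by (rule wsumset_nE)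
      then obtain t where "T = {#t#}" using size_1_singleton_mset by metis
      then show "w \<in> dilate A \<alpha>" using T by (simp add: wsumset_add_mset)
    qed
    show "dilate A \<alpha> \<subseteq> wsumset_n A 1 {#\<alpha>#}" by (auto intro!: wsumset_nI[of "{#\<alpha>#}"] simp: wsumset_add_mset)
  qed
  moreover have "dilate A \<alpha> + K = (of_int a0 * \<alpha>) +o K"
  proof (intro equalityI subsetI)
    fix x assume "x \<in> dilate A \<alpha> + K"
    then obtain y where "y \<in> dilate A \<alpha>" "x - y \<in> K" by (auto simp: mem_plus_iff)
    then show "x \<in> (of_int a0 * \<alpha>) +o K"
      using add_subgroup_diff_trans[OF K] dilate_single[OF K \<alpha>] by (auto simp: mem_elt_plus)
  next
    fix x assume "x \<in> (of_int a0 * \<alpha>) +o K"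
    then show "x \<in> dilate A \<alpha> + K" using a0 by (auto simp: mem_elt_plus mem_plus_iff dilate_def)
  qed
  ultimately show ?thesis
    using \<alpha> index_self[OF K] dav_self[OF K] add_subgroup_zero[OF K] by (simp add: fills_def)
qed

text \<open>Structure found inside \<alpha> + L controls only the terms there; terms outside
  \<alpha> + L may be too many for the bound in G, so \<open>fills_enlarge\<close> must readjust the
  subgroup. The hypothesis \<open>out\<close> allows for a loss of |G / L| - 2 terms at one level
  and |L / K| - 1 at another, and still leaves |L / K| + D terms, where D =
  \<open>dav A K G\<close>.\<close>

lemma structured_of_proper_subgroup:
  assumes fi: "finite_index K G" and L: "add_subgroup L" "K \<subseteq> L" "L \<subset> G"
    and \<alpha>: "single A L \<alpha>" and S: "\<forall>s\<in>#S. s - \<alpha> \<in> G"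
    and IH: "\<And>S'. \<forall>s\<in>#S'. s - \<alpha> \<in> L \<Longrightarrow> ncosets K L + dav A K L \<le> size S' + 1 \<Longrightarrow> structured K L S'"
    and out: "size (outside S \<alpha> L) + 3 \<le> ncosets L G + ncosets K L"
    and sz: "ncosets K G + dav A K G \<le> size S + 1"
  shows "structured K G S"
proof -
  note f = finite_indexD[OF fi]
  have LG: "L \<subseteq> G" using L by blast
  have fL: "finite_index K L" by (rule finite_index_lower[OF fi L(1,2) LG])
  have fLG: "finite_index L G" by (rule finite_index_upper[OF fi L(1,2) LG])
  define l where "l = ncosets K L"
  define q where "q = ncosets L G"
  have l1: "1 \<le> l" and q2: "2 \<le> q" using index_pos[OF fL] index_ge_2[OF fLG] L by (auto simp: l_def q_def)
  have lq: "ncosets K G = l * q" unfolding l_def q_def by (rule index_tower[OF fi L(1,2) LG])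
  have dL: "dav A K L \<le> dav A K G" using dav_tower[OF fi L(1,2) LG] dav_pos[OF fLG] by linarith
  let ?S = "inside S \<alpha> L"
  obtain q' where q': "q = q' + 2" using q2 by (metis add.commute le_Suc_ex)
  have "l * q' + l + dav A K G \<le> size ?S + q'"
    using sz size_inside_outside[of S \<alpha> L] out unfolding lq l_def[symmetric] q_def[symmetric] q' by (simp add: algebra_simps)
  moreover have "q' \<le> l * q'" using l1 by simp
  ultimately have sS: "l + dav A K G \<le> size ?S" by linarith
  then have "ncosets K L + dav A K L \<le> size ?S + 1" using dL l_def by linarith
  then have "structured K L ?S" by (intro IH) (auto simp: inside_def)
  then obtain H \<beta> S2 where H: "add_subgroup H" "K \<subseteq> H" "H \<subseteq> L" and S2: "S2 \<subseteq># inside ?S \<beta> H" "fills K H \<beta> S2"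
    and o2: "size (outside ?S \<beta> H) \<le> ncosets H L - 2" unfolding structured_def by blast
  have fH: "finite_index K H" by (rule finite_index_lower[OF fL H])
  define x where "x = ncosets H L"
  define h where "h = ncosets K H"
  have x1: "1 \<le> x" and h1: "1 \<le> h" unfolding x_def h_def using index_pos finite_index_upper[OF fL H] fH by auto
  have lhx: "l = h * x" unfolding l_def h_def x_def by (rule index_tower[OF fL H])
  \<comment> \<open>A term of \<open>S2\<close> lies in both classes and so ties \<beta> to \<alpha>
    modulo L.\<close>
  have "S2 \<noteq> {#}" using S2(2) h1 dav_pos[OF fH] by (auto simp: fills_def h_def)
  then obtain s where s: "s \<in># S2" by blast
  then have "s \<in># inside ?S \<beta> H" using S2(1) mset_subset_eqD by metis
  then have s: "s - \<alpha> \<in> L" "s - \<beta> \<in> L" using H by (auto simp: inside_def)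
  then have ba: "\<beta> - \<alpha> \<in> L" "\<alpha> - \<beta> \<in> G" using add_subgroup_diff[OF L(1) s(1,2)] add_subgroup_diff[OF L(1) s(2,1)] LG by auto
  have eq: "inside ?S \<beta> H = inside S \<beta> H"
  proof -
    have "s - \<alpha> \<in> L" if "s - \<beta> \<in> H" for s using add_subgroup_diff_trans[OF L(1) _ ba(1)] that H by blast
    then show ?thesis by (auto simp: inside_def filter_filter_mset intro!: filter_mset_cong)
  qed
  have "size ?S \<le> (x - 2) + size (inside S \<beta> H)" using size_inside_outside[of ?S \<beta> H] o2 eq x_def by simp
  moreover have "h + x \<le> h * x + 1" by (rule add_le_mult_plus_one[OF h1 x1])
  ultimately have ins: "ncosets K H + dav A K G \<le> size (inside S \<beta> H) + 1"
    using sS x1 unfolding h_def[symmetric] lhx by (cases "x = 1") auto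
  have "\<forall>s\<in>#S. s - \<beta> \<in> G" using S add_subgroup_diff_trans[OF f(2) _ ba(2)] by blast
  then show ?thesis
    using fills_enlarge[OF fi H(1,2) _ _ S2(2) S2(1)[unfolded eq] ins sz] H(3) LG unfolding structured_def by blast
qed

text \<open>Modulo the stabilizer L of the sum every crossing term counts, and each coset of L
  consists of |L / K| cosets of K. That factor outweighs the terms that are single modulo L, which
  \<open>poor\<close> limits to |L / K| - 2.\<close>

lemma ncosets_nonsingle_wsumset:
  assumes fi: "finite_index K G" and T: "\<forall>t\<in>#T. \<not> single A K t \<and> single A G t"
    and poor: "\<And>L. add_subgroup L \<Longrightarrow> K \<subset> L \<Longrightarrow> L \<subseteq> G \<Longrightarrow> size {#t \<in># T. single A L t#} + 2 \<le> ncosets K L"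
  shows "size T + 1 \<le> ncosets K (wsumset A T)"
proof -
  note f = finite_indexD[OF fi]
  define Z where "Z = wsumset A T + K"
  have ZK: "Z + K = Z" unfolding Z_def by (rule periodic_coset[OF f(1)])
  have Z0: "Z \<noteq> {}" unfolding Z_def using wsumset_nonempty subset_plus_subgroup[OF f(1)] by (metis subset_empty)
  define L where "L = stabilizer_in G Z"
  note st = stabilizer_in_props[OF fi ZK Z0, folded L_def]
  have fL: "finite_index L G" using finite_index_upper[OF fi st(1-3)] .
  have ZL: "Z = wsumset A T + L"
    by (metis Z_def add.assoc add.commute add_subgroup_absorb f(1) add_subgroup_zero st(1) st(2) st(4))
  have "size {#t \<in># T. crosses L (dilate A t)#} + 1 \<le> ncosets L (wsumset A T)"
    unfolding wsumset_def
    by (rule sumset_size_if_aperiodic[OF fL]) (use T dilate_nonempty st(5) ZL in \<open>auto simp: single_def wsumset_def\<close>)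
  moreover have "ncosets L (wsumset A T) = ncosets L Z" using ZL ncosets_plus[OF st(1)] by simp
  moreover have "ncosets K (wsumset A T) = ncosets K Z" using Z_def ncosets_plus[OF f(1)] by simp
  moreover have "ncosets K Z = ncosets K L * ncosets L Z" by (rule ncosets_tower[OF f(1) st(1,2,4)])
  ultimately have main: "ncosets K L * (size {#t \<in># T. \<not> single A L t#} + 1) \<le> ncosets K (wsumset A T)"
    by (simp only: single_def not_not mult_le_mono2)
  have split: "size T = size {#t \<in># T. single A L t#} + size {#t \<in># T. \<not> single A L t#}"
    by (metis multiset_partition size_union)
  show ?thesis
  proof (cases "L = K")
    case True
    then have "{#t \<in># T. single A L t#} = {#}" using T by (intro filter_mset_empty_if) auto
    then have "size T = size {#t \<in># T. \<not> single A L t#}" using split by simp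
    then show ?thesis using main True index_self[OF f(1)] by (metis mult_1)
  next
    \<comment> \<open>With p terms single and c not single modulo L, the claim is that (p + 2 + a)(c
      + 1) is at least p + c + 1.\<close>
    case False
    then have p: "size {#t \<in># T. single A L t#} + 2 \<le> ncosets K L" using poor st by blast
    then obtain a where a: "ncosets K L = size {#t \<in># T. single A L t#} + 2 + a" using le_Suc_ex by blast
    show ?thesis using main unfolding a split by (simp add: algebra_simps)
  qed
qed

text \<open>A block supplies at most one term. This is where the bound h on the number of removed
  terms comes from.\<close>

lemma sumset_blocks_elim:
  fixes g :: "'b \<Rightarrow> 'v::comm_ring_1"
  assumes "\<forall>i<j. finite (P i)" "z \<in> (\<Sum>i<j. insert 0 (g ` P i))"
  shows "\<exists>N. N \<subseteq># (\<Sum>i<j. mset_set (P i)) \<and> size N \<le> j \<and> z = (\<Sum>s\<in>#N. g s)"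
  using assms
proof (induction j arbitrary: z)
  case (Suc j)
  then obtain y c where z: "z = y + c" "y \<in> (\<Sum>i<j. insert 0 (g ` P i))" "c \<in> insert 0 (g ` P j)"
    by (auto simp only: sum.lessThan_Suc elim!: set_plus_elim)
  then obtain N where N: "N \<subseteq># (\<Sum>i<j. mset_set (P i))" "size N \<le> j" "y = (\<Sum>s\<in>#N. g s)" using Suc by force
  show ?case
  proof (cases "c = 0")
    case True
    then show ?thesis using N z by (intro exI[of _ N]) (auto intro: subset_mset.order_trans)
  next
    case False
    then obtain s where s: "s \<in> P j" "c = g s" using z by blast
    then have "{#s#} \<subseteq># mset_set (P j)" using Suc.prems by simp
    then have "N + {#s#} \<subseteq># (\<Sum>i<Suc j. mset_set (P i))" using N by (simp only: sum.lessThan_Suc subset_mset.add_mono)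
    then show ?thesis using N z s by (intro exI[of _ "N + {#s#}"]) auto
  qed
qed simp

text \<open>Each block of singles with distinct classes contributes its full size to the sumset unless zero
  has a second representation, and that representation tells which terms to remove.\<close>

lemma removable_singles:
  fixes \<alpha> :: "'v::comm_ring_1"
  assumes fi: "finite_index K G" and \<alpha>: "single A K \<alpha>"
    and M: "\<forall>s\<in>#M. single A K s \<and> s - \<alpha> \<in> G \<and> s - \<alpha> \<notin> K"
    and mult: "\<And>s. size {#t \<in># M. t - s \<in> K#} \<le> h"
    and D: "D + K = D" "D \<subseteq> G" "0 \<in> D"
    and big: "ncosets K G < size M + ncosets K D"
  shows "\<exists>N d. N \<subseteq># M \<and> N \<noteq> {#} \<and> size N \<le> h \<and> d \<in> D \<and>
    d + of_nat (size N) * (of_int a0 * \<alpha>) - of_int a0 * (\<Sum>\<^sub># N) \<in> K"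
proof (rule ccontr)
  assume no: "\<not> ?thesis"
  note f = finite_indexD[OF fi]
  \<comment> \<open>Deleting the single s, and with it one unit of length, changes the normalized
    value by g s modulo K.\<close>
  define g where "g s = of_int a0 * \<alpha> - of_int a0 * s" for s
  have gN: "(\<Sum>s\<in>#N. g s) = of_nat (size N) * (of_int a0 * \<alpha>) - of_int a0 * (\<Sum>\<^sub># N)" for N
    by (induction N) (simp_all add: g_def algebra_simps)
  have "size {#t \<in># M. t +o K = c#} \<le> h" for c
  proof (cases "\<exists>s. c = s +o K")
    case True
    then show ?thesis using mult coset_eq_iff[OF f(1)] by auto
  next
    case False
    then have "{#t \<in># M. t +o K = c#} = {#}" by (intro filter_mset_empty_if) blast
    then show ?thesis by (metis size_empty zero_le)
  qed
  then obtain P where P: "\<forall>i<h. finite (P i) \<and> inj_on (\<lambda>t. t +o K) (P i)" "M = (\<Sum>i<h. mset_set (P i))"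
    using partition_into_transversals[where M = M and f = "\<lambda>t. t +o K" and h = h] by blast
  have PM: "mset_set (P i) \<subseteq># M" if "i < h" for i
    unfolding P(2) using that sum.remove[of "{..<h}" i "\<lambda>j. mset_set (P j)"] by simp
  \<comment> \<open>Blocks are added one at a time; each adds its cardinality to the coset count as
    long as zero is represented uniquely.\<close>
  define X where "X j = D + (\<Sum>i<j. insert 0 (g ` P i))" for j
  have Xp: "X j + K = X j" for j unfolding X_def using D(1) by (metis add.assoc add.commute)
  have step: "size (\<Sum>i<j. mset_set (P i)) + ncosets K D \<le> ncosets K (X j) \<and> X j \<subseteq> G \<and> 0 \<in> X j" if "j \<le> h" for j
    using that
  proof (induction j)
    case 0
    then show ?case using D by (simp add: X_def)
  next
    case (Suc j)
    then have jh: "j < h" and IH: "size (\<Sum>i<j. mset_set (P i)) + ncosets K D \<le> ncosets K (X j)" "X j \<subseteq> G" "0 \<in> X j" by auto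
    let ?C = "insert 0 (g ` P j)"
    have fin: "finite (P j)" using P jh by blast
    have Pj: "single A K s \<and> s - \<alpha> \<in> G \<and> s - \<alpha> \<notin> K" if "s \<in> P j" for s
    proof -
      have "s \<in># M" using PM[OF jh] that fin by (metis finite_set_mset_mset_set mset_subset_eqD)
      then show ?thesis using M by blast
    qed
    have CG: "?C \<subseteq> G"
    proof
      fix c assume "c \<in> ?C"
      then consider "c = 0" | s where "s \<in> P j" "c = g s" by blast
      then show "c \<in> G"
      proof cases
        case 2
        then have "of_int a0 * (\<alpha> - s) \<in> G" using Pj add_subgroup_of_int[OF f(2)] add_subgroup_diff_commute[OF f(2)] by blast
        then show ?thesis unfolding 2(2) g_def by (simp only: right_diff_distrib)
      qed (simp add: add_subgroup_zero[OF f(2)])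
    qed
    then have CKG: "?C + K \<subseteq> G" using f(3) set_plus_mono2[of ?C G K G] add_subgroup_absorb[OF f(2)] add_subgroup_zero[OF f(2)] by blast
    have ginj: "s = t" if "s \<in> P j" "t \<in> P j" "g s - g t \<in> K" for s t
    proof -
      have "of_int a0 * t - of_int a0 * s \<in> K" using that by (simp add: g_def)
      then have "t - s \<in> K" using single_class_eq[OF f(1)] Pj that by blast
      then show ?thesis using P jh that coset_eq_iff[OF f(1)] by (metis inj_onD)
    qed
    have gnz: "g s \<notin> K" if "s \<in> P j" for s
      using single_class_eq[OF f(1) \<alpha>, of s] Pj[OF that] add_subgroup_diff_commute[OF f(1)] by (auto simp: g_def)
    have "inj_on (\<lambda>x. x +o K) ?C"
      using ginj gnz add_subgroup_minus[OF f(1)] by (auto simp: inj_on_def coset_eq_iff[OF f(1)]) (metis minus_minus)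
    moreover have "card ?C = card (P j) + 1"
    proof -
      have "inj_on g (P j)" using ginj add_subgroup_zero[OF f(1)] by (auto simp: inj_on_def)
      moreover have "0 \<notin> g ` P j" using gnz add_subgroup_zero[OF f(1)] by force
      ultimately show ?thesis using fin by (simp add: card_image)
    qed
    ultimately have nC: "ncosets K (?C + K) = card (P j) + 1"
      unfolding ncosets_plus[OF f(1)] unfolding ncosets_def by (simp only: card_image)
    have "ncosets K (X j) + ncosets K (?C + K) \<le> ncosets K (X j + (?C + K)) + 1"
    proof (rule scherk_kemperman[OF fi Xp IH(2,3) periodic_coset[OF f(1)] CKG])
      show "0 \<in> ?C + K" using subset_plus_subgroup[OF f(1), of ?C] by blast
      \<comment> \<open>If y is outside K, it uses some s of block j; with at most one term per
        earlier block this gives exactly the set N that was assumed not to exist.\<close>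
      fix x y assume x: "x \<in> X j" and y: "y \<in> ?C + K" and xy: "x + y \<in> K"
      obtain c where c: "c \<in> ?C" "y - c \<in> K" using y unfolding mem_plus_iff by blast
      show "y \<in> K"
      proof (cases "c = 0")
        case False
        then obtain s where s: "s \<in> P j" "c = g s" using c by blast
        obtain d z where dz: "x = d + z" "d \<in> D" "z \<in> (\<Sum>i<j. insert 0 (g ` P i))" using x unfolding X_def by (rule set_plus_elim)
        then obtain N where N: "N \<subseteq># (\<Sum>i<j. mset_set (P i))" "size N \<le> j" "z = (\<Sum>s\<in>#N. g s)"
          using sumset_blocks_elim[of j P z g] P jh by auto
        have "N + {#s#} \<subseteq># (\<Sum>i<Suc j. mset_set (P i))"
          unfolding sum.lessThan_Suc using N s fin by (intro subset_mset.add_mono) auto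
        moreover have "(\<Sum>i<Suc j. mset_set (P i)) \<subseteq># M" unfolding P(2)
        proof -
          have "(\<Sum>i<h. mset_set (P i)) = (\<Sum>i<Suc j. mset_set (P i)) + (\<Sum>i\<in>{Suc j..<h}. mset_set (P i))"
            using sum.atLeastLessThan_concat[of 0 "Suc j" h "\<lambda>i. mset_set (P i)"] jh
            by (simp only: atLeast0LessThan[symmetric] Suc_le_eq)
          then show "(\<Sum>i<Suc j. mset_set (P i)) \<subseteq># (\<Sum>i<h. mset_set (P i))" by simp
        qed
        ultimately have sub: "N + {#s#} \<subseteq># M" by (rule subset_mset.order_trans)
        have "(x + y) - (y - c) \<in> K" using add_subgroup_diff[OF f(1) xy c(2)] .
        then have "d + (\<Sum>s\<in>#N + {#s#}. g s) \<in> K" using dz N s by (simp add: algebra_simps)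
        then have "d + of_nat (size (N + {#s#})) * (of_int a0 * \<alpha>) - of_int a0 * (\<Sum>\<^sub># (N + {#s#})) \<in> K"
          unfolding gN by (simp only: add_diff_eq)
        moreover have "N + {#s#} \<noteq> {#}" "size (N + {#s#}) \<le> h" using N jh by auto
        ultimately show ?thesis using no sub dz(2) by blast
      qed (use c in simp)
    qed
    moreover have "X j + (?C + K) = X (Suc j)"
    proof -
      have "X j + (?C + K) = (X j + K) + ?C" by (simp only: ac_simps)
      then show ?thesis unfolding Xp by (simp only: X_def sum.lessThan_Suc add.assoc)
    qed
    moreover have "X j + (?C + K) \<subseteq> G" using set_plus_mono2[OF IH(2) CKG] add_subgroup_absorb[OF f(2)] add_subgroup_zero[OF f(2)] by blast
    moreover have "0 + 0 \<in> X j + (?C + K)" using IH(3) subset_plus_subgroup[OF f(1), of ?C] by (intro set_plus_intro) auto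
    ultimately show ?case using IH nC by simp
  qed
  \<comment> \<open>After all blocks the sum would need |M| plus the cosets of D, which exceeds |G /
    K| by \<open>big\<close>.\<close>
  have "ncosets K (X h) \<le> ncosets K G" using ncosets_mono[OF fi, of G 0 "X h"] step[of h] by simp
  then show False using step[of h] big P(2) by simp
qed

lemma wsumset_n_plus_subset:
  assumes G: "add_subgroup G" "K \<subseteq> G" and \<alpha>: "single A G \<alpha>" and S: "\<forall>s\<in>#S. s - \<alpha> \<in> G"
  shows "wsumset_n A n S + K \<subseteq> (of_nat n * (of_int a0 * \<alpha>)) +o G"
proof
  fix y assume "y \<in> wsumset_n A n S + K"
  then obtain w where w: "w \<in> wsumset_n A n S" "y - w \<in> K" by (auto simp: mem_plus_iff)
  then have "(y - w) + (w - of_nat n * (of_int a0 * \<alpha>)) \<in> G"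
    using wsumset_n_coset[OF G(1) \<alpha> S] G(2) by (intro add_subgroup_add[OF G(1)]) blast+
  then show "y \<in> (of_nat n * (of_int a0 * \<alpha>)) +o G" by (simp add: mem_elt_plus)
qed

text \<open>Some singles are deleted, and the resulting error is compensated by choosing other
  weights on the nonsingles. The nonsingles Z alone offer at least |Z| + 1 adjustments modulo K;
  together with the singles this exceeds |G / K|, so a deletable set exists.\<close>

lemma shorten_representation:
  fixes \<alpha> :: "'v::comm_ring_1"
  assumes fi: "finite_index K G" and \<alpha>: "single A K \<alpha>"
    and T: "\<forall>s\<in>#T. s - \<alpha> \<in> G \<and> s - \<alpha> \<notin> K"
    and mult: "\<And>s. s \<in># T \<Longrightarrow> single A K s \<Longrightarrow> size (inside T s K) \<le> h"
    and poor: "\<And>L. add_subgroup L \<Longrightarrow> K \<subset> L \<Longrightarrow> L \<subseteq> G \<Longrightarrow>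
      size {#t \<in># T. \<not> single A K t \<and> single A L t#} + 2 \<le> ncosets K L"
    and big: "ncosets K G < size T" and w: "w \<in> wsumset A T"
  shows "\<exists>T' w'. T' \<subseteq># T \<and> size T' < size T \<and> size T \<le> size T' + h \<and> w' \<in> wsumset A T' \<and>
    (w - of_nat (size T) * (of_int a0 * \<alpha>)) - (w' - of_nat (size T') * (of_int a0 * \<alpha>)) \<in> K"
proof -
  note f = finite_indexD[OF fi]
  let ?b = "of_int a0 * \<alpha>"
  define Y where "Y = {#t \<in># T. single A K t#}"
  define Z where "Z = {#t \<in># T. \<not> single A K t#}"
  have TYZ: "T = Y + Z" unfolding Y_def Z_def by (rule multiset_partition)
  obtain u v where uv: "w = u + v" "u \<in> wsumset A Y" "v \<in> wsumset A Z" using w unfolding TYZ wsumset_union by (rule set_plus_elim)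
  have \<alpha>G: "single A G \<alpha>" by (rule single_mono[OF f(1-3) \<alpha>])
  have sG: "\<forall>s\<in>#T. single A G s" using single_cong[OF f(2) \<alpha>G] T by blast
  \<comment> \<open>The changes of the sum that reweighting Z can produce, modulo K; 0 is the
    present choice.\<close>
  define D where "D = (- v) +o (wsumset A Z + K)"
  have "size Z + 1 \<le> ncosets K (wsumset A Z)"
  proof (rule ncosets_nonsingle_wsumset[OF fi])
    show "\<forall>t\<in>#Z. \<not> single A K t \<and> single A G t" using sG by (auto simp: Z_def)
    fix L assume "add_subgroup L" "K \<subset> L" "L \<subseteq> G"
    then show "size {#t \<in># Z. single A L t#} + 2 \<le> ncosets K L"
      using poor[of L] by (simp add: Z_def filter_filter_mset conj_commute)
  qed
  then have "size Z + 1 \<le> ncosets K D" by (simp add: D_def ncosets_elt_plus ncosets_plus[OF f(1)])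
  then have bigD: "ncosets K G < size Y + ncosets K D" using big TYZ by simp
  have D1: "D + K = D" unfolding D_def by (simp only: set_plus_rearrange3 periodic_coset[OF f(1)])
  have D2: "D \<subseteq> G"
  proof
    fix d assume "d \<in> D"
    then obtain v' where v': "v' \<in> wsumset A Z" "d + v - v' \<in> K" by (auto simp: D_def mem_elt_plus mem_plus_iff)
    have "v' - of_int a0 * (\<Sum>\<^sub># Z) \<in> G" "v - of_int a0 * (\<Sum>\<^sub># Z) \<in> G"
      using wsumset_single_diff[OF f(2)] v'(1) uv(3) sG by (auto simp: Z_def)
    then have "(d + v - v') + ((v' - of_int a0 * (\<Sum>\<^sub># Z)) - (v - of_int a0 * (\<Sum>\<^sub># Z))) \<in> G"
      using v'(2) f(3) add_subgroup_add[OF f(2)] add_subgroup_diff[OF f(2)] by blast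
    then show "d \<in> G" by simp
  qed
  have D3: "0 \<in> D" using uv(3) subset_plus_subgroup[OF f(1)] by (auto simp: D_def mem_elt_plus)
  have mY: "size {#t \<in># Y. t - s \<in> K#} \<le> h" for s
  proof (cases "\<exists>t0\<in>#Y. t0 - s \<in> K")
    case True
    then obtain t0 where t0: "t0 \<in># Y" "t0 - s \<in> K" by blast
    have "{#t \<in># Y. t - s \<in> K#} \<subseteq># {#t \<in># T. t - s \<in> K#}" unfolding Y_def by (intro multiset_filter_mono multiset_filter_subset)
    also have "\<dots> \<subseteq># inside T t0 K" unfolding inside_def
      using add_subgroup_diff_trans[OF f(1)] t0(2) add_subgroup_diff_commute[OF f(1)] by (intro filter_mset_subset_filter_mset) blast
    finally have "size {#t \<in># Y. t - s \<in> K#} \<le> size (inside T t0 K)" by (rule size_mset_mono)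
    also have "\<dots> \<le> h" using mult t0(1) by (simp add: Y_def)
    finally show ?thesis .
  next
    case False
    then have "{#t \<in># Y. t - s \<in> K#} = {#}" by (intro filter_mset_empty_if) blast
    then show ?thesis by (metis size_empty zero_le)
  qed
  have Ys: "\<forall>s\<in>#Y. single A K s \<and> s - \<alpha> \<in> G \<and> s - \<alpha> \<notin> K" using T by (auto simp: Y_def)
  obtain N d where N: "N \<subseteq># Y" "N \<noteq> {#}" "size N \<le> h" "d \<in> D" "d + of_nat (size N) * ?b - of_int a0 * (\<Sum>\<^sub># N) \<in> K"
    using removable_singles[OF fi \<alpha> Ys mY D1 D2 D3 bigD] by blast
  obtain v' where v': "v' \<in> wsumset A Z" "d + v - v' \<in> K" using N(4) by (auto simp: D_def mem_elt_plus mem_plus_iff)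
  define T' where "T' = (Y - N) + Z"
  define w' where "w' = of_int a0 * (\<Sum>\<^sub># (Y - N)) + v'"
  have YN: "Y = N + (Y - N)" using N(1) by simp
  then have sY: "\<Sum>\<^sub># Y = \<Sum>\<^sub># N + \<Sum>\<^sub># (Y - N)" "size Y = size N + size (Y - N)" by (metis sum_mset.union, metis size_union)
  have "T' \<subseteq># T" unfolding T'_def TYZ by (intro subset_mset.add_mono) auto
  moreover have szT: "size T = size T' + size N" unfolding T'_def TYZ using sY by simp
  moreover have "0 < size N" using N(2) by (simp add: nonempty_has_size)
  moreover have "w' \<in> wsumset A T'" unfolding w'_def T'_def wsumset_union using sum_in_wsumset v'(1) by blast
  moreover have "(u - of_int a0 * (\<Sum>\<^sub># Y)) + (d + v - v') - (d + of_nat (size N) * ?b - of_int a0 * (\<Sum>\<^sub># N)) \<in> K"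
    using add_subgroup_diff[OF f(1) add_subgroup_add[OF f(1) wsumset_single_diff[OF f(1) _ uv(2)] v'(2)] N(5)] Ys by blast
  then have "(w - of_nat (size T) * ?b) - (w' - of_nat (size T') * ?b) \<in> K"
    unfolding uv(1) w'_def szT sY by (simp add: algebra_simps)
  ultimately show ?thesis using N(3) by (intro exI[of _ T'] exI[of _ w']) auto
qed

text \<open>Every element gets a representation outside \<alpha> + K, lengthened by zero sums until
  at most h slots stay free. A shortest such representation has at most n terms, since a longer one
  could lose between 1 and h terms. The free slots are filled with the h terms in \<alpha> +
  K.\<close>

lemma fills_whole_group:
  fixes \<alpha> :: "'v::comm_ring_1"
  assumes fi: "finite_index K G" and \<alpha>: "single A K \<alpha>" and S: "\<forall>s\<in>#S. s - \<alpha> \<in> G"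
    and cr: "\<And>L. add_subgroup L \<Longrightarrow> K \<subseteq> L \<Longrightarrow> L \<subset> G \<Longrightarrow> ncosets L G \<le> size (outside S \<alpha> L) + 1"
    and mult: "\<And>s. s \<in># S \<Longrightarrow> single A K s \<Longrightarrow> size (inside S s K) \<le> size (inside S \<alpha> K)"
    and hD: "size (inside S \<alpha> K) < dav A K G"
    and poor: "\<And>L. add_subgroup L \<Longrightarrow> K \<subset> L \<Longrightarrow> L \<subseteq> G \<Longrightarrow>
      size {#t \<in># S. \<not> single A K t \<and> single A L t#} + 2 \<le> ncosets K L"
    and sz: "ncosets K G + dav A K G \<le> size S + 1"
  shows "\<exists>S''. S'' \<subseteq># S \<and> fills K G \<alpha> S''"
proof -
  note f = finite_indexD[OF fi]
  let ?b = "of_int a0 * \<alpha>"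
  define n where "n = ncosets K G"
  define h where "h = size (inside S \<alpha> K)"
  define I where "I = inside S \<alpha> K"
  have \<alpha>G: "single A G \<alpha>" by (rule single_mono[OF f(1-3) \<alpha>])
  have cr': "ncosets L G \<le> size (outside (outside S \<alpha> K) \<alpha> L) + 1" if "add_subgroup L" "K \<subseteq> L" "L \<subset> G" for L
  proof -
    have "outside (outside S \<alpha> K) \<alpha> L = outside S \<alpha> L"
      using that by (auto simp: outside_def filter_filter_mset intro!: filter_mset_cong)
    then show ?thesis using cr[OF that] by simp
  qed
  have oG: "\<forall>s\<in>#outside S \<alpha> K. s - \<alpha> \<in> G" using S by (auto simp: outside_def)
  obtain R' where R': "R' \<subseteq># outside S \<alpha> K" "size R' + 1 \<le> n"
    "(\<Sum>s\<in>#R'. insert 0 (dilate A (s - \<alpha>))) + K = G"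
    using sum_translated_dilates_full[OF fi oG cr'] unfolding n_def by blast
  have "R' + I \<subseteq># outside S \<alpha> K + inside S \<alpha> K" unfolding I_def using R'(1) by (intro subset_mset.add_mono) auto
  then have RI: "R' + I \<subseteq># S" using outside_plus_inside by metis
  \<comment> \<open>\<open>R'\<close> has at most n - 1 terms and I at most D - 1, with D =
    \<open>dav A K G\<close>, so both fit into \<open>S''\<close>.\<close>
  have "size (R' + I) \<le> n + dav A K G - 1" using R'(2) hD I_def by simp
  moreover have "n + dav A K G - 1 \<le> size S" using sz n_def by simp
  ultimately obtain S'' where S'': "R' + I \<subseteq># S''" "S'' \<subseteq># S" "size S'' = n + dav A K G - 1"
    using submultiset_of_size_between[OF RI] by blast
  define R where "R = outside S'' \<alpha> K"
  have "I \<subseteq># S''" "R' \<subseteq># S''" using S''(1) by (meson mset_subset_eq_add_left mset_subset_eq_add_right subset_mset.order_trans)+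
  have "inside S'' \<alpha> K = I"
  proof (rule subset_mset.antisym)
    show "inside S'' \<alpha> K \<subseteq># I" unfolding I_def inside_def using S''(2) by (rule multiset_filter_mono)
    have "filter_mset (\<lambda>s. s - \<alpha> \<in> K) I \<subseteq># inside S'' \<alpha> K" unfolding inside_def using \<open>I \<subseteq># S''\<close> by (rule multiset_filter_mono)
    then show "I \<subseteq># inside S'' \<alpha> K" by (simp add: I_def inside_def filter_filter_mset)
  qed
  then have SRI: "S'' = R + I" unfolding R_def using outside_plus_inside by metis
  have R'R: "R' \<subseteq># R"
  proof -
    have "filter_mset (\<lambda>s. s - \<alpha> \<notin> K) R' = R'" unfolding filter_mset_eq_conv using mset_subset_eqD[OF R'(1)] by (auto simp: outside_def)
    then show ?thesis unfolding R_def outside_def using multiset_filter_mono[OF \<open>R' \<subseteq># S''\<close>] by metis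
  qed
  have RG: "\<forall>s\<in>#R. s - \<alpha> \<in> G \<and> s - \<alpha> \<notin> K" using S mset_subset_eqD[OF S''(2)] by (auto simp: R_def outside_def)
  have hI: "size I = h" by (simp add: I_def h_def)
  have d1: "1 \<le> dav A K G" by (rule dav_pos[OF fi])
  have szR: "size R + 1 + h = n + dav A K G" using S''(3) SRI hI d1 by simp
  have S''G: "\<forall>s\<in>#S''. s - \<alpha> \<in> G" using S mset_subset_eqD[OF S''(2)] by blast
  have "(of_nat n * ?b) +o G \<subseteq> wsumset_n A n S'' + K"
  proof
    fix y assume "y \<in> (of_nat n * ?b) +o G"
    define g where "g = y - of_nat n * ?b"
    have "g \<in> (\<Sum>s\<in>#R'. insert 0 (dilate A (s - \<alpha>))) + K" using \<open>y \<in> (of_nat n * ?b) +o G\<close> R'(3) by (simp add: g_def mem_elt_plus)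
    then obtain z where z: "z \<in> (\<Sum>s\<in>#R'. insert 0 (dilate A (s - \<alpha>)))" "g - z \<in> K" by (auto simp: mem_plus_iff)
    then obtain T0 where T0: "T0 \<subseteq># R'" "z \<in> wsumset A (image_mset (\<lambda>s. s - \<alpha>) T0)" using sumset_insert_zero by blast
    then obtain w0 where w0: "w0 \<in> wsumset A T0" "z - (w0 - of_nat (size T0) * ?b) \<in> K" using wsumset_translate[OF f(1) \<alpha>] by blast
    have T0R: "T0 \<subseteq># R" using T0 R'R by (meson subset_mset.order_trans)
    have g0: "g - (w0 - of_nat (size T0) * ?b) \<in> K" using add_subgroup_diff_trans[OF f(1) z(2) w0(2)] .
    have RG': "\<forall>s\<in>#R. s - \<alpha> \<in> G" using RG by blast
    obtain T1 w1 where T1: "T1 \<subseteq># R" "w1 \<in> wsumset A T1" "size R + 1 \<le> size T1 + dav A K G"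
      "(w1 - of_nat (size T1) * ?b) - (w0 - of_nat (size T0) * ?b) \<in> K"
      using extend_by_zero_sums[OF fi \<alpha> RG' T0R w0(1)] by blast
    \<comment> \<open>The lower bound n - h on the length is what the h terms of I can make up for;
      by \<open>szR\<close> the extended representation \<open>T1\<close> meets it.\<close>
    let ?Q = "\<lambda>T. T \<subseteq># R \<and> n \<le> size T + h \<and> (\<exists>w\<in>wsumset A T. g - (w - of_nat (size T) * ?b) \<in> K)"
    have "g - (w1 - of_nat (size T1) * ?b) \<in> K"
      using add_subgroup_diff_trans[OF f(1) g0] T1(4) add_subgroup_diff_commute[OF f(1)] by blast
    then have "?Q T1" using T1 szR by auto
    then obtain T where T: "?Q T" and mn: "\<And>M. ?Q M \<Longrightarrow> size T \<le> size M"
      using ex_has_least_nat[of ?Q T1 size] by blast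
    then obtain w where w: "w \<in> wsumset A T" "g - (w - of_nat (size T) * ?b) \<in> K" by blast
    have Tn: "size T \<le> n"
    proof (rule ccontr)
      assume "\<not> size T \<le> n"
      then have big: "ncosets K G < size T" using n_def by simp
      have TR: "T \<subseteq># R" using T by blast
      then have TS: "T \<subseteq># S" using SRI S''(2) by (meson mset_subset_eq_add_left subset_mset.order_trans)
      have TG: "\<forall>s\<in>#T. s - \<alpha> \<in> G \<and> s - \<alpha> \<notin> K" using RG mset_subset_eqD[OF TR] by blast
      have mT: "size (inside T s K) \<le> h" if s: "s \<in># T" "single A K s" for s
      proof -
        have "size (inside T s K) \<le> size (inside S s K)" unfolding inside_def by (intro size_mset_mono multiset_filter_mono TS)
        then show ?thesis using mult[OF mset_subset_eqD[OF TS s(1)] s(2)] h_def by simp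
      qed
      have pT: "size {#t \<in># T. \<not> single A K t \<and> single A L t#} + 2 \<le> ncosets K L"
        if L: "add_subgroup L" "K \<subset> L" "L \<subseteq> G" for L
        using poor[OF L] size_mset_mono[OF multiset_filter_mono[OF TS, of "\<lambda>t. \<not> single A K t \<and> single A L t"]] by linarith
      obtain T' w' where T': "T' \<subseteq># T" "size T' < size T" "size T \<le> size T' + h" "w' \<in> wsumset A T'"
        "(w - of_nat (size T) * ?b) - (w' - of_nat (size T') * ?b) \<in> K"
        using shorten_representation[OF fi \<alpha> TG mT pT big w(1)] by blast
      have "T' \<subseteq># R" using T'(1) TR by (rule subset_mset.order_trans)
      moreover have "n \<le> size T' + h" using T'(3) big n_def by linarith
      moreover have "g - (w' - of_nat (size T') * ?b) \<in> K" using add_subgroup_diff_trans[OF f(1) w(2) T'(5)] .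
      ultimately have "size T \<le> size T'" using mn T'(4) by blast
      then show False using T'(2) by simp
    qed
    have "n - size T \<le> size I" using T hI by auto
    then obtain V where V: "V \<subseteq># I" "size V = n - size T" by (rule submultiset_of_size)
    obtain v where v: "v \<in> wsumset A V" using wsumset_nonempty[of V] by blast
    have "\<forall>s\<in>#V. s - \<alpha> \<in> K" using mset_subset_eqD[OF V(1)] by (auto simp: I_def inside_def)
    then have "v - of_nat (n - size T) * ?b \<in> K" using wsumset_coset[OF f(1) \<alpha> _ v] V(2) by simp
    then have "(g - (w - of_nat (size T) * ?b)) - (v - of_nat (n - size T) * ?b) \<in> K" using add_subgroup_diff[OF f(1) w(2)] by blast
    then have "y - (w + v) \<in> K" using Tn by (simp add: g_def of_nat_diff algebra_simps)
    moreover have "T + V \<subseteq># S''" unfolding SRI using T V by (intro subset_mset.add_mono) auto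
    then have "w + v \<in> wsumset_n A n S''" using w v V Tn by (intro wsumset_nI[of "T + V"]) (auto simp: wsumset_union)
    ultimately show "y \<in> wsumset_n A n S'' + K" by (auto simp: mem_plus_iff)
  qed
  then have "wsumset_n A n S'' + K = (of_nat n * ?b) +o G" using wsumset_n_plus_subset[OF f(2,3) \<alpha>G S''G] by blast
  then have "fills K G \<alpha> S''" unfolding fills_def using \<alpha>G S''G S''(3) d1 n_def by simp
  then show ?thesis using S''(2) by blast
qed

text \<open>For L of least index over K among the rich subgroups, no proper intermediate subgroup is
  rich. So any |L / K| - 1 of the relevant terms cross each of them often enough for
  \<open>sumset_full\<close>.\<close>

lemma nonsingles_fill_subgroup:
  assumes fi: "finite_index K G" and K1: "add_subgroup K1" "K \<subset> K1" "K1 \<subseteq> G"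
    and rich: "ncosets K K1 \<le> size {#t \<in># S. \<not> single A K t \<and> single A K1 t#} + 1"
  obtains L Z z where "add_subgroup L" "K \<subset> L" "L \<subseteq> G" "Z \<subseteq># S" "size Z + 1 = ncosets K L" "wsumset A Z + K = z +o L"
proof -
  note f = finite_indexD[OF fi]
  let ?F = "\<lambda>L. {#t \<in># S. \<not> single A K t \<and> single A L t#}"
  let ?P = "\<lambda>L. add_subgroup L \<and> K \<subset> L \<and> L \<subseteq> G \<and> ncosets K L \<le> size (?F L) + 1"
  have "?P K1" using K1 rich by blast
  then obtain L where P: "?P L" and mn: "\<And>M. ?P M \<Longrightarrow> ncosets K L \<le> ncosets K M"
    using ex_has_least_nat[of ?P K1 "ncosets K"] by blast
  then have L: "add_subgroup L" "K \<subset> L" "L \<subseteq> G" "K \<subseteq> L" by auto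
  have fL: "finite_index K L" by (rule finite_index_lower[OF fi L(1,4,3)])
  have "ncosets K L - 1 \<le> size (?F L)" using P by linarith
  then obtain Z where Z: "Z \<subseteq># ?F L" "size Z = ncosets K L - 1" by (rule submultiset_of_size)
  have c1: "1 \<le> ncosets K L" by (rule index_pos[OF fL])
  have ZS: "Z \<subseteq># S" using Z(1) by (meson multiset_filter_subset subset_mset.order_trans)
  have Zs: "\<not> single A K t \<and> single A L t" if "t \<in># Z" for t using mset_subset_eqD[OF Z(1) that] by simp
  have "\<exists>g. (\<Sum>s\<in>#Z. dilate A s) + K = g +o L"
  proof (rule sumset_full[OF fL])
    show "\<forall>s\<in>#Z. dilate A s \<noteq> {} \<and> \<not> crosses L (dilate A s)" using Zs dilate_nonempty by (auto simp: single_def)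
    fix M assume M: "add_subgroup M" "K \<subseteq> M" "M \<subset> L"
    have subM: "M \<subseteq> L" using M by blast
    have split: "size Z = size {#t \<in># Z. single A M t#} + size {#t \<in># Z. crosses M (dilate A t)#}"
      using arg_cong[OF multiset_partition[of Z "\<lambda>t. crosses M (dilate A t)"], of size]
      unfolding single_def size_union by linarith
    have tw: "ncosets K L = ncosets K M * ncosets M L" by (rule index_tower[OF fL M(1,2) subM])
    have b2: "2 \<le> ncosets M L" using index_ge_2[OF finite_index_upper[OF fL M(1,2) subM]] M by blast
    show "ncosets M L \<le> size {#s \<in># Z. crosses M (dilate A s)#} + 1"
    \<comment> \<open>For M = K all terms of Z cross. For larger M, failure of richness leaves at
      most |M / K| - 2 that do not.\<close>
    proof (cases "M = K")
      case True
      then have "{#t \<in># Z. single A M t#} = {#}" using Zs by (intro filter_mset_empty_if) blast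
      then have "size Z = size {#t \<in># Z. crosses M (dilate A t)#}" using split by simp
      then show ?thesis using Z(2) True by simp
    next
      case False
      have fM: "finite_index K M" by (rule finite_index_lower[OF fL M(1,2) subM])
      have a2: "2 \<le> ncosets K M" using index_ge_2[OF fM] False by blast
      have "ncosets K M < ncosets K L" using tw a2 b2 by simp
      then have "\<not> ?P M" using mn[of M] by linarith
      then have "size (?F M) + 1 < ncosets K M" using M L False by auto
      moreover have "{#t \<in># Z. single A M t#} \<subseteq># ?F M"
      proof -
        have "{#t \<in># Z. single A M t#} = {#t \<in># Z. \<not> single A K t \<and> single A M t#}" using Zs by (intro filter_mset_cong) auto
        also have "\<dots> \<subseteq># ?F M" using ZS by (rule multiset_filter_mono)
        finally show ?thesis .
      qed
      ultimately have "size {#t \<in># Z. single A M t#} + 1 < ncosets K M" using size_mset_mono by (meson add_le_mono1 le_less_trans)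
      moreover have "ncosets K M + ncosets M L \<le> ncosets K M * ncosets M L + 1" by (rule add_le_mult_plus_one) (use a2 b2 in auto)
      ultimately show ?thesis using split Z(2) tw by linarith
    qed
  qed
  then obtain z where "wsumset A Z + K = z +o L" unfolding wsumset_def by blast
  then show ?thesis using that[OF L(1-3) ZS] Z(2) c1 by simp
qed

theorem structured_exists:
  assumes "finite_index K G" "single A G \<gamma>" "\<forall>s\<in>#S. s - \<gamma> \<in> G" "ncosets K G + dav A K G \<le> size S + 1"
  shows "structured K G S"
  using assms
proof (induction "ncosets K G" arbitrary: K G S \<gamma> rule: less_induct)
  case less
  note fi = less.prems(1)
  note f = finite_indexD[OF fi]
  note sz = less.prems(4)
  let ?D = "dav A K G"
  have d1: "1 \<le> ?D" by (rule dav_pos[OF fi])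
  have n1: "1 \<le> ncosets K G" by (rule index_pos[OF fi])
  have SS: "single A G s \<and> (\<forall>t\<in>#S. t - s \<in> G)" if "s - \<gamma> \<in> G" for s
    using single_cong[OF f(2) less.prems(2) that] less.prems(3) that
      add_subgroup_diff_trans[OF f(2)] add_subgroup_diff_commute[OF f(2)] by blast
  have IHlow: "structured K L S'"
    if L: "add_subgroup L" "K \<subseteq> L" "L \<subset> G" "single A L \<alpha>" "\<forall>s\<in>#S'. s - \<alpha> \<in> L" "ncosets K L + dav A K L \<le> size S' + 1" for L \<alpha> S'
  proof -
    have LG: "L \<subseteq> G" using L by blast
    have fL: "finite_index K L" by (rule finite_index_lower[OF fi L(1,2) LG])
    have "2 \<le> ncosets L G" using index_ge_2[OF finite_index_upper[OF fi L(1,2) LG]] L by blast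
    then have "ncosets K L < ncosets K G" using index_tower[OF fi L(1,2) LG] index_pos[OF fL] by simp
    then show ?thesis using less.hyps[OF _ fL L(4-6)] by blast
  qed
  \<comment> \<open>\<open>A\<close>, \<open>R\<close> and \<open>B\<close> are the three cases of
    the overview; for K = G a single term already fills.\<close>
  consider (eq) "K = G"
    | (A) \<alpha> where "K \<noteq> G" "\<alpha> \<in># S" "single A K \<alpha>" "?D \<le> size (inside S \<alpha> K)"
    | (R) K1 where "K \<noteq> G" "add_subgroup K1" "K \<subset> K1" "K1 \<subseteq> G" "ncosets K K1 \<le> size {#t \<in># S. \<not> single A K t \<and> single A K1 t#} + 1"
    | (B) "K \<noteq> G" "\<And>\<alpha>. \<alpha> \<in># S \<Longrightarrow> single A K \<alpha> \<Longrightarrow> size (inside S \<alpha> K) < ?D"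
       "\<And>K1. add_subgroup K1 \<Longrightarrow> K \<subset> K1 \<Longrightarrow> K1 \<subseteq> G \<Longrightarrow> size {#t \<in># S. \<not> single A K t \<and> single A K1 t#} + 2 \<le> ncosets K K1"
    by (metis add_2_eq_Suc' Suc_eq_plus1 Suc_leI not_le)
  then show ?case
  proof cases
    case eq
    have "S \<noteq> {#}" using sz d1 n1 by auto
    then obtain s where s: "s \<in># S" by blast
    have s': "single A G s" "\<forall>t\<in>#S. t - s \<in> G" using SS s less.prems(3) by blast+
    have "{#s#} \<subseteq># inside S s G" using s add_subgroup_zero[OF f(2)] by (simp add: inside_def)
    moreover have "outside S s G = {#}" unfolding outside_def using s'(2) by (intro filter_mset_empty_if) blast
    ultimately show ?thesis unfolding structured_def using fills_trivial[OF f(2) s'(1)] f(2) eq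
      by (intro exI[of _ G] exI[of _ s] exI[of _ "{#s#}"]) simp
  next
    case A
    have "\<forall>s\<in>#S. s - \<alpha> \<in> G" using SS A(2) less.prems(3) by blast
    moreover have "{#\<alpha>#} \<subseteq># inside S \<alpha> K" using A(2) add_subgroup_zero[OF f(1)] by (simp add: inside_def)
    moreover have "ncosets K K + ?D \<le> size (inside S \<alpha> K) + 1" using A(4) index_self[OF f(1)] by simp
    ultimately show ?thesis unfolding structured_def
      using fills_enlarge[OF fi f(1) order_refl f(3) _ fills_trivial[OF f(1) A(3)] _ _ sz] by blast
  next
    case R
    obtain L Z z where L: "add_subgroup L" "K \<subset> L" "L \<subseteq> G" and Z: "Z \<subseteq># S" "size Z + 1 = ncosets K L" "wsumset A Z + K = z +o L"
      using nonsingles_fill_subgroup[OF fi R(2-5)] by blast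
    have KL: "K \<subseteq> L" using L by blast
    have fL: "finite_index K L" by (rule finite_index_lower[OF fi L(1) KL L(3)])
    have fLG: "finite_index L G" by (rule finite_index_upper[OF fi L(1) KL L(3)])
    define c where "c = ncosets K L"
    define e where "e = ncosets L G"
    have c2: "2 \<le> c" and e1: "1 \<le> e" unfolding c_def e_def using index_ge_2[OF fL] index_pos[OF fLG] L by auto
    have ce: "ncosets K G = c * e" unfolding c_def e_def by (rule index_tower[OF fi L(1) KL L(3)])
    have ce': "c + e \<le> c * e + 1" by (rule add_le_mult_plus_one) (use c2 e1 in auto)
    have dL: "dav A L G \<le> ?D" using dav_tower[OF fi L(1) KL L(3)] dav_pos[OF fL] by linarith
    let ?S1 = "S - Z"
    have s1: "size S = size ?S1 + size Z" using Z(1) by (metis size_union subset_mset.diff_add)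
    have "structured L G ?S1"
    proof (rule less.hyps[OF _ fLG less.prems(2)])
      show "ncosets L G < ncosets K G" using ce c2 e1 e_def by simp
      show "\<forall>s\<in>#?S1. s - \<gamma> \<in> G" using less.prems(3) in_diffD by metis
      show "ncosets L G + dav A L G \<le> size ?S1 + 1" using sz s1 Z(2) ce ce' dL unfolding c_def[symmetric] e_def[symmetric] by linarith
    qed
    then obtain H \<alpha> S1 where H: "add_subgroup H" "L \<subseteq> H" "H \<subseteq> G" and S1: "S1 \<subseteq># inside ?S1 \<alpha> H" "fills L H \<alpha> S1"
      and out: "size (outside ?S1 \<alpha> H) \<le> ncosets H G - 2" unfolding structured_def by blast
    have KH: "K \<subseteq> H" using KL H by blast
    have fLH: "finite_index L H" by (rule finite_index_lower[OF fLG H])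
    have \<alpha>H: "single A H \<alpha>" using S1 by (simp add: fills_def)
    have "S1 \<noteq> {#}" using S1(2) index_pos[OF fLH] dav_pos[OF fLH] by (auto simp: fills_def)
    then obtain s where "s \<in># S1" by blast
    then have s: "s \<in># ?S1" "s - \<alpha> \<in> H" using mset_subset_eqD[OF S1(1)] unfolding inside_def set_mset_filter by blast+
    then have "s - \<gamma> \<in> G" "\<alpha> - s \<in> G" using less.prems(3) in_diffD[OF s(1)] H add_subgroup_diff_commute[OF H(1)] by blast+
    then have \<alpha>G: "single A G \<alpha>" "\<forall>t\<in>#S. t - \<alpha> \<in> G" using SS add_subgroup_diff_trans[OF f(2)] by blast+
    show ?thesis
    proof (cases "H = G")
      \<comment> \<open>The structure of \<open>S - Z\<close> is known only modulo L, so it is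
        sought afresh modulo K inside \<alpha> + H. Restoring Z adds at most |L / K| - 1 outside
        terms, which \<open>structured_of_proper_subgroup\<close> tolerates.\<close>
      case False
      then have HG: "H \<subset> G" using H by blast
      have fHG: "finite_index H G" by (rule finite_index_upper[OF fi H(1) KH H(3)])
      have q2: "2 \<le> ncosets H G" using index_ge_2[OF fHG False] .
      show ?thesis
      proof (rule structured_of_proper_subgroup[OF fi H(1) KH HG \<alpha>H \<alpha>G(2) _ _ sz])
        fix S' assume "\<forall>s\<in>#S'. s - \<alpha> \<in> H" "ncosets K H + dav A K H \<le> size S' + 1"
        then show "structured K H S'" using IHlow[OF H(1) KH HG \<alpha>H] by blast
      next
        have fKH: "finite_index K H" by (rule finite_index_lower[OF fi H(1) KH H(3)])
        have "outside S \<alpha> H = outside ?S1 \<alpha> H + outside Z \<alpha> H" unfolding outside_def using Z(1)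
          by (metis filter_union_mset subset_mset.diff_add)
        then have "size (outside S \<alpha> H) \<le> size (outside ?S1 \<alpha> H) + size Z"
          using size_mset_mono[OF outside_subset[of Z \<alpha> H]] by simp
        moreover have "c \<le> ncosets K H" using index_tower[OF fKH L(1) KL H(2)] index_pos[OF fLH] c_def by simp
        ultimately show "size (outside S \<alpha> H) + 3 \<le> ncosets H G + ncosets K H" using out Z(2) q2 c_def by linarith
      qed
    next
      \<comment> \<open>\<open>S1\<close> reaches every coset of L within one coset of G, and Z then
        corrects inside L.\<close>
      case True
      have sS1: "size S1 + 1 = e + dav A L G" using S1(2) True e_def by (simp add: fills_def)
      have ZS1: "Z + S1 \<subseteq># S"
      proof -
        have "S1 \<subseteq># S - Z" using S1(1) inside_subset by (meson subset_mset.order_trans)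
        then show ?thesis using Z(1) by (metis subset_mset.add_diff_inverse mset_subset_eq_mono_add_left_cancel)
      qed
      have "size (Z + S1) \<le> c * e + ?D - 1" using Z(2) sS1 ce' dL c_def by simp
      moreover have "c * e + ?D - 1 \<le> size S" using sz ce by simp
      ultimately obtain S'' where S'': "Z + S1 \<subseteq># S''" "S'' \<subseteq># S" "size S'' = c * e + ?D - 1"
        using submultiset_of_size_between[OF ZS1] by blast
      have S''G: "\<forall>s\<in>#S''. s - \<alpha> \<in> G" using \<alpha>G(2) mset_subset_eqD[OF S''(2)] by blast
      have "c * e - (c - 1) - e \<le> size (S'' - (Z + S1))"
        using S''(3) Z(2) sS1 ce' dL d1 c_def by (simp add: size_Diff_submset[OF S''(1)])
      \<comment> \<open>V brings the c - 1 terms of Z and e terms of \<open>S1\<close> up to c e =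
        |G / K| terms.\<close>
      then obtain V where V: "V \<subseteq># S'' - (Z + S1)" "size V = c * e - (c - 1) - e" by (rule submultiset_of_size)
      obtain v where v: "v \<in> wsumset A V" using wsumset_nonempty[of V] by blast
      have sub: "V + (Z + U) \<subseteq># S''" if "U \<subseteq># S1" for U
      proof -
        have "V + (Z + U) \<subseteq># (S'' - (Z + S1)) + (Z + S1)" using V(1) that by (intro subset_mset.add_mono) auto
        then show ?thesis using S''(1) by simp
      qed
      let ?b = "of_int a0 * \<alpha>"
      have fS1: "wsumset_n A e S1 + L = (of_nat e * ?b) +o G" using S1(2) True e_def by (simp add: fills_def)
      have sub_coset: "wsumset_n A (c * e) S'' + K \<subseteq> (of_nat (c * e) * ?b) +o G" by (rule wsumset_n_plus_subset[OF f(2,3) \<alpha>G(1) S''G])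
      have sup: "y \<in> wsumset_n A (c * e) S'' + K" if y: "y - v - z - of_nat e * ?b \<in> G" for y
      proof -
        have "y - v - z \<in> wsumset_n A e S1 + L" using y fS1 by (simp add: mem_elt_plus)
        then obtain u where u: "u \<in> wsumset_n A e S1" "y - v - z - u \<in> L" by (auto simp: mem_plus_iff)
        then obtain U where U: "U \<subseteq># S1" "size U = e" "u \<in> wsumset A U" by (auto elim: wsumset_nE)
        have "y - v - u \<in> z +o L" using u(2) by (simp add: mem_elt_plus algebra_simps)
        then have "y - v - u \<in> wsumset A Z + K" using Z(3) by simp
        then obtain x where x: "x \<in> wsumset A Z" "y - v - u - x \<in> K" by (auto simp: mem_plus_iff)
        have "v + (x + u) \<in> wsumset A (V + (Z + U))" using v x U by (auto simp: wsumset_union)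
        moreover have "size (V + (Z + U)) = c * e" using V(2) Z(2) U(2) ce' c2 c_def by simp
        ultimately have "v + (x + u) \<in> wsumset_n A (c * e) S''" using sub[OF U(1)] by (intro wsumset_nI)
        moreover have "y - (v + (x + u)) \<in> K" using x(2) by (simp add: algebra_simps)
        ultimately show ?thesis by (auto simp: mem_plus_iff)
      qed
      \<comment> \<open>One realized element identifies the coset of G that the construction
        reaches.\<close>
      have "v + z + of_nat e * ?b \<in> wsumset_n A (c * e) S'' + K" by (rule sup) (simp add: add_subgroup_zero[OF f(2)])
      then have vz: "v + z + of_nat e * ?b - of_nat (c * e) * ?b \<in> G" using sub_coset by (auto simp: mem_elt_plus)
      have "(of_nat (c * e) * ?b) +o G \<subseteq> wsumset_n A (c * e) S'' + K"
      proof
        fix y assume "y \<in> (of_nat (c * e) * ?b) +o G"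
        then have "y - of_nat (c * e) * ?b \<in> G" by (simp add: mem_elt_plus)
        then have "(y - of_nat (c * e) * ?b) - (v + z + of_nat e * ?b - of_nat (c * e) * ?b) \<in> G" using vz add_subgroup_diff[OF f(2)] by blast
        then show "y \<in> wsumset_n A (c * e) S'' + K" by (intro sup) (simp add: algebra_simps)
      qed
      then have "fills K G \<alpha> S''" unfolding fills_def ce using sub_coset \<alpha>G(1) S''G S''(3) d1 by auto
      moreover have "inside S \<alpha> G = S" unfolding inside_def filter_mset_eq_conv using \<alpha>G(2) by simp
      moreover have "outside S \<alpha> G = {#}" unfolding outside_def using \<alpha>G(2) by (intro filter_mset_empty_if) blast
      ultimately show ?thesis unfolding structured_def using f S''(2)
        by (intro exI[of _ G] exI[of _ \<alpha>] exI[of _ S'']) simp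
    qed
  next
    case B
    have KG: "K \<subset> G" using B(1) f(3) by blast
    have sGall: "single A G t" if "t \<in># S" for t using SS that less.prems(3) by blast
    \<comment> \<open>Without singles all of S would be nonsingle modulo K, contradicting the third
      condition of \<open>B\<close> for the subgroup G.\<close>
    have ex: "\<exists>\<alpha>. \<alpha> \<in># S \<and> single A K \<alpha>"
    proof (rule ccontr)
      assume "\<not> ?thesis"
      then have "{#t \<in># S. \<not> single A K t \<and> single A G t#} = S" unfolding filter_mset_eq_conv using sGall by auto
      then have "size S + 2 \<le> ncosets K G" using B(3)[OF f(2) KG order_refl] by simp
      then show False using sz d1 by linarith
    qed
    have "\<exists>\<alpha>. (\<alpha> \<in># S \<and> single A K \<alpha>) \<and> (\<forall>s. s \<in># S \<and> single A K s \<longrightarrow> size (inside S s K) \<le> size (inside S \<alpha> K))"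
    proof -
      obtain s0 where s0: "s0 \<in># S \<and> single A K s0" using ex by blast
      show ?thesis
        using ex_has_greatest_nat[of "\<lambda>s. s \<in># S \<and> single A K s" s0 "\<lambda>s. size (inside S s K)" "Suc (size S)"]
          s0 size_mset_mono[OF inside_subset] by (metis less_Suc_eq_le)
    qed
    then obtain \<alpha> where \<alpha>: "\<alpha> \<in># S" "single A K \<alpha>"
      and mx: "\<And>s. s \<in># S \<Longrightarrow> single A K s \<Longrightarrow> size (inside S s K) \<le> size (inside S \<alpha> K)" by blast
    have SG: "\<forall>s\<in>#S. s - \<alpha> \<in> G" using SS \<alpha>(1) less.prems(3) by blast
    show ?thesis
    \<comment> \<open>A proper L with at most |G / L| - 2 terms outside \<alpha> + L permits descent
      to L; otherwise the crossing condition of \<open>fills_whole_group\<close> holds.\<close>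
    proof (cases "\<exists>L. add_subgroup L \<and> K \<subseteq> L \<and> L \<subset> G \<and> size (outside S \<alpha> L) + 1 < ncosets L G")
      case True
      then obtain L where L: "add_subgroup L" "K \<subseteq> L" "L \<subset> G" "size (outside S \<alpha> L) + 1 < ncosets L G" by blast
      have \<alpha>L: "single A L \<alpha>" by (rule single_mono[OF f(1) L(1,2) \<alpha>(2)])
      show ?thesis
      proof (rule structured_of_proper_subgroup[OF fi L(1-3) \<alpha>L SG _ _ sz])
        fix S' assume "\<forall>s\<in>#S'. s - \<alpha> \<in> L" "ncosets K L + dav A K L \<le> size S' + 1"
        then show "structured K L S'" using IHlow[OF L(1-3) \<alpha>L] by blast
      next
        have "1 \<le> ncosets K L" using index_pos[OF finite_index_lower[OF fi L(1,2)]] L(3) by blast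
        then show "size (outside S \<alpha> L) + 3 \<le> ncosets L G + ncosets K L" using L(4) by linarith
      qed
    next
      case False
      then have "ncosets L G \<le> size (outside S \<alpha> L) + 1" if "add_subgroup L" "K \<subseteq> L" "L \<subset> G" for L
        using that by (meson not_le)
      then obtain S'' where S'': "S'' \<subseteq># S" "fills K G \<alpha> S''"
        using fills_whole_group[OF fi \<alpha>(2) SG _ mx B(2)[OF \<alpha>] B(3) sz] by blast
      moreover have "inside S \<alpha> G = S" unfolding inside_def filter_mset_eq_conv using SG by simp
      moreover have "outside S \<alpha> G = {#}" unfolding outside_def using SG by (intro filter_mset_empty_if) blast
      ultimately show ?thesis unfolding structured_def using f
        by (intro exI[of _ G] exI[of _ \<alpha>] exI[of _ S'']) simp
    qed
  qed
qed

end

section \<open>The weighted sumset of full length\<close>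

context weights
begin

text \<open>\<open>wsumset_n_periodic\<close> describes the n-term sums of S and the shorter sums of
  \<open>S\<^sub>0\<close> by the same subsequences of the exceptional terms R. The two descriptions
  differ by a translation, and both are visibly H-periodic.\<close>

theorem structure_of_weighted_sums:
  assumes fi: "finite_index K G" and \<gamma>: "single A G \<gamma>" "\<forall>s\<in>#S. s - \<gamma> \<in> G"
    and n: "ncosets K G \<le> n" and sz: "n + dav A K G \<le> size S + 1"
  shows "\<exists>H \<alpha> S' S'' S\<^sub>0. add_subgroup H \<and> K \<subseteq> H \<and> H \<subseteq> G \<and> \<alpha> - \<gamma> \<in> G \<and>
    S' \<subseteq># S \<and> S'' \<subseteq># S' \<and> S\<^sub>0 \<subseteq># S \<and> single A H \<alpha> \<and> (\<forall>s\<in>#S'. s - \<alpha> \<in> H) \<and>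
    size (S - S') \<le> ncosets H G - 2 \<and>
    size S'' + 1 = ncosets K H + dav A K H \<and>
    wsumset_n A (ncosets K H) S'' + K = (of_nat (ncosets K H) * (of_int a0 * \<alpha>)) +o H \<and>
    wsumset_n A n S + K = (of_int (int n - int (ncosets K H) - int (size (S - S'))) * (of_int a0 * \<alpha>)) +o
      (wsumset_n A (ncosets K H + size (S - S')) S\<^sub>0 + K) \<and>
    (wsumset_n A n S + K) + H = wsumset_n A n S + K \<and>
    of_nat n * (of_int a0 * \<alpha>) \<in> wsumset_n A n S + K \<and>
    (S - S') + S'' \<subseteq># S\<^sub>0 \<and>
    size S\<^sub>0 + 2 = ncosets K H + size (S - S') + dav A K H + dav A H G \<and>
    dav A K H + dav A H G \<le> dav A K G + 1"
proof -
  note f = finite_indexD[OF fi]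
  have "structured K G S" using structured_exists[OF fi \<gamma>] n sz by simp
  then obtain H \<alpha> S'' where H: "add_subgroup H" "K \<subseteq> H" "H \<subseteq> G" and S'': "S'' \<subseteq># inside S \<alpha> H" and fl: "fills K H \<alpha> S''"
    and out: "size (outside S \<alpha> H) \<le> ncosets H G - 2" unfolding structured_def by blast
  let ?b = "of_int a0 * \<alpha>"
  define h where "h = ncosets K H"
  define q where "q = ncosets H G"
  define R where "R = outside S \<alpha> H"
  define I where "I = inside S \<alpha> H"
  define r where "r = size R"
  have fH: "finite_index K H" by (rule finite_index_lower[OF fi H])
  have fHG: "finite_index H G" by (rule finite_index_upper[OF fi H])
  have S: "S = R + I" unfolding R_def I_def by (rule outside_plus_inside)
  have SI: "S - I = R" using S by simp
  have \<alpha>: "single A H \<alpha>" and flH: "wsumset_n A h S'' + K = (of_nat h * ?b) +o H" and sS'': "size S'' + 1 = h + dav A K H"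
    using fl by (auto simp: fills_def h_def)
  have d: "1 \<le> dav A K H" "1 \<le> dav A H G" using dav_pos[OF fH] dav_pos[OF fHG] by auto
  have tow: "dav A K H + dav A H G \<le> dav A K G + 1" by (rule dav_tower[OF fi H])
  have h1: "1 \<le> h" and q1: "1 \<le> q" using index_pos[OF fH] index_pos[OF fHG] by (auto simp: h_def q_def)
  have hq: "ncosets K G = h * q" unfolding h_def q_def by (rule index_tower[OF fi H])
  \<comment> \<open>With r <= q - 2 this gives h + r < h q <= n; for q = 1 the truncated bound gives
    r = 0.\<close>
  have "h + q \<le> h * q + 1" by (rule add_le_mult_plus_one[OF h1 q1])
  then have hr: "h + r \<le> n" using out n hq q1 unfolding r_def R_def q_def[symmetric] by (cases "q = 1") auto
  have "S'' \<noteq> {#}" using sS'' h1 d by auto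
  then obtain s where "s \<in># S''" by blast
  then have "s \<in># inside S \<alpha> H" using mset_subset_eqD[OF S''] by blast
  then have s: "s \<in># S" "s - \<alpha> \<in> H" by (auto simp: inside_def)
  then have \<alpha>\<gamma>: "\<alpha> - \<gamma> \<in> G"
    using \<gamma>(2) H(3) add_subgroup_diff_trans[OF f(2), of \<alpha> s \<gamma>] add_subgroup_diff_commute[OF f(2), of \<alpha> s] by blast
  have RG: "\<forall>s\<in>#R. s - \<alpha> \<in> G"
  proof
    fix t assume "t \<in># R"
    then have "t - \<gamma> \<in> G" using \<gamma>(2) by (auto simp: R_def outside_def)
    then show "t - \<alpha> \<in> G" using \<alpha>\<gamma> add_subgroup_diff_trans[OF f(2)] add_subgroup_diff_commute[OF f(2)] by blast
  qed
  have IH: "\<forall>s\<in>#I. s - \<alpha> \<in> H" by (simp add: I_def inside_def)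
  have S''I: "S'' \<subseteq># I" using S'' by (simp add: I_def)
  have szS: "size S = r + size I" unfolding r_def using S by (metis size_union)
  have "dav A H G - 1 \<le> size (I - S'')"
    using sz szS sS'' hr tow d by (simp add: size_Diff_submset[OF S''I])
  \<comment> \<open>\<open>D\<^sub>A(G/H)\<close> - 1 further terms are exactly the filler that
    \<open>wsumset_n_periodic\<close> requires for length h + r.\<close>
  then obtain J where J: "J \<subseteq># I - S''" "size J = dav A H G - 1" by (rule submultiset_of_size)
  define I0 where "I0 = S'' + J"
  have I0I: "I0 \<subseteq># I" unfolding I0_def using J(1) S''I by (metis subset_mset.add_diff_inverse mset_subset_eq_mono_add_left_cancel)
  have I0H: "\<forall>s\<in>#I0. s - \<alpha> \<in> H" using IH mset_subset_eqD[OF I0I] by blast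
  have szI0: "size I0 + 2 = h + dav A K H + dav A H G" unfolding I0_def using J(2) sS'' d by simp
  have memS: "x \<in> wsumset_n A n S + K \<longleftrightarrow> (\<exists>T w. T \<subseteq># R \<and> w \<in> wsumset A T \<and> x - (w + of_nat (n - size T) * ?b) \<in> H)" for x
    unfolding S by (rule wsumset_n_periodic[OF fi H \<alpha> RG IH S''I flH]) (use hr r_def szS sz sS'' tow in auto)
  have mem0: "x \<in> wsumset_n A (h + r) (R + I0) + K \<longleftrightarrow> (\<exists>T w. T \<subseteq># R \<and> w \<in> wsumset A T \<and> x - (w + of_nat (h + r - size T) * ?b) \<in> H)" for x
    by (rule wsumset_n_periodic[OF fi H \<alpha> RG I0H _ flH]) (use r_def szI0 sS'' I0_def in auto)
  have eq: "wsumset_n A n S + K = (of_int (int n - int h - int r) * ?b) +o (wsumset_n A (h + r) (R + I0) + K)"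
  proof (rule Set.set_eqI)
    fix x
    have "x - (w + of_nat (n - size T) * ?b) = (x - of_int (int n - int h - int r) * ?b) - (w + of_nat (h + r - size T) * ?b)"
      if "T \<subseteq># R" for T w
    proof -
      have "size T \<le> r" using size_mset_mono[OF that] r_def by simp
      then have e: "(of_nat (n - size T) :: 'a) = of_int (int n - int h - int r) + of_nat (h + r - size T)"
        using hr by (simp add: of_nat_diff)
      show ?thesis unfolding e by (simp add: algebra_simps)
    qed
    then show "x \<in> wsumset_n A n S + K \<longleftrightarrow> x \<in> (of_int (int n - int h - int r) * ?b) +o (wsumset_n A (h + r) (R + I0) + K)"
      unfolding mem_elt_plus memS mem0 by (metis (no_types, lifting))
  qed
  have per: "(wsumset_n A n S + K) + H = wsumset_n A n S + K"
  proof (intro equalityI subset_plus_subgroup[OF H(1)] subsetI)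
    fix x assume "x \<in> (wsumset_n A n S + K) + H"
    then obtain y where y: "y \<in> wsumset_n A n S + K" "x - y \<in> H" unfolding mem_plus_iff[of x "wsumset_n A n S + K"] by blast
    then obtain T w where T: "T \<subseteq># R" "w \<in> wsumset A T" "y - (w + of_nat (n - size T) * ?b) \<in> H" unfolding memS by blast
    have "x - (w + of_nat (n - size T) * ?b) \<in> H" using add_subgroup_diff_trans[OF H(1) y(2) T(3)] .
    then show "x \<in> wsumset_n A n S + K" unfolding memS using T by blast
  qed
  have nb: "of_nat n * ?b \<in> wsumset_n A n S + K"
    unfolding memS by (rule exI[of _ "{#}"], rule exI[of _ 0]) (simp add: add_subgroup_zero[OF H(1)])
  have "R + I0 \<subseteq># S" unfolding S using I0I by simp
  moreover have "R + S'' \<subseteq># R + I0" by (simp add: I0_def)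
  moreover have "size (R + I0) + 2 = h + r + dav A K H + dav A H G" using szI0 r_def by simp
  moreover have "I \<subseteq># S" using S by simp
  ultimately show ?thesis
    using H \<alpha>\<gamma> S''I \<alpha> IH out sS'' flH eq per nb tow unfolding h_def r_def R_def[symmetric] SI[symmetric]
    by (intro exI[of _ H] exI[of _ \<alpha>] exI[of _ I] exI[of _ S''] exI[of _ "(S - I) + I0"]) simp
qed

end

subsection \<open>Presentations of finite abelian groups\<close>

text \<open>M is X modulo the kernel of \<phi>. Subgroups of M restrict X, quotients of M enlarge
  the kernel, and in both cases the additive results apply.\<close>

locale presentation = comm_group M for M (structure) +
  fixes X :: "'v::comm_ring_1 set" and \<phi>
  assumes X: "add_subgroup X" and surj: "\<phi> ` X = carrier M"
    and hom: "\<And>x y. x \<in> X \<Longrightarrow> y \<in> X \<Longrightarrow> \<phi> (x + y) = \<phi> x \<otimes> \<phi> y"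
begin

definition ker :: "'v set" where "ker = {x \<in> X. \<phi> x = \<one>}"

lemma closed: "x \<in> X \<Longrightarrow> \<phi> x \<in> carrier M"
  using surj by blast

lemma hom_zero: "\<phi> 0 = \<one>"
proof -
  have "\<phi> 0 \<otimes> \<phi> 0 = \<phi> 0" using hom[of 0 0] add_subgroup_zero[OF X] by simp
  then show ?thesis using closed[OF add_subgroup_zero[OF X]] by (metis l_cancel_one)
qed

lemma hom_minus: "x \<in> X \<Longrightarrow> \<phi> (- x) = inv (\<phi> x)"
  using hom[of "- x" x] add_subgroup_minus[OF X] closed hom_zero by (metis inv_equality add.left_inverse)

lemma hom_diff: "x \<in> X \<Longrightarrow> y \<in> X \<Longrightarrow> \<phi> (x - y) = \<phi> x \<otimes> inv (\<phi> y)"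
  using hom[of x "- y"] add_subgroup_minus[OF X] hom_minus by simp

lemma hom_of_nat: "x \<in> X \<Longrightarrow> \<phi> (of_nat n * x) = \<phi> x [^] n"
proof (induction n)
  case 0
  then show ?case by (simp add: hom_zero)
next
  case (Suc n)
  have "of_nat n * x \<in> X" using add_subgroup_of_int[OF X Suc.prems, of "int n"] by simp
  then have "\<phi> (of_nat n * x + x) = \<phi> x [^] n \<otimes> \<phi> x" using hom Suc by simp
  then show ?case by (simp add: algebra_simps)
qed

lemma hom_of_int: "x \<in> X \<Longrightarrow> \<phi> (of_int m * x) = \<phi> x [^] m"
proof (cases m)
  case (nonneg k)
  then show "x \<in> X \<Longrightarrow> ?thesis" using hom_of_nat[of x k] by (simp add: int_pow_int)
next
  case (neg k)
  assume x: "x \<in> X"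
  have kx: "of_nat (Suc k) * x \<in> X" using add_subgroup_of_int[OF X x, of "int (Suc k)"] by simp
  have "of_int m * x = - (of_nat (Suc k) * x)" using neg by (metis mult_minus_left of_int_minus of_int_of_nat_eq)
  then have "\<phi> (of_int m * x) = inv (\<phi> x [^] Suc k)" using hom_minus[OF kx] hom_of_nat[OF x] by metis
  then show ?thesis using neg int_pow_neg_int[OF closed[OF x], of "Suc k"] by metis
qed

lemma add_subgroup_ker: "add_subgroup ker"
  unfolding add_subgroup_def ker_def
  using add_subgroup_zero[OF X] hom_zero add_subgroup_diff[OF X] hom_diff by auto

lemma diff_in_ker_iff: "x \<in> X \<Longrightarrow> y \<in> X \<Longrightarrow> x - y \<in> ker \<longleftrightarrow> \<phi> x = \<phi> y"
proof -
  assume xy: "x \<in> X" "y \<in> X"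
  then have c: "\<phi> x \<in> carrier M" "\<phi> y \<in> carrier M" using closed by blast+
  then have "\<phi> x \<otimes> inv (\<phi> y) = \<one> \<longleftrightarrow> \<phi> x = \<phi> y"
    using inv_equality[of "\<phi> x" "inv (\<phi> y)"] by auto
  then show ?thesis using xy hom_diff[of x y] add_subgroup_diff[OF X] by (simp add: ker_def)
qed

lemma image_plus_ker: "Y \<subseteq> X \<Longrightarrow> \<phi> ` (Y + ker) = \<phi> ` Y"
proof (intro equalityI subsetI)
  fix z assume Y: "Y \<subseteq> X" and "z \<in> \<phi> ` (Y + ker)"
  then obtain y k where "y \<in> Y" "k \<in> ker" "z = \<phi> (y + k)" by (auto elim!: set_plus_elim)
  then show "z \<in> \<phi> ` Y" using Y hom[of y k] closed by (auto simp: ker_def)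
qed (use subset_plus_subgroup[OF add_subgroup_ker] in blast)

lemma card_image_eq_ncosets: "Y \<subseteq> X \<Longrightarrow> card (\<phi> ` Y) = ncosets ker Y"
proof -
  assume Y: "Y \<subseteq> X"
  obtain U where U: "U \<subseteq> Y" "inj_on (\<lambda>x. x +o ker) U" "(\<lambda>x. x +o ker) ` U = (\<lambda>x. x +o ker) ` Y" "card U = ncosets ker Y"
    by (rule ncosets_reps)
  have iff: "x +o ker = y +o ker \<longleftrightarrow> \<phi> x = \<phi> y" if "x \<in> Y" "y \<in> Y" for x y
    using that Y diff_in_ker_iff coset_eq_iff[OF add_subgroup_ker] by blast
  have "inj_on \<phi> U" using U(1,2) iff unfolding inj_on_def by (meson subsetD)
  moreover have "\<phi> ` U = \<phi> ` Y"
  proof (intro equalityI subsetI)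
    fix z assume "z \<in> \<phi> ` Y"
    then obtain y where y: "y \<in> Y" "z = \<phi> y" by blast
    then obtain u where "u \<in> U" "y +o ker = u +o ker" using U(3) by (metis (no_types, lifting) imageE imageI)
    then show "z \<in> \<phi> ` U" using iff y U(1) by blast
  qed (use U(1) in blast)
  ultimately show ?thesis using U(4) by (metis card_image)
qed

lemma order_eq_index: "order M = ncosets ker X"
  using card_image_eq_ncosets[OF order_refl] surj by (simp add: order_def)

lemma finite_index_ker: "finite (carrier M) \<Longrightarrow> finite_index ker X"
proof -
  assume fin: "finite (carrier M)"
  have "ncosets ker X \<noteq> 0" using fin order_eq_index one_closed by (metis card_eq_0_iff empty_iff order_def)
  then show ?thesis using X add_subgroup_ker by (auto simp: finite_index_def ncosets_def ker_def intro: card_ge_0_finite)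
qed

lemma wsumset_subset: "set_mset T \<subseteq> X \<Longrightarrow> wsumset A T \<subseteq> X"
proof (induction T)
  case (add s T)
  then have "dilate A s + wsumset A T \<subseteq> X + X" by (intro set_plus_mono2) (auto simp: dilate_def add_subgroup_of_int[OF X])
  then show ?case by (simp add: wsumset_add_mset add_subgroup_absorb[OF X] add_subgroup_zero[OF X])
qed (simp add: add_subgroup_zero[OF X])

text \<open>Products indexed by {1..k} carry an order that multisets lack. The induction peels off
  the last index on one side and, on the other, any term whose image is the last factor.\<close>

lemma indexed_products_eq:
  assumes "set_mset N \<subseteq> X" "size N = k"
  shows "{finprod M (\<lambda>i. s i [^] a i) {1..k} | s (a :: nat \<Rightarrow> int).
      image_mset s (mset_set {1..k}) = image_mset \<phi> N \<and> (\<forall>i\<in>{1..k}. a i \<in> A)} = \<phi> ` wsumset A N"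
    (is "?E k N = _")
  using assms
proof (induction k arbitrary: N)
  case 0
  then show ?case by (auto simp: hom_zero)
next
  case (Suc k)
  have ins: "{1..Suc k} = insert (Suc k) {1..k}" by auto
  have ms: "image_mset s (mset_set {1..Suc k}) = add_mset (s (Suc k)) (image_mset s (mset_set {1..k}))" for s :: "nat \<Rightarrow> 'a"
    unfolding ins by simp
  have fp: "finprod M (\<lambda>i. s i [^] a i) {1..Suc k} = s (Suc k) [^] a (Suc k) \<otimes> finprod M (\<lambda>i. s i [^] a i) {1..k}"
    if "\<And>i. i \<in> {1..Suc k} \<Longrightarrow> s i \<in> carrier M" for s and a :: "nat \<Rightarrow> int"
    unfolding ins using that by (intro finprod_insert) auto
  show ?case
  proof (intro equalityI subsetI)
    fix z assume "z \<in> ?E (Suc k) N"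
    then obtain s a where z: "z = finprod M (\<lambda>i. s i [^] a i) {1..Suc k}"
      and s: "image_mset s (mset_set {1..Suc k}) = image_mset \<phi> N" and a: "\<forall>i\<in>{1..Suc k}. a i \<in> A" by blast
    have sc: "s i \<in> carrier M" if "i \<in> {1..Suc k}" for i
    proof -
      have "s i \<in># image_mset s (mset_set {1..Suc k})" using that by simp
      then show ?thesis unfolding s using Suc.prems(1) closed by auto
    qed
    have "s (Suc k) \<in># image_mset \<phi> N" using s ms by (metis union_single_eq_member)
    then obtain x where x: "x \<in># N" "s (Suc k) = \<phi> x" by auto
    define N' where "N' = N - {#x#}"
    have N: "N = add_mset x N'" using x by (simp add: N'_def)
    have N': "set_mset N' \<subseteq> X" "size N' = k" "x \<in> X" using Suc.prems N by auto
    have "image_mset s (mset_set {1..k}) = image_mset \<phi> N'" using s ms x N by simp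
    then have "finprod M (\<lambda>i. s i [^] a i) {1..k} \<in> ?E k N'" using a by force
    then obtain w where w: "w \<in> wsumset A N'" "finprod M (\<lambda>i. s i [^] a i) {1..k} = \<phi> w" unfolding Suc.IH[OF N'(1,2)] by blast
    have wX: "w \<in> X" using wsumset_subset[OF N'(1)] w by blast
    have axX: "of_int (a (Suc k)) * x \<in> X" using N' add_subgroup_of_int[OF X] by blast
    have "z = \<phi> (of_int (a (Suc k)) * x + w)"
      using fp[of s a, OF sc] z x(2) w(2) hom[OF axX wX] hom_of_int[OF N'(3)] by simp
    moreover have "of_int (a (Suc k)) * x + w \<in> wsumset A N" unfolding N wsumset_add_mset using a w by (intro set_plus_intro) (auto simp: dilate_def)
    ultimately show "z \<in> \<phi> ` wsumset A N" by blast
  next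
    fix z assume "z \<in> \<phi> ` wsumset A N"
    then obtain v where v: "v \<in> wsumset A N" "z = \<phi> v" by blast
    obtain x N' where N: "N = add_mset x N'" using Suc.prems(2) by (metis size_eq_Suc_imp_eq_union)
    have N': "set_mset N' \<subseteq> X" "size N' = k" "x \<in> X" using Suc.prems N by auto
    obtain b w where bw: "v = of_int b * x + w" "b \<in> A" "w \<in> wsumset A N'" using v(1) unfolding N wsumset_add_mset by (auto simp: dilate_def elim!: set_plus_elim)
    have "\<phi> w \<in> ?E k N'" using Suc.IH[OF N'(1,2)] bw(3) by blast
    then obtain s a where sa: "\<phi> w = finprod M (\<lambda>i. s i [^] a i) {1..k}"
      "image_mset s (mset_set {1..k}) = image_mset \<phi> N'" "\<forall>i\<in>{1..k}. a i \<in> A" by blast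
    define s' where "s' = s(Suc k := \<phi> x)"
    define a' where "a' = a(Suc k := b)"
    have im: "image_mset s' (mset_set {1..k}) = image_mset s (mset_set {1..k})" by (intro image_mset_cong) (auto simp: s'_def)
    have im': "image_mset s' (mset_set {1..Suc k}) = image_mset \<phi> N" unfolding ms im sa(2) N by (simp add: s'_def)
    have sc: "s' i \<in> carrier M" if "i \<in> {1..Suc k}" for i
    proof -
      have "s' i \<in># image_mset s' (mset_set {1..Suc k})" using that by simp
      then show ?thesis unfolding im' using Suc.prems(1) closed by auto
    qed
    have wX: "w \<in> X" using wsumset_subset[OF N'(1)] bw by blast
    have axX: "of_int b * x \<in> X" using N' add_subgroup_of_int[OF X] by blast
    have "finprod M (\<lambda>i. s' i [^] a' i) {1..k} = finprod M (\<lambda>i. s i [^] a i) {1..k}"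
    proof (rule finprod_cong')
      show "(\<lambda>i. s i [^] a i) \<in> {1..k} \<rightarrow> carrier M"
      proof
        fix i assume i: "i \<in> {1..k}"
        then have "s i \<in> carrier M" using sc[of i] by (auto simp: s'_def split: if_splits)
        then show "s i [^] a i \<in> carrier M" by simp
      qed
    qed (auto simp: s'_def a'_def)
    then have "finprod M (\<lambda>i. s' i [^] a' i) {1..Suc k} = \<phi> x [^] b \<otimes> \<phi> w" 
      using fp[of s' a', OF sc] sa(1) by (simp add: s'_def a'_def)
    also have "\<dots> = z" using v(2) bw(1) hom[OF axX wX] hom_of_int[OF N'(3)] by simp
    finally have "z = finprod M (\<lambda>i. s' i [^] a' i) {1..Suc k}" by simp
    moreover have "\<forall>i\<in>{1..Suc k}. a' i \<in> A" using sa(3) bw(2) by (auto simp: a'_def)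
    ultimately show "z \<in> ?E (Suc k) N" using im' by blast
  qed
qed

theorem wsums_of_length_eq:
  assumes S: "set_mset S \<subseteq> X"
  shows "wsums_of_length M A k (image_mset \<phi> S) = \<phi> ` wsumset_n A k S"
proof (intro equalityI subsetI)
  fix z assume "z \<in> wsums_of_length M A k (image_mset \<phi> S)"
  then obtain s a where z: "z = finprod M (\<lambda>i. s i [^] a i) {1..k}"
    and s: "image_mset s (mset_set {1..k}) \<subseteq># image_mset \<phi> S" and a: "\<forall>i\<in>{1..k}. a i \<in> A"
    unfolding wsums_of_length_def by blast
  obtain N where N: "N \<subseteq># S" "image_mset s (mset_set {1..k}) = image_mset \<phi> N" using s by (rule submultiset_image_msetE)
  have "size N = k" using arg_cong[OF N(2), of size] by simp
  moreover have "set_mset N \<subseteq> X" using S set_mset_mono[OF N(1)] by blast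
  ultimately have "z \<in> \<phi> ` wsumset A N" using indexed_products_eq[of N k A] z N(2) a by blast
  then show "z \<in> \<phi> ` wsumset_n A k S" using wsumset_nI[OF N(1) \<open>size N = k\<close>] by blast
next
  fix z assume "z \<in> \<phi> ` wsumset_n A k S"
  then obtain N where N: "N \<subseteq># S" "size N = k" "z \<in> \<phi> ` wsumset A N" by (auto elim!: wsumset_nE)
  moreover have "set_mset N \<subseteq> X" using S set_mset_mono[OF N(1)] by blast
  ultimately obtain s a where "z = finprod M (\<lambda>i. s i [^] a i) {1..k}"
    "image_mset s (mset_set {1..k}) = image_mset \<phi> N" "\<forall>i\<in>{1..k}. a i \<in> A" using indexed_products_eq[of N k A] by blast
  then show "z \<in> wsums_of_length M A k (image_mset \<phi> S)"
    unfolding wsums_of_length_def using image_mset_subseteq_mono[OF N(1)] by force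
qed

lemma one_in_wsums_iff:
  assumes S: "set_mset S \<subseteq> X"
  shows "\<one> \<in> wsums M A (image_mset \<phi> S) \<longleftrightarrow> (\<exists>T. T \<subseteq># S \<and> T \<noteq> {#} \<and> wsumset A T \<inter> ker \<noteq> {})"
proof
  assume "\<one> \<in> wsums M A (image_mset \<phi> S)"
  then obtain r where r: "1 \<le> r" "\<one> \<in> \<phi> ` wsumset_n A r S" unfolding wsums_def wsums_of_length_eq[OF S] by auto
  then obtain T w where T: "T \<subseteq># S" "size T = r" "w \<in> wsumset A T" "\<phi> w = \<one>" by (auto elim!: wsumset_nE)
  moreover have "w \<in> X" using wsumset_subset[of T A] T S set_mset_mono[OF T(1)] by blast
  ultimately show "\<exists>T. T \<subseteq># S \<and> T \<noteq> {#} \<and> wsumset A T \<inter> ker \<noteq> {}" using r(1) by (intro exI[of _ T]) (auto simp: ker_def)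
next
  assume "\<exists>T. T \<subseteq># S \<and> T \<noteq> {#} \<and> wsumset A T \<inter> ker \<noteq> {}"
  then obtain T w where T: "T \<subseteq># S" "T \<noteq> {#}" "w \<in> wsumset A T" "\<phi> w = \<one>" by (auto simp: ker_def)
  then have "\<one> \<in> \<phi> ` wsumset_n A (size T) S" using wsumset_nI[OF T(1) refl T(3)] by force
  moreover have "size T \<in> {1..size (image_mset \<phi> S)}" using T size_mset_mono[OF T(1)] by (auto simp: Suc_le_eq nonempty_has_size)
  ultimately show "\<one> \<in> wsums M A (image_mset \<phi> S)" unfolding wsums_def wsums_of_length_eq[OF S] by blast
qed

text \<open>For each length the two defining predicates agree, since sequences over M lift to X term
  by term.\<close>

theorem davenport_eq_dav: "davenport M A = dav A ker X"
proof -
  have "(\<forall>S. set_mset S \<subseteq> carrier M \<and> size S = l \<longrightarrow> \<one> \<in> wsums M A S) \<longleftrightarrow>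
    (\<forall>S. set_mset S \<subseteq> X \<and> size S = l \<longrightarrow> (\<exists>T. T \<subseteq># S \<and> T \<noteq> {#} \<and> wsumset A T \<inter> ker \<noteq> {}))" (is "?a \<longleftrightarrow> ?b") for l
  proof
    assume ?a
    then show ?b using one_in_wsums_iff[of _ A] closed by (metis (no_types, lifting) image_subset_iff set_image_mset size_image_mset subsetD)
  next
    assume b: ?b
    show ?a
    proof (intro allI impI)
      fix S assume S: "set_mset S \<subseteq> carrier M \<and> size S = l"
      let ?g = "inv_into X \<phi>"
      have g: "?g s \<in> X" "\<phi> (?g s) = s" if "s \<in># S" for s
      proof -
        have "s \<in> \<phi> ` X" using that S surj by blast
        then show "?g s \<in> X" "\<phi> (?g s) = s" by (rule inv_into_into, rule f_inv_into_f)
      qed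
      have sub: "set_mset (image_mset ?g S) \<subseteq> X" using g by auto
      have "image_mset \<phi> (image_mset ?g S) = S" using g by (simp add: multiset.map_comp) (metis (mono_tags, lifting) comp_apply image_mset_cong multiset.map_ident)
      moreover have "\<one> \<in> wsums M A (image_mset \<phi> (image_mset ?g S))" unfolding one_in_wsums_iff[OF sub] using b sub S by simp
      ultimately show "\<one> \<in> wsums M A S" by simp
    qed
  qed
  then show ?thesis unfolding davenport_def dav_def by simp
qed

end

section \<open>Subgroups, quotients and cosets under a presentation\<close>

context presentation
begin

definition preimage :: "'a set \<Rightarrow> 'v set" where
  "preimage H = {x \<in> X. \<phi> x \<in> H}"

lemma image_preimage: "H \<subseteq> carrier M \<Longrightarrow> \<phi> ` preimage H = H"
  using surj by (auto simp: preimage_def)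

lemma add_subgroup_preimage:
  assumes "subgroup H M"
  shows "add_subgroup (preimage H)"
  unfolding add_subgroup_def preimage_def
  using add_subgroup_zero[OF X] hom_zero add_subgroup_diff[OF X] hom_diff
    subgroup.one_closed[OF assms] subgroup.m_closed[OF assms] subgroup.m_inv_closed[OF assms] by auto

lemma subgroup_image:
  assumes "add_subgroup Y" "Y \<subseteq> X"
  shows "subgroup (\<phi> ` Y) M"
proof (rule subgroupI)
  show "\<phi> ` Y \<subseteq> carrier M" using assms(2) closed by blast
  show "\<phi> ` Y \<noteq> {}" using add_subgroup_zero[OF assms(1)] by blast
  show "inv a \<in> \<phi> ` Y" if a: "a \<in> \<phi> ` Y" for a
  proof -
    obtain x where "x \<in> Y" "a = \<phi> x" using a by blast
    then show ?thesis using hom_minus[of x] add_subgroup_minus[OF assms(1)] assms(2) by (metis imageI subsetD)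
  qed
  show "a \<otimes> b \<in> \<phi> ` Y" if ab: "a \<in> \<phi> ` Y" "b \<in> \<phi> ` Y" for a b
  proof -
    obtain x y where "x \<in> Y" "a = \<phi> x" "y \<in> Y" "b = \<phi> y" using ab by blast
    then show ?thesis using hom[of x y] add_subgroup_add[OF assms(1)] assms(2) by (metis imageI subsetD)
  qed
qed

lemma preimage_image:
  assumes "add_subgroup Y" "Y \<subseteq> X" "ker \<subseteq> Y"
  shows "preimage (\<phi> ` Y) = Y"
proof (intro equalityI subsetI)
  fix x assume "x \<in> preimage (\<phi> ` Y)"
  then obtain y where y: "x \<in> X" "y \<in> Y" "\<phi> x = \<phi> y" by (auto simp: preimage_def)
  then have "x - y \<in> Y" using diff_in_ker_iff assms by blast
  then show "x \<in> Y" using add_subgroup_add[OF assms(1) _ y(2)] by force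
qed (use assms in \<open>auto simp: preimage_def\<close>)

lemma presentation_subgroup:
  assumes H: "subgroup H M"
  shows "presentation (M\<lparr>carrier := H\<rparr>) (preimage H) \<phi>"
proof -
  have "comm_group (M\<lparr>carrier := H\<rparr>)"
    using group.group_comm_groupI[OF subgroup.subgroup_is_group[OF H group_axioms]] m_comm subgroup.mem_carrier[OF H] by auto
  then show ?thesis
    unfolding presentation_def presentation_axioms_def
    using add_subgroup_preimage[OF H] image_preimage[OF subgroup.subset[OF H]] hom by (auto simp: preimage_def)
qed

lemma ker_subgroup:
  assumes H: "subgroup H M"
  shows "presentation.ker (M\<lparr>carrier := H\<rparr>) (preimage H) \<phi> = ker"
  unfolding presentation.ker_def[OF presentation_subgroup[OF H]]
  using subgroup.one_closed[OF H] by (auto simp: ker_def preimage_def)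

text \<open>X stays and only the kernel grows, to the preimage of H; the Davenport constant of the
  quotient is again a \<open>dav\<close>, with a larger K.\<close>

lemma presentation_quotient:
  assumes H: "subgroup H M"
  shows "presentation (M Mod H) X (\<lambda>x. H #> \<phi> x)"
proof -
  interpret N: normal H M using H by (rule subgroup_imp_normal)
  have "(\<lambda>x. H #> \<phi> x) ` X = carrier (M Mod H)" unfolding carrier_FactGroup surj[symmetric] by (simp add: image_image)
  moreover have "H #> \<phi> (x + y) = (H #> \<phi> x) \<otimes>\<^bsub>M Mod H\<^esub> (H #> \<phi> y)" if "x \<in> X" "y \<in> X" for x y
    using N.rcos_sum[OF closed closed] hom that by simp
  ultimately show ?thesis
    unfolding presentation_def presentation_axioms_def using abelian_FactGroup[OF H] X by blast
qed

lemma ker_quotient: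
  assumes H: "subgroup H M"
  shows "presentation.ker (M Mod H) X (\<lambda>x. H #> \<phi> x) = preimage H"
  unfolding presentation.ker_def[OF presentation_quotient[OF H]]
  using coset_join1[OF _ closed H] coset_join2[OF closed H] by (auto simp: preimage_def)

lemma mem_coset_iff:
  assumes H: "subgroup H M" and u: "u \<in> X" "v \<in> X"
  shows "\<phi> u \<in> \<phi> v <# H \<longleftrightarrow> u - v \<in> preimage H"
proof -
  have uv: "u - v \<in> X" "\<phi> u \<in> carrier M" "\<phi> v \<in> carrier M" using u add_subgroup_diff[OF X] closed by auto
  have e: "\<phi> (u - v) = inv (\<phi> v) \<otimes> \<phi> u" using hom_diff[OF u] uv m_comm by simp
  show ?thesis
  proof
    assume "\<phi> u \<in> \<phi> v <# H"
    then obtain h where h: "h \<in> H" "\<phi> u = \<phi> v \<otimes> h" by (auto simp: l_coset_def)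
    then have "\<phi> (u - v) = h" unfolding e using uv subgroup.mem_carrier[OF H h(1)] by (simp add: m_assoc[symmetric])
    then show "u - v \<in> preimage H" using h uv by (simp add: preimage_def)
  next
    assume "u - v \<in> preimage H"
    then have "inv (\<phi> v) \<otimes> \<phi> u \<in> H" by (simp add: preimage_def e)
    moreover have "\<phi> u = \<phi> v \<otimes> (inv (\<phi> v) \<otimes> \<phi> u)" using uv by (simp add: m_assoc[symmetric])
    ultimately show "\<phi> u \<in> \<phi> v <# H" by (auto simp: l_coset_def)
  qed
qed

lemma image_elt_plus: "v \<in> X \<Longrightarrow> Y \<subseteq> X \<Longrightarrow> \<phi> ` (v +o Y) = \<phi> v <# \<phi> ` Y"
  using hom by (auto simp: elt_set_plus_def l_coset_def image_iff) (metis subsetD)+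

lemma image_set_plus: "Y \<subseteq> X \<Longrightarrow> Z \<subseteq> X \<Longrightarrow> \<phi> ` (Y + Z) = \<phi> ` Y <#> \<phi> ` Z"
  using hom by (auto simp: set_plus_def set_mult_def image_iff) (metis subsetD)+

end

text \<open>A function is a vector of exponents, and the indicator of x maps to x. Values outside
  the carrier do not affect the image.\<close>

lemma presentation_free:
  fixes G :: "('a, 'b) monoid_scheme" (structure)
  assumes "comm_group G" and fin: "finite (carrier G)"
  shows "presentation G (UNIV :: ('a \<Rightarrow> int) set) (\<lambda>f. finprod G (\<lambda>x. x [^]\<^bsub>G\<^esub> f x) (carrier G))"
proof -
  interpret comm_group G by fact
  let ?p = "\<lambda>f :: 'a \<Rightarrow> int. finprod G (\<lambda>x. x [^] f x) (carrier G)"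
  have "x \<in> range ?p" if x: "x \<in> carrier G" for x
  proof -
    have "?p (\<lambda>y. if y = x then 1 else 0) = finprod G (\<lambda>y. if y = x then y else \<one>) (carrier G)"
      by (rule finprod_cong') auto
    also have "\<dots> = x" using finprod_singleton_swap[OF x fin, of "\<lambda>y. y"] by simp
    finally show ?thesis by (intro range_eqI[OF sym])
  qed
  moreover have "?p f \<in> carrier G" for f by (rule finprod_closed) auto
  moreover have "?p (f + g) = ?p f \<otimes> ?p g" for f g
  proof -
    have "?p (f + g) = finprod G (\<lambda>x. x [^] f x \<otimes> x [^] g x) (carrier G)"
      by (rule finprod_cong') (auto simp: int_pow_mult)
    also have "\<dots> = ?p f \<otimes> ?p g" by (rule finprod_multf) auto
    finally show ?thesis .
  qed
  ultimately show ?thesis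
    unfolding presentation_def presentation_axioms_def add_subgroup_def using comm_group_axioms by auto
qed

section \<open>Transfer to the given group\<close>

theorem theorem1p1:
  fixes G0 :: "('a, 'b) monoid_scheme"
    and G :: "'a set" and \<gamma> \<delta> :: 'a and n :: nat
    and A :: "int set" and W :: "int multiset" and S :: "'a multiset"
  assumes "comm_group G0" and "finite (carrier G0)"
    and "subgroup G G0"
    and "\<gamma> \<in> carrier G0" and "\<delta> \<in> carrier G0"
    and "n \<ge> card G"
    and "A \<noteq> {}" and "Gcd A = 1"
    and "set_mset W = A"
    and "set_mset S \<subseteq> \<gamma> <#\<^bsub>G0\<^esub> G"
    and "\<forall>s \<in> set_mset S. {s [^]\<^bsub>G0\<^esub> a | a. a \<in> A} \<subseteq> \<delta> <#\<^bsub>G0\<^esub> G"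
    and "size S \<ge> n + davenport (G0\<lparr>carrier := G\<rparr>) A - 1"
  shows "\<exists>H \<alpha> \<beta> S' S'' S\<^sub>0.
    subgroup H (G0\<lparr>carrier := G\<rparr>) \<and>
    \<alpha> \<in> \<gamma> <#\<^bsub>G0\<^esub> G \<and> \<beta> \<in> \<delta> <#\<^bsub>G0\<^esub> G \<and>
    S' \<subseteq># S \<and> S'' \<subseteq># S' \<and> S\<^sub>0 \<subseteq># S \<and>
    (let r = size (S - S');
         q = order (G0\<lparr>carrier := G\<rparr> Mod H);
         D\<^sub>G = davenport (G0\<lparr>carrier := G\<rparr>) A;
         D\<^sub>H = davenport (G0\<lparr>carrier := H\<rparr>) A;
         D\<^sub>Q = davenport (G0\<lparr>carrier := G\<rparr> Mod H) A
     in
      (set_mset S' \<subseteq> \<alpha> <#\<^bsub>G0\<^esub> H \<and> set_mset S'' \<subseteq> \<alpha> <#\<^bsub>G0\<^esub> H \<and>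
       (\<forall>s \<in> set_mset S'. {s [^]\<^bsub>G0\<^esub> a | a. a \<in> A} \<subseteq> \<beta> <#\<^bsub>G0\<^esub> H)) \<and>
      int (size S') \<ge> min (int (size S)) (int (size S) - (int q - 2)) \<and>
      size S'' = card H + D\<^sub>H - 1 \<and>
      (\<beta> [^]\<^bsub>G0\<^esub> card H) <#\<^bsub>G0\<^esub> H = wsums_of_length G0 (set_mset W) (card H) S'' \<and>
      (wsums_of_length G0 (set_mset W) n S =
         (\<beta> [^]\<^bsub>G0\<^esub> (int n - int (card H) - int r))
           <#\<^bsub>G0\<^esub> wsums_of_length G0 (set_mset W) (card H + r) S\<^sub>0 \<and>
       wsums_of_length G0 (set_mset W) n S <#>\<^bsub>G0\<^esub> H = wsums_of_length G0 (set_mset W) n S \<and>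
       \<beta> [^]\<^bsub>G0\<^esub> n \<in> wsums_of_length G0 (set_mset W) n S) \<and>
      ((S - S') + S'' \<subseteq># S\<^sub>0 \<and>
       size S\<^sub>0 = card H + r + D\<^sub>H + D\<^sub>Q - 2 \<and>
       card H + r + D\<^sub>H + D\<^sub>Q - 2 \<le> card H + r + D\<^sub>G - 1) \<and>
      int r \<le> max 0 (int q - 2))"
proof -
  define \<phi> where "\<phi> = (\<lambda>f :: 'a \<Rightarrow> int. finprod G0 (\<lambda>x. x [^]\<^bsub>G0\<^esub> f x) (carrier G0))"
  interpret P: presentation G0 UNIV \<phi> unfolding \<phi>_def by (rule presentation_free[OF assms(1,2)])
  note G = assms(3)
  obtain a0 where a0: "a0 \<in> A" using assms(7) by blast
  interpret W: weights A a0 by unfold_locales (use a0 assms(8) in auto)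
  define K where "K = P.ker"
  define LG where "LG = P.preimage G"
  interpret PG: presentation "G0\<lparr>carrier := G\<rparr>" LG \<phi> unfolding LG_def by (rule P.presentation_subgroup[OF G])
  have kerG: "PG.ker = K" unfolding K_def LG_def by (rule P.ker_subgroup[OF G])
  have finG: "finite G" using subgroup.subset[OF G] assms(2) finite_subset by blast
  have fi: "finite_index K LG" using PG.finite_index_ker finG kerG by simp
  note f = finite_indexD[OF fi]
  have cG: "card G = ncosets K LG" using PG.order_eq_index kerG by (simp add: order_def)
  have dG: "davenport (G0\<lparr>carrier := G\<rparr>) A = dav A K LG" using PG.davenport_eq_dav[of A] kerG by simp
  define g where "g = inv_into UNIV \<phi>"
  have g: "\<phi> (g s) = s" if "s \<in> carrier G0" for s using that P.surj by (simp add: g_def f_inv_into_f)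
  have Gsub: "x <#\<^bsub>G0\<^esub> G \<subseteq> carrier G0" if "x \<in> carrier G0" for x
    using P.l_coset_subset_G[OF subgroup.subset[OF G] that] .
  have Sc: "s \<in> carrier G0" if "s \<in># S" for s using that assms(10) Gsub[OF assms(4)] by blast
  define S1 where "S1 = image_mset g S"
  have \<phi>S1: "image_mset \<phi> S1 = S"
    unfolding S1_def multiset.map_comp using Sc g by (metis (mono_tags, lifting) comp_apply image_mset_cong multiset.map_ident)
  have szS1: "size S1 = size S" by (simp add: S1_def)
  have memG: "u - v \<in> LG" if "\<phi> u \<in> x <#\<^bsub>G0\<^esub> G" "\<phi> v \<in> x <#\<^bsub>G0\<^esub> G" "x \<in> carrier G0" for u v x
  proof -
    have "u - g x \<in> LG" "v - g x \<in> LG"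
      using that P.mem_coset_iff[OF G, of u "g x"] P.mem_coset_iff[OF G, of v "g x"] g[OF that(3)] by (auto simp: LG_def)
    then show ?thesis using add_subgroup_diff[OF f(2)] by force
  qed
  have sz1: "n + dav A K LG \<le> size S1 + 1" using assms(12) dG szS1 by simp
  then have "S1 \<noteq> {#}" using assms(6) cG index_pos[OF fi] W.dav_pos[OF fi] by auto
  then obtain c where c: "c \<in># S1" by blast
  have S1S: "\<phi> s \<in># S" if "s \<in># S1" for s using that \<phi>S1 by (metis imageI set_image_mset)
  have cS: "\<forall>s\<in>#S1. s - c \<in> LG" using memG[OF _ _ assms(4)] S1S c assms(10) by blast
  have \<phi>pow: "\<phi> (of_int a * x) = \<phi> x [^]\<^bsub>G0\<^esub> a" for a x by (simp add: P.hom_of_int)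
  have inD: "\<phi> (of_int a * s) \<in> \<delta> <#\<^bsub>G0\<^esub> G" if "s \<in># S1" "a \<in> A" for s a
    using assms(11) S1S[OF that(1)] that(2) \<phi>pow by force
  \<comment> \<open>That A s lies in \<delta> + G for each term s says that terms are single modulo
    \<open>LG\<close>; the term c now takes the place of \<gamma>.\<close>
  have cs: "single A LG c" unfolding W.single_iff[OF f(2)] using memG[OF inD[OF c] inD[OF c a0] assms(5)] by blast
  obtain H1 \<alpha>1 T' T'' T0 where H1: "add_subgroup H1" "K \<subseteq> H1" "H1 \<subseteq> LG" and \<alpha>1: "\<alpha>1 - c \<in> LG" "single A H1 \<alpha>1"
    and T: "T' \<subseteq># S1" "T'' \<subseteq># T'" "T0 \<subseteq># S1" "\<forall>s\<in>#T'. s - \<alpha>1 \<in> H1"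
    and r1: "size (S1 - T') \<le> ncosets H1 LG - 2"
    and sT'': "size T'' + 1 = ncosets K H1 + dav A K H1"
    and e4: "wsumset_n A (ncosets K H1) T'' + K = (of_nat (ncosets K H1) * (of_int a0 * \<alpha>1)) +o H1"
    and e5: "wsumset_n A n S1 + K = (of_int (int n - int (ncosets K H1) - int (size (S1 - T'))) * (of_int a0 * \<alpha>1)) +o
      (wsumset_n A (ncosets K H1 + size (S1 - T')) T0 + K)"
    and e6: "(wsumset_n A n S1 + K) + H1 = wsumset_n A n S1 + K"
    and e7: "of_nat n * (of_int a0 * \<alpha>1) \<in> wsumset_n A n S1 + K"
    and T0: "(S1 - T') + T'' \<subseteq># T0" "size T0 + 2 = ncosets K H1 + size (S1 - T') + dav A K H1 + dav A H1 LG"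
    and tow: "dav A K H1 + dav A H1 LG \<le> dav A K LG + 1"
    using W.structure_of_weighted_sums[OF fi cs cS assms(6)[unfolded cG] sz1] by blast
  define H where "H = \<phi> ` H1"
  define \<alpha> where "\<alpha> = \<phi> \<alpha>1"
  define \<beta> where "\<beta> = \<phi> (of_int a0 * \<alpha>1)"
  have H: "subgroup H G0" unfolding H_def by (rule P.subgroup_image[OF H1(1)]) simp
  have LH: "P.preimage H = H1" unfolding H_def by (rule P.preimage_image[OF H1(1) _ H1(2)[unfolded K_def]]) simp
  have HG: "H \<subseteq> G" using H1(3) by (auto simp: H_def LG_def P.preimage_def)
  have HG': "subgroup H (G0\<lparr>carrier := G\<rparr>)" by (rule P.subgroup_incl[OF H G HG])
  interpret PH: presentation "G0\<lparr>carrier := H\<rparr>" H1 \<phi> using P.presentation_subgroup[OF H] LH by simp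
  have kerH: "PH.ker = K" using P.ker_subgroup[OF H] LH K_def by simp
  have cH: "card H = ncosets K H1" using PH.order_eq_index kerH by (simp add: order_def)
  have dH: "davenport (G0\<lparr>carrier := H\<rparr>) A = dav A K H1" using PH.davenport_eq_dav[of A] kerH by simp
  have pQ: "presentation (G0\<lparr>carrier := G\<rparr> Mod H) LG (\<lambda>x. H #>\<^bsub>G0\<lparr>carrier := G\<rparr>\<^esub> \<phi> x)" by (rule PG.presentation_quotient[OF HG'])
  have preH: "PG.preimage H = H1" using H1(3) LH by (auto simp: PG.preimage_def P.preimage_def)
  have kerQ: "presentation.ker (G0\<lparr>carrier := G\<rparr> Mod H) LG (\<lambda>x. H #>\<^bsub>G0\<lparr>carrier := G\<rparr>\<^esub> \<phi> x) = H1"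
    using PG.ker_quotient[OF HG'] preH by simp
  have cQ: "order (G0\<lparr>carrier := G\<rparr> Mod H) = ncosets H1 LG" using presentation.order_eq_index[OF pQ] kerQ by simp
  have dQ: "davenport (G0\<lparr>carrier := G\<rparr> Mod H) A = dav A H1 LG" using presentation.davenport_eq_dav[OF pQ, of A] kerQ by simp
  \<comment> \<open>Adding the kernel does not change images, so the K-periodic sets of the additive
    theorem carry over directly.\<close>
  have ws: "wsums_of_length G0 A k (image_mset \<phi> U) = \<phi> ` (wsumset_n A k U + K)" for k U
    using P.wsums_of_length_eq[of U A k] P.image_plus_ker[of "wsumset_n A k U"] K_def by simp
  have wsS: "wsums_of_length G0 A n S = \<phi> ` (wsumset_n A n S1 + K)" using ws[of n S1] \<phi>S1 by simp
  have d1: "1 \<le> dav A K H1" "1 \<le> dav A H1 LG"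
    using W.dav_pos[OF finite_index_lower[OF fi H1]] W.dav_pos[OF finite_index_upper[OF fi H1]] by auto
  have SS': "S - image_mset \<phi> T' = image_mset \<phi> (S1 - T')" using image_mset_Diff[OF T(1)] \<phi>S1 by metis
  have \<alpha>G: "\<alpha> \<in> \<gamma> <#\<^bsub>G0\<^esub> G"
  proof -
    have "c - g \<gamma> \<in> LG" unfolding LG_def using P.mem_coset_iff[OF G, of c "g \<gamma>"] S1S[OF c] assms(10) g[OF assms(4)] by auto
    then have "\<alpha>1 - g \<gamma> \<in> LG" using add_subgroup_diff_trans[OF f(2) \<alpha>1(1)] by blast
    then show ?thesis unfolding \<alpha>_def using P.mem_coset_iff[OF G, of \<alpha>1 "g \<gamma>"] g[OF assms(4)] by (simp add: LG_def)
  qed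
  have \<beta>G: "\<beta> \<in> \<delta> <#\<^bsub>G0\<^esub> G"
  proof -
    have "of_int a0 * c - g \<delta> \<in> LG" unfolding LG_def using P.mem_coset_iff[OF G, of "of_int a0 * c" "g \<delta>"] inD[OF c a0] g[OF assms(5)] by auto
    moreover have "of_int a0 * \<alpha>1 - of_int a0 * c \<in> LG" using add_subgroup_of_int[OF f(2) \<alpha>1(1), of a0] by (simp add: algebra_simps)
    ultimately have "of_int a0 * \<alpha>1 - g \<delta> \<in> LG" using add_subgroup_diff_trans[OF f(2)] by blast
    then show ?thesis unfolding \<beta>_def using P.mem_coset_iff[OF G, of "of_int a0 * \<alpha>1" "g \<delta>"] g[OF assms(5)] by (simp add: LG_def)
  qed
  have inH: "\<phi> s \<in> \<alpha> <#\<^bsub>G0\<^esub> H" if "s \<in># T'" for s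
    unfolding \<alpha>_def using P.mem_coset_iff[OF H, of s \<alpha>1] LH T(4) that by simp
  have A\<beta>: "{\<phi> s [^]\<^bsub>G0\<^esub> a | a. a \<in> A} \<subseteq> \<beta> <#\<^bsub>G0\<^esub> H" if s: "s \<in># T'" for s
  proof clarify
    fix a assume a: "a \<in> A"
    have "of_int a * s - of_int a0 * s \<in> H1" using W.single_cong[OF H1(1) \<alpha>1(2)] W.single_iff[OF H1(1)] T(4) s a by blast
    moreover have "of_int a0 * s - of_int a0 * \<alpha>1 \<in> H1" using add_subgroup_of_int[OF H1(1), of "s - \<alpha>1" a0] T(4) s by (simp add: algebra_simps)
    ultimately have "of_int a * s - of_int a0 * \<alpha>1 \<in> H1" using add_subgroup_diff_trans[OF H1(1)] by blast
    then show "\<phi> s [^]\<^bsub>G0\<^esub> a \<in> \<beta> <#\<^bsub>G0\<^esub> H"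
      unfolding \<beta>_def \<phi>pow[symmetric] using P.mem_coset_iff[OF H, of "of_int a * s" "of_int a0 * \<alpha>1"] LH by simp
  qed
  have E4: "(\<beta> [^]\<^bsub>G0\<^esub> card H) <#\<^bsub>G0\<^esub> H = wsums_of_length G0 A (card H) (image_mset \<phi> T'')"
    unfolding ws cH e4 \<beta>_def unfolding H_def
    by (simp only: P.image_elt_plus subset_UNIV UNIV_I P.hom_of_nat[OF UNIV_I, symmetric])
  have E5: "wsums_of_length G0 A n S =
      (\<beta> [^]\<^bsub>G0\<^esub> (int n - int (card H) - int (size (S1 - T')))) <#\<^bsub>G0\<^esub> wsums_of_length G0 A (card H + size (S1 - T')) (image_mset \<phi> T0)"
    unfolding wsS ws cH e5 \<beta>_def by (simp only: P.image_elt_plus subset_UNIV UNIV_I P.hom_of_int[OF UNIV_I, symmetric])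
  have E6: "wsums_of_length G0 A n S <#>\<^bsub>G0\<^esub> H = wsums_of_length G0 A n S"
    unfolding wsS H_def P.image_set_plus[OF subset_UNIV subset_UNIV, symmetric] e6 ..
  have E7: "\<beta> [^]\<^bsub>G0\<^esub> n \<in> wsums_of_length G0 A n S"
    unfolding wsS \<beta>_def P.hom_of_nat[OF UNIV_I, symmetric] using e7 by blast
  have szT': "size S = size T' + size (S1 - T')" using T(1) szS1 by (metis size_union subset_mset.add_diff_inverse)
  have sub: "image_mset \<phi> T' \<subseteq># S" "image_mset \<phi> T'' \<subseteq># image_mset \<phi> T'" "image_mset \<phi> T0 \<subseteq># S"
    using T image_mset_subseteq_mono[of _ _ \<phi>] \<phi>S1 by metis+
  have sub0: "image_mset \<phi> (S1 - T') + image_mset \<phi> T'' \<subseteq># image_mset \<phi> T0"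
    using image_mset_subseteq_mono[OF T0(1), of \<phi>] by simp
  have T''T': "s \<in># T'" if "s \<in># T''" for s using mset_subset_eqD[OF T(2) that] .
  show ?thesis
    unfolding Let_def assms(9)
  proof (rule exI[of _ H], rule exI[of _ \<alpha>], rule exI[of _ \<beta>], rule exI[of _ "image_mset \<phi> T'"],
      rule exI[of _ "image_mset \<phi> T''"], rule exI[of _ "image_mset \<phi> T0"], intro conjI)
    show "set_mset (image_mset \<phi> T') \<subseteq> \<alpha> <#\<^bsub>G0\<^esub> H" "set_mset (image_mset \<phi> T'') \<subseteq> \<alpha> <#\<^bsub>G0\<^esub> H"
      using inH T''T' by auto
    show "\<forall>s\<in>#image_mset \<phi> T'. {s [^]\<^bsub>G0\<^esub> a |a. a \<in> A} \<subseteq> \<beta> <#\<^bsub>G0\<^esub> H" using A\<beta> by simp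
    show "min (int (size S)) (int (size S) - (int (order (G0\<lparr>carrier := G\<rparr> Mod H)) - 2)) \<le> int (size (image_mset \<phi> T'))"
      using r1 szT' cQ by simp
    show "size (image_mset \<phi> T'') = card H + davenport (G0\<lparr>carrier := H\<rparr>) A - 1" using sT'' cH dH by simp
    show "wsums_of_length G0 A n S = (\<beta> [^]\<^bsub>G0\<^esub> (int n - int (card H) - int (size (S - image_mset \<phi> T')))) <#\<^bsub>G0\<^esub>
        wsums_of_length G0 A (card H + size (S - image_mset \<phi> T')) (image_mset \<phi> T0)"
      using E5 unfolding SS' size_image_mset .
    show "S - image_mset \<phi> T' + image_mset \<phi> T'' \<subseteq># image_mset \<phi> T0" using sub0 SS' by simp
    show "size (image_mset \<phi> T0) = card H + size (S - image_mset \<phi> T') + davenport (G0\<lparr>carrier := H\<rparr>) A +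
        davenport (G0\<lparr>carrier := G\<rparr> Mod H) A - 2"
      unfolding SS' size_image_mset cH dH dQ using T0(2) by simp
    show "card H + size (S - image_mset \<phi> T') + davenport (G0\<lparr>carrier := H\<rparr>) A + davenport (G0\<lparr>carrier := G\<rparr> Mod H) A - 2
        \<le> card H + size (S - image_mset \<phi> T') + davenport (G0\<lparr>carrier := G\<rparr>) A - 1"
      unfolding dH dQ dG using tow d1 by simp
    show "int (size (S - image_mset \<phi> T')) \<le> max 0 (int (order (G0\<lparr>carrier := G\<rparr> Mod H)) - 2)"
      unfolding SS' size_image_mset cQ using r1 by simp
  qed (fact HG' \<alpha>G \<beta>G sub E4 E6 E7)+
qed

end
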